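(* Let $X=B$ or $C$ and $n\ge1$. Suppose $\alpha_1,\dots,\alpha_r\in\mathcal W(X_n)$ satisfy $$\Delta_{X_n}^+=\Phi(\alpha_1)\sqcup\Phi(\alpha_2)\sqcup\dots\sqcup\Phi(\alpha_r)$$ with all $\Phi(\alpha_a)\ne\emptyset$, indexed so that $(1,\tilde n+1)\in\Phi(\iota(\alpha_1))$. Let $\alpha_1=\sigma_1[[\beta_{11},\dots,\beta_{1m};\beta_{1(m+1)}]]$ be the simple form expression for $\alpha_1$, with corresponding partition of $\{1,\dots,n\}$ into consecutive intervals of lengths $z_1,\dots,z_m,z_{m+1}$, where $z_{m+1}=p\geq 0$. Put $Y=B$ if $X_p\neq C_0$ and $Y=C$ if $X_p=C_0$. Then, up to reordering of $\alpha_2,\dots,\alpha_r$, there exist unique elements $\sigma_a\in\mathcal W(Y_m)$, $\beta_{ab}\in S_{z_b}$ ($1\le b\le m$) and $\beta_{a(m+1)}\in\mathcal W(X_p)$ such that $\alpha_a=\sigma_a[[\beta_{a1},\dots,\beta_{am};\beta_{a(m+1)}]]$ for $a=2,\dots,r$ and (i) $\Delta_{Y_m}^+=\Phi(\sigma_1)\sqcup\dots\sqcup\Phi(\sigma_r)$; $\ \Delta_{z_b}^+=\Phi(\beta_{1b})\sqcup\dots\sqcup\Phi(\beta_{rb})$ for $b=1,\dots,m$; and $\Delta_{X_p}^+=\Phi(\beta_{1(m+1)})\sqcup\dots\sqcup\Phi(\beta_{r(m+1)})$; (ii) if $\alpha_1$ is minus-decomposable then $\sigma_1=J$ and $\sigma_2=\dots=\sigma_r=I$;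 (iii) if $\alpha_1$ is minus-indecomposable then $\sigma_1$ is simple (in $\mathcal W(Y_m)$) and, after relabelling $\alpha_2,\dots,\alpha_r$, we have $\sigma_2=J\sigma_1$ and $\sigma_3=\dots=\sigma_r=I$. In particular, $\sigma_1$ and at most one other of the $\sigma_a$ are not equal to the identity. Let $q$ denote the number of $\sigma_a$ which are not $I$, i.e. $q=1$ if $\alpha_1$ is minus-decomposable and $q=2$ if $\alpha_1$ is minus-indecomposable, and relabel $\alpha_2,\dots,\alpha_r$ so that $\sigma_{q+1}=\dots=\sigma_r=I$. The decomposition $\Delta_{X_n}^+=\Phi(\alpha_1)\sqcup\Phi(\alpha_2)\sqcup\dots\sqcup\Phi(\alpha_r)$ is irreducible if and only if the following four conditions hold: (1) each of the decompositions listed in (i) is irreducible; (2) for each $a=q+1,\dots,r$, exactly one of $\beta_{a1},\dots,\beta_{am},\beta_{a(m+1)}$ is not equal to the identity; (3) $\beta_{ab}=I$ for $a=1,\dots,q$ and $b=1,\dots,m+1$; (4) $m=1$ if $\alpha_1$ is minus-decomposable.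
   Context: Type $A$ notation. $\alpha\in S_k$ is written $(\alpha(1),\dots,\alpha(k))$; $I_k$ is the identity, $J_k=(k,k-1,\dots,1)$; $\Delta_k^+=\{(i,j)\mid1\le i<j\le k\}$; $\Phi(\alpha)=\{(i,j)\in\Delta_k^+\mid\alpha(i)>\alpha(j)\}$. $\sqcup$ is disjoint union. A block of size $t$ of $\alpha\in S_k$ is a set of $t$ consecutive integers mapped by $\alpha$ onto a set of $t$ consecutive integers; $\alpha$ is simple if it has no block of size $t$ for $1<t<k$. Inflation: for a partition of $\{1,\dots,k\}$ into consecutive nonempty intervals $U_1,\dots,U_s$ (in increasing order), $\sigma\in S_s$ and $\beta_i\in S_{|U_i|}$, $\sigma[\beta_1,\dots,\beta_s]\in S_k$ is the unique permutation $\alpha$ such that the values of $\alpha$ on $U_i$ are order isomorphic to the sequence $\beta_i$ for all $i$, and for $a\in U_i,b\in U_j$, $i\neq j$, $\alpha(a)<\alpha(b)$ iff $\sigma(i)<\sigma(j)$. $\alpha$ is plus-decomposable (minus-decomposable) if $\alpha=I_2[\beta_1,\beta_2]$ ($\alpha=J_2[\beta_1,\beta_2]$) for some $\beta_1,\beta_2$; otherwise plus-indecomposable (minus-indecomposable). Every $\alpha\in S_k$, $k\ge2$, has a unique simple form $\alpha=\sigma[\beta_1,\dots,\beta_s]$ with $s\ge2$ and either $\sigma$ simple with $s\ge4$, or $\sigma=I_s$ with $s$ maximal (each $\beta_b$ plus-indecomposable), or $\sigma=J_s$ with $s$ maximal (each $\beta_b$ minus-indecomposable). Types $B$, $C$.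 With $\varepsilon_1,\dots,\varepsilon_n$ the standard basis of $\mathbb R^n$: $\Delta_{B_n}^+=\{\varepsilon_i\pm\varepsilon_j\mid i<j\}\sqcup\{\varepsilon_i\}$, $\Delta_{C_n}^+=\{\varepsilon_i\pm\varepsilon_j\mid i<j\}\sqcup\{2\varepsilon_i\}$. $\mathcal W(B_n)$ and $\mathcal W(C_n)$ are the group of signed permutations of $\varepsilon_1,\dots,\varepsilon_n$ (acting linearly). $\Delta^+_{X_0}=\emptyset$ and $\mathcal W(X_0)$ is trivial. For $\alpha\in\mathcal W(X_n)$, $\Phi(\alpha)=\{v\in\Delta_{X_n}^+\mid\alpha(v)\notin\Delta_{X_n}^+\}$. $I$ is the identity and $J\in\mathcal W(X_n)$ is the element with $\Phi(J)=\Delta_{X_n}^+$. Put $\tilde n=2n$ for $X=B$ and $\tilde n=2n-1$ for $X=C$. Let $\varepsilon_{\tilde n+2-i}=-\varepsilon_i$ for $1\le i\le n$ (and $\varepsilon_{n+1}=0$ for $X=B$); the embedding $\iota:\mathcal W(X_n)\hookrightarrow S_{\tilde n+1}$ is given by $\iota(\alpha)(i)=j$ iff $\alpha(\varepsilon_i)=\varepsilon_j$ (for $X=B$, $\iota(\alpha)(n+1)=n+1$). Irreducibility. In $S_k$ or in $\mathcal W(X_n)$: an element $\alpha$ is reducible if $\Phi(\alpha)$ is a disjoint union of inversion sets of elements of the same group, none of which equals $\Phi(\alpha)$; otherwise irreducible (so the identity is irreducible). A decomposition into inversion sets is irreducible if each inversion set in it (empty ones allowed) is that of an irreducible element. Inflation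 in $\mathcal W(X_n)$. Let $0\le p\le n$, let $\{1,\dots,n-p\}$ be partitioned into consecutive nonempty intervals of lengths $z_1,\dots,z_m$, let $\beta_b\in S_{z_b}$ for $1\le b\le m$, $\beta_{m+1}\in\mathcal W(X_p)$, and $\sigma\in\mathcal W(B_m)$ if $X_p\ne C_0$, $\sigma\in\mathcal W(C_m)$ if $X_p=C_0$. Then $\alpha=\sigma[[\beta_1,\dots,\beta_m;\beta_{m+1}]]\in\mathcal W(X_n)$ is the unique element with $\iota(\alpha)=\iota(\sigma)[\beta_1,\dots,\beta_m,\iota(\beta_{m+1}),J_{z_m}\beta_mJ_{z_m},\dots,J_{z_1}\beta_1J_{z_1}]$, where the middle entry is omitted if $X_p=C_0$ (then $\beta_{m+1}$ is empty and conditions on it are void). An element of $\mathcal W(X_n)$ is simple in $\mathcal W(X_n)$ if it cannot be realized as such an inflation except with $m=0$ or $m=n$. The expression $\alpha=\sigma[[\beta_1,\dots,\beta_m;\beta_{m+1}]]$ is the simple form expression for $\alpha$ if the displayed expression for $\iota(\alpha)$ is the simple form of $\iota(\alpha)$ in $S_{\tilde n+1}$. $\alpha\in\mathcal W(X_n)$ is called minus-decomposable (minus-indecomposable) if $\iota(\alpha)$ is. *)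

theory Defs
  imports Complex_Main "HOL-Library.FuncSet" "HOL-Library.Disjoint_Sets"
    "HOL-Combinatorics.Permutations"
begin

section \<open>Symmetric groups\<close>

text \<open>
  An element of \<open>S\<^sub>k\<close> is a function \<open>nat \<Rightarrow> nat\<close> with \<open>\<alpha> permutes {1..k}\<close>, so it is the identity
  outside \<open>{1..k}\<close>, and \<open>I\<^sub>k\<close> is \<^const>\<open>id\<close> for every \<open>k\<close>.
\<close>

definition symgrp :: "nat \<Rightarrow> (nat \<Rightarrow> nat) set" where
  "symgrp k = {\<alpha>. \<alpha> permutes {1..k}}"

definition revperm :: "nat \<Rightarrow> nat \<Rightarrow> nat" where
  "revperm k = (\<lambda>x. if x \<in> {1..k} then k + 1 - x else x)"

definition posA :: "nat \<Rightarrow> (nat \<times> nat) set" where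
  "posA k = {(i, j). 1 \<le> i \<and> i < j \<and> j \<le> k}"

definition invA :: "nat \<Rightarrow> (nat \<Rightarrow> nat) \<Rightarrow> (nat \<times> nat) set" where
  "invA k \<alpha> = {(i, j) \<in> posA k. \<alpha> i > \<alpha> j}"

definition block :: "nat \<Rightarrow> (nat \<Rightarrow> nat) \<Rightarrow> nat \<Rightarrow> nat set \<Rightarrow> bool" where
  "block k \<alpha> t A \<longleftrightarrow> A \<subseteq> {1..k} \<and> (\<exists>i. A = {i..<i + t}) \<and> (\<exists>j. \<alpha> ` A = {j..<j + t})"

definition simpleA :: "nat \<Rightarrow> (nat \<Rightarrow> nat) \<Rightarrow> bool" where
  "simpleA k \<alpha> \<longleftrightarrow> \<alpha> \<in> symgrp k \<and> \<not> (\<exists>t A. 1 < t \<and> t < k \<and> block k \<alpha> t A)"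

text \<open>
  Partitions into consecutive nonempty intervals are given by the lengths \<open>z 1, \<dots>, z s\<close>;
  the \<open>i\<close>-th interval is \<open>U\<^sub>i = {offset z i + 1..offset z i + z i}\<close>.
\<close>

definition offset :: "(nat \<Rightarrow> nat) \<Rightarrow> nat \<Rightarrow> nat" where
  "offset z i = (\<Sum>j = 1..<i. z j)"

definition intvl :: "(nat \<Rightarrow> nat) \<Rightarrow> nat \<Rightarrow> nat set" where
  "intvl z i = {offset z i + 1..offset z i + z i}"

text \<open>
  \<open>inflationA k \<alpha> s z \<sigma> \<beta>\<close> says that \<open>\<alpha> \<in> S\<^sub>k\<close> equals \<open>\<sigma>[\<beta> 1, \<dots>, \<beta> s]\<close> with respect to the partition
  of \<open>{1..k}\<close> into intervals of lengths \<open>z 1, \<dots>, z s\<close>. There is exactly one permutation with the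
  order properties below, so this is an equation for \<open>\<alpha>\<close>.
\<close>

definition inflationA ::
  "nat \<Rightarrow> (nat \<Rightarrow> nat) \<Rightarrow> nat \<Rightarrow> (nat \<Rightarrow> nat) \<Rightarrow> (nat \<Rightarrow> nat) \<Rightarrow> (nat \<Rightarrow> nat \<Rightarrow> nat) \<Rightarrow> bool" where
  "inflationA k \<alpha> s z \<sigma> \<beta> \<longleftrightarrow>
     \<alpha> \<in> symgrp k \<and> \<sigma> \<in> symgrp s \<and>
     (\<Sum>i = 1..s. z i) = k \<and>
     (\<forall>i\<in>{1..s}. 1 \<le> z i \<and> \<beta> i \<in> symgrp (z i)) \<and>
     (\<forall>i\<in>{1..s}. \<forall>x\<in>{1..z i}. \<forall>y\<in>{1..z i}.
        \<alpha> (offset z i + x) < \<alpha> (offset z i + y) \<longleftrightarrow> \<beta> i x < \<beta> i y) \<and>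
     (\<forall>i\<in>{1..s}. \<forall>j\<in>{1..s}. i \<noteq> j \<longrightarrow>
        (\<forall>a\<in>intvl z i. \<forall>b\<in>intvl z j. \<alpha> a < \<alpha> b \<longleftrightarrow> \<sigma> i < \<sigma> j))"

definition plus_decomposable :: "nat \<Rightarrow> (nat \<Rightarrow> nat) \<Rightarrow> bool" where
  "plus_decomposable k \<alpha> \<longleftrightarrow> (\<exists>z \<beta>. inflationA k \<alpha> 2 z id \<beta>)"

definition minus_decomposable :: "nat \<Rightarrow> (nat \<Rightarrow> nat) \<Rightarrow> bool" where
  "minus_decomposable k \<alpha> \<longleftrightarrow> (\<exists>z \<beta>. inflationA k \<alpha> 2 z (revperm 2) \<beta>)"

definition simple_formA ::
  "nat \<Rightarrow> (nat \<Rightarrow> nat) \<Rightarrow> nat \<Rightarrow> (nat \<Rightarrow> nat) \<Rightarrow> (nat \<Rightarrow> nat) \<Rightarrow> (nat \<Rightarrow> nat \<Rightarrow> nat) \<Rightarrow> bool" where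
  "simple_formA k \<alpha> s z \<sigma> \<beta> \<longleftrightarrow>
     inflationA k \<alpha> s z \<sigma> \<beta> \<and> 2 \<le> s \<and>
     (4 \<le> s \<and> simpleA s \<sigma>
      \<or> \<sigma> = id \<and> (\<forall>i\<in>{1..s}. \<not> plus_decomposable (z i) (\<beta> i))
      \<or> \<sigma> = revperm s \<and> (\<forall>i\<in>{1..s}. \<not> minus_decomposable (z i) (\<beta> i)))"


section \<open>Types B and C\<close>

datatype bctype = TypeB | TypeC

text \<open>
  Vectors of \<open>\<real>\<^sup>n\<close> are functions \<open>nat \<Rightarrow> real\<close> supported in \<open>{1..n}\<close>. The standard basis is extended to
  integer indices by \<open>eps (- i) = - eps i\<close> and \<open>eps 0 = 0\<close>. A signed permutation is given by its
  action on the indices of \<open>\<plusminus>\<epsilon>\<^sub>1, \<dots>, \<plusminus>\<epsilon>\<^sub>n\<close>: \<open>w i = j\<close> means \<open>w(\<epsilon>\<^sub>i) = \<epsilon>\<^sub>j\<close> and \<open>w i = - j\<close> means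
  \<open>w(\<epsilon>\<^sub>i) = - \<epsilon>\<^sub>j\<close>. The identity is \<^const>\<open>id\<close> and the product is \<open>\<circ>\<close>.
\<close>

definition eps :: "int \<Rightarrow> nat \<Rightarrow> real" where
  "eps i = (\<lambda>k. if int k = \<bar>i\<bar> then of_int (sgn i) else 0)"

definition weyl :: "nat \<Rightarrow> (int \<Rightarrow> int) set" where
  "weyl n = {w. w permutes ({- int n..int n} - {0}) \<and> (\<forall>i. w (- i) = - w i)}"

definition act :: "nat \<Rightarrow> (int \<Rightarrow> int) \<Rightarrow> (nat \<Rightarrow> real) \<Rightarrow> (nat \<Rightarrow> real)" where
  "act n w v = (\<lambda>k. \<Sum>i = 1..n. v i * eps (w (int i)) k)"

definition pos_roots :: "bctype \<Rightarrow> nat \<Rightarrow> (nat \<Rightarrow> real) set" where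
  "pos_roots X n =
     {(\<lambda>k. eps i k + eps j k) | i j. 1 \<le> i \<and> i < j \<and> j \<le> int n} \<union>
     {(\<lambda>k. eps i k - eps j k) | i j. 1 \<le> i \<and> i < j \<and> j \<le> int n} \<union>
     (case X of
        TypeB \<Rightarrow> {eps i | i. 1 \<le> i \<and> i \<le> int n}
      | TypeC \<Rightarrow> {(\<lambda>k. 2 * eps i k) | i. 1 \<le> i \<and> i \<le> int n})"

definition invBC :: "bctype \<Rightarrow> nat \<Rightarrow> (int \<Rightarrow> int) \<Rightarrow> (nat \<Rightarrow> real) set" where
  "invBC X n \<alpha> = {v \<in> pos_roots X n. act n \<alpha> v \<notin> pos_roots X n}"

definition longest :: "bctype \<Rightarrow> nat \<Rightarrow> (int \<Rightarrow> int)" where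
  "longest X n = (THE w. w \<in> weyl n \<and> invBC X n w = pos_roots X n)"

text \<open>The degree \<open>\<tilde>n + 1\<close> of the symmetric group into which \<open>\<W>(X\<^sub>n)\<close> embeds.\<close>

definition deg :: "bctype \<Rightarrow> nat \<Rightarrow> nat" where
  "deg X n = (case X of TypeB \<Rightarrow> 2 * n + 1 | TypeC \<Rightarrow> 2 * n)"

text \<open>
  The vectors \<open>\<epsilon>\<^sub>1, \<dots>, \<epsilon>\<^bsub>\<tilde>n+1\<^esub>\<close>, where \<open>\<epsilon>\<^bsub>\<tilde>n+2-i\<^esub> = - \<epsilon>\<^sub>i\<close> for \<open>1 \<le> i \<le> n\<close>, and \<open>\<epsilon>\<^bsub>n+1\<^esub> = 0\<close> in type B.
\<close>

definition epsx :: "bctype \<Rightarrow> nat \<Rightarrow> nat \<Rightarrow> nat \<Rightarrow> real" where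
  "epsx X n i =
     (if i \<le> n then eps (int i)
      else if X = TypeB \<and> i = n + 1 then (\<lambda>k. 0)
      else (\<lambda>k. - eps (int (deg X n + 1 - i)) k))"

definition iota :: "bctype \<Rightarrow> nat \<Rightarrow> (int \<Rightarrow> int) \<Rightarrow> nat \<Rightarrow> nat" where
  "iota X n \<alpha> =
     (\<lambda>i. if i \<in> {1..deg X n}
          then (THE j. j \<in> {1..deg X n} \<and> act n \<alpha> (epsx X n i) = epsx X n j)
          else i)"

definition minus_decomposableBC :: "bctype \<Rightarrow> nat \<Rightarrow> (int \<Rightarrow> int) \<Rightarrow> bool" where
  "minus_decomposableBC X n \<alpha> \<longleftrightarrow> minus_decomposable (deg X n) (iota X n \<alpha>)"


section \<open>Inflation in types B and C\<close>

text \<open>The type \<open>Y\<close> of the outer element: C if \<open>X\<^sub>p = C\<^sub>0\<close>, and B otherwise.\<close>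

definition outer :: "bctype \<Rightarrow> nat \<Rightarrow> bctype" where
  "outer X p = (if X = TypeC \<and> p = 0 then TypeC else TypeB)"

text \<open>
  The lengths and entries of
  \<open>\<iota>(\<sigma>)[\<beta>\<^sub>1, \<dots>, \<beta>\<^sub>m, \<iota>(\<beta>\<^bsub>m+1\<^esub>), J\<beta>\<^sub>mJ, \<dots>, J\<beta>\<^sub>1J]\<close>. It has \<open>deg (outer X p) m\<close> entries, that is,
  \<open>2m + 1\<close>, or \<open>2m\<close> when \<open>X\<^sub>p = C\<^sub>0\<close> and the middle entry is omitted. The element \<open>\<beta>\<^bsub>m+1\<^esub>\<close> is the
  separate argument \<open>\<gamma>\<close>.
\<close>

definition sym_lengths :: "bctype \<Rightarrow> nat \<Rightarrow> (nat \<Rightarrow> nat) \<Rightarrow> nat \<Rightarrow> nat \<Rightarrow> nat" where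
  "sym_lengths X m z p i =
     (if i \<le> m then z i
      else if outer X p = TypeB \<and> i = m + 1 then deg X p
      else z (deg (outer X p) m + 1 - i))"

definition sym_entries ::
  "bctype \<Rightarrow> nat \<Rightarrow> (nat \<Rightarrow> nat) \<Rightarrow> nat \<Rightarrow> (nat \<Rightarrow> nat \<Rightarrow> nat) \<Rightarrow> (int \<Rightarrow> int) \<Rightarrow> nat \<Rightarrow> nat \<Rightarrow> nat" where
  "sym_entries X m z p \<beta> \<gamma> i =
     (if i \<le> m then \<beta> i
      else if outer X p = TypeB \<and> i = m + 1 then iota X p \<gamma>
      else (let b = deg (outer X p) m + 1 - i in revperm (z b) \<circ> \<beta> b \<circ> revperm (z b)))"

text \<open>\<open>\<alpha> = \<sigma>[[\<beta> 1, \<dots>, \<beta> m; \<gamma>]]\<close> in \<open>\<W>(X\<^sub>n)\<close>, with interval lengths \<open>z 1, \<dots>, z m\<close> and \<open>\<gamma> \<in> \<W>(X\<^sub>p)\<close>.\<close>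

definition inflationBC ::
  "bctype \<Rightarrow> nat \<Rightarrow> (int \<Rightarrow> int) \<Rightarrow> nat \<Rightarrow> (nat \<Rightarrow> nat) \<Rightarrow> nat \<Rightarrow>
   (int \<Rightarrow> int) \<Rightarrow> (nat \<Rightarrow> nat \<Rightarrow> nat) \<Rightarrow> (int \<Rightarrow> int) \<Rightarrow> bool" where
  "inflationBC X n \<alpha> m z p \<sigma> \<beta> \<gamma> \<longleftrightarrow>
     (\<Sum>b = 1..m. z b) + p = n \<and>
     (\<forall>b\<in>{1..m}. 1 \<le> z b \<and> \<beta> b \<in> symgrp (z b)) \<and>
     \<gamma> \<in> weyl p \<and> \<sigma> \<in> weyl m \<and> \<alpha> \<in> weyl n \<and>
     inflationA (deg X n) (iota X n \<alpha>) (deg (outer X p) m)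
       (sym_lengths X m z p) (iota (outer X p) m \<sigma>) (sym_entries X m z p \<beta> \<gamma>)"

definition simpleBC :: "bctype \<Rightarrow> nat \<Rightarrow> (int \<Rightarrow> int) \<Rightarrow> bool" where
  "simpleBC X n \<alpha> \<longleftrightarrow> \<alpha> \<in> weyl n \<and>
     \<not> (\<exists>m z p \<sigma> \<beta> \<gamma>. m \<noteq> 0 \<and> m \<noteq> n \<and> inflationBC X n \<alpha> m z p \<sigma> \<beta> \<gamma>)"

definition simple_formBC ::
  "bctype \<Rightarrow> nat \<Rightarrow> (int \<Rightarrow> int) \<Rightarrow> nat \<Rightarrow> (nat \<Rightarrow> nat) \<Rightarrow> nat \<Rightarrow>
   (int \<Rightarrow> int) \<Rightarrow> (nat \<Rightarrow> nat \<Rightarrow> nat) \<Rightarrow> (int \<Rightarrow> int) \<Rightarrow> bool" where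
  "simple_formBC X n \<alpha> m z p \<sigma> \<beta> \<gamma> \<longleftrightarrow>
     inflationBC X n \<alpha> m z p \<sigma> \<beta> \<gamma> \<and>
     simple_formA (deg X n) (iota X n \<alpha>) (deg (outer X p) m)
       (sym_lengths X m z p) (iota (outer X p) m \<sigma>) (sym_entries X m z p \<beta> \<gamma>)"


section \<open>Decompositions and irreducibility\<close>

definition disj_union :: "'v set \<Rightarrow> nat \<Rightarrow> (nat \<Rightarrow> 'v set) \<Rightarrow> bool" where
  "disj_union D r F \<longleftrightarrow> D = (\<Union>a\<in>{1..r}. F a) \<and> disjoint_family_on F {1..r}"

text \<open>
  A group is represented by its set \<open>G\<close> of elements together with its inversion set function \<open>\<Phi>\<close>.
  The condition \<open>1 \<le> r\<close> excludes the empty union, so that the identity is irreducible.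
\<close>

definition reducible :: "'g set \<Rightarrow> ('g \<Rightarrow> 'v set) \<Rightarrow> 'g \<Rightarrow> bool" where
  "reducible G \<Phi> \<alpha> \<longleftrightarrow>
     (\<exists>r \<gamma>. 1 \<le> r \<and> (\<forall>a\<in>{1..r}. \<gamma> a \<in> G \<and> \<Phi> (\<gamma> a) \<noteq> \<Phi> \<alpha>) \<and>
            disj_union (\<Phi> \<alpha>) r (\<lambda>a. \<Phi> (\<gamma> a)))"

definition irreducible_decomp :: "'g set \<Rightarrow> ('g \<Rightarrow> 'v set) \<Rightarrow> nat \<Rightarrow> (nat \<Rightarrow> 'v set) \<Rightarrow> bool" where
  "irreducible_decomp G \<Phi> r F \<longleftrightarrow>
     (\<forall>a\<in>{1..r}. \<exists>\<gamma>\<in>G. F a = \<Phi> \<gamma> \<and> \<not> reducible G \<Phi> \<gamma>)"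

text \<open>
  \<open>\<alpha> 1, \<dots>, \<alpha> r\<close> are given, and \<open>(m, z, p, \<sigma>\<^sub>1, \<beta>\<^sub>1, \<gamma>\<^sub>1)\<close> describes the simple form of \<open>\<alpha> 1\<close>.
  The predicate collects everything required of the elements \<open>\<sigma> a\<close>, \<open>\<beta> a b\<close> and \<open>\<gamma> a\<close>
  (the latter in the role of \<open>\<beta>\<^bsub>a(m+1)\<^esub>\<close>). Membership in extensional function spaces makes
  uniqueness of these elements the same as uniqueness of the functions \<open>\<sigma>\<close>, \<open>\<beta>\<close> and \<open>\<gamma>\<close>.
  The indexing by \<open>a\<close> follows the given one of the \<open>\<alpha> a\<close>; the permutation \<open>\<pi>\<close> of \<open>{2..r}\<close> in the
  last condition is the relabelling of \<open>\<alpha> 2, \<dots>, \<alpha> r\<close>.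
\<close>

definition inflated_decomp ::
  "bctype \<Rightarrow> nat \<Rightarrow> nat \<Rightarrow> (nat \<Rightarrow> int \<Rightarrow> int) \<Rightarrow> nat \<Rightarrow> (nat \<Rightarrow> nat) \<Rightarrow> nat \<Rightarrow>
   (int \<Rightarrow> int) \<Rightarrow> (nat \<Rightarrow> nat \<Rightarrow> nat) \<Rightarrow> (int \<Rightarrow> int) \<Rightarrow>
   (nat \<Rightarrow> int \<Rightarrow> int) \<Rightarrow> (nat \<Rightarrow> nat \<Rightarrow> nat \<Rightarrow> nat) \<Rightarrow> (nat \<Rightarrow> int \<Rightarrow> int) \<Rightarrow> bool" where
  "inflated_decomp X n r \<alpha> m z p \<sigma>\<^sub>1 \<beta>\<^sub>1 \<gamma>\<^sub>1 \<sigma> \<beta> \<gamma> \<longleftrightarrow>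
     \<sigma> \<in> {1..r} \<rightarrow>\<^sub>E weyl m \<and>
     \<beta> \<in> {1..r} \<rightarrow>\<^sub>E (\<Pi>\<^sub>E b\<in>{1..m}. symgrp (z b)) \<and>
     \<gamma> \<in> {1..r} \<rightarrow>\<^sub>E weyl p \<and>
     \<sigma> 1 = \<sigma>\<^sub>1 \<and> (\<forall>b\<in>{1..m}. \<beta> 1 b = \<beta>\<^sub>1 b) \<and> \<gamma> 1 = \<gamma>\<^sub>1 \<and>
     (\<forall>a\<in>{2..r}. inflationBC X n (\<alpha> a) m z p (\<sigma> a) (\<beta> a) (\<gamma> a)) \<and>
     disj_union (pos_roots (outer X p) m) r (\<lambda>a. invBC (outer X p) m (\<sigma> a)) \<and>
     (\<forall>b\<in>{1..m}. disj_union (posA (z b)) r (\<lambda>a. invA (z b) (\<beta> a b))) \<and>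
     disj_union (pos_roots X p) r (\<lambda>a. invBC X p (\<gamma> a)) \<and>
     (minus_decomposableBC X n (\<alpha> 1) \<longrightarrow>
        \<sigma> 1 = longest (outer X p) m \<and> (\<forall>a\<in>{2..r}. \<sigma> a = id)) \<and>
     (\<not> minus_decomposableBC X n (\<alpha> 1) \<longrightarrow>
        simpleBC (outer X p) m (\<sigma> 1) \<and>
        (\<exists>\<pi>. \<pi> permutes {2..r} \<and> 2 \<le> r \<and>
             \<sigma> (\<pi> 2) = longest (outer X p) m \<circ> \<sigma> 1 \<and>
             (\<forall>a\<in>{3..r}. \<sigma> (\<pi> a) = id)))"

end

theory Submission
  imports Defs
begin

text \<open>
  Via \<open>\<iota>\<close>, inversion sets in \<open>\<W>(X\<^sub>n)\<close> become inversion sets of permutations that commute with the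
  reversal \<open>J\<close>, and a decomposition of \<open>\<Delta>\<^sup>+\<close> becomes a colouring \<open>c\<close> of the pairs \<open>i < j\<close> for which
  \<open>c(i, k) \<in> {c(i, j), c(j, k)}\<close> whenever \<open>i < j < k\<close>. In such a colouring the connected components of
  each colour are intervals that are blocks of all the permutations involved, and at most two colours
  are connected on the whole vertex set. If \<open>\<sigma>\<^sub>1\<close> is simple, every colour occurring between two blocks
  of \<open>\<alpha>\<^sub>1\<close> is connected on the whole vertex set, so besides the colour of \<open>\<alpha>\<^sub>1\<close> only one further colour
  occurs there. Hence all \<open>\<alpha>\<^sub>a\<close> are inflations over the partition of \<open>\<alpha>\<^sub>1\<close>. As inversion sets of
  inflations are assembled independently from those of their components, this reduces irreducibility to
  the components, and the same colouring argument shows that \<open>\<sigma>\<^sub>1[[I, \<dots>, I; I]]\<close> is irreducible.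
\<close>

section \<open>Permutations and their inversion sets\<close>

text \<open>The triangle condition on colours rests on inversion sets being closed under composable
  pairs and on their complements being closed too. Membership in the signed group comes from
  uniqueness: the mirror image of an inflation with palindromic data is an inflation with the same
  data, hence equal to it, and so it lies in the image of \<open>iota\<close>. For irreducibility
  only the inversion set of one element is decomposed; its non-inversions then get an extra colour
  0, which takes over the part that the colour of \<alpha>1 plays in the decomposition of all
  positive roots. For the structure statement this is harmless, since all pairs between intervals
  then have colour 1. For irreducibility, J splits into w and Jw for any w other than I and J, and
  such w exist as soon as m is at least 2. For m = 1 the mirror symmetry of the colouring is what
  forces a single colour; in the symmetric group it fails, as the inversion set of J_3 is the
  disjoint union of {(1,2)} and {(1,3),(2,3)}.\<close>

lemma symgrp_in: "\<alpha> \<in> symgrp k \<Longrightarrow> x \<in> {1..k} \<Longrightarrow> \<alpha> x \<in> {1..k}"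
  unfolding symgrp_def by (simp only: mem_Collect_eq permutes_in_image)

lemma symgrp_out: "\<alpha> \<in> symgrp k \<Longrightarrow> x \<notin> {1..k} \<Longrightarrow> \<alpha> x = x"
  unfolding symgrp_def by (auto dest: permutes_not_in)

lemma symgrp_eq_iff: "\<alpha> \<in> symgrp k \<Longrightarrow> \<alpha> x = \<alpha> y \<longleftrightarrow> x = y"
  unfolding symgrp_def by (simp only: mem_Collect_eq inj_eq[OF permutes_inj])

lemma symgrp_surj:
  assumes "\<alpha> \<in> symgrp k" "y \<in> {1..k}"
  obtains x where "x \<in> {1..k}" "\<alpha> x = y"
proof -
  have "y \<in> \<alpha> ` {1..k}" using assms permutes_image[of \<alpha> "{1..k}"] unfolding symgrp_def by simp
  then show ?thesis using that by blast
qed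

lemma symgrpI:
  assumes "\<And>x. x \<in> {1..k} \<Longrightarrow> \<alpha> x \<in> {1..k}" "inj_on \<alpha> {1..k}" "\<And>x. x \<notin> {1..k} \<Longrightarrow> \<alpha> x = x"
  shows "\<alpha> \<in> symgrp k"
  unfolding symgrp_def using inj_imp_permutes[of \<alpha> "{1..k}"] assms by auto

lemma id_symgrp: "id \<in> symgrp k"
  unfolding symgrp_def by (simp add: permutes_id)

lemma symgrp_comp: "\<alpha> \<in> symgrp k \<Longrightarrow> \<beta> \<in> symgrp k \<Longrightarrow> \<alpha> \<circ> \<beta> \<in> symgrp k"
  unfolding symgrp_def by (simp add: permutes_compose)

lemma revperm_symgrp: "revperm k \<in> symgrp k"
  by (rule symgrpI) (auto simp: revperm_def inj_on_def)

text \<open>A value is its own rank, because \<open>\<alpha>\<close> maps the points with value at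
  most \<open>\<alpha> x\<close> bijectively onto \<open>{1..\<alpha> x}\<close>. Hence the order of
  the values determines a permutation, which is the source of the uniqueness of inflations and of
  their components.\<close>

lemma perm_eq_card:
  assumes "\<alpha> \<in> symgrp k" "x \<in> {1..k}"
  shows "\<alpha> x = card {y \<in> {1..k}. \<alpha> y \<le> \<alpha> x}"
proof -
  have "\<alpha> ` {y \<in> {1..k}. \<alpha> y \<le> \<alpha> x} = {1..\<alpha> x}"
  proof (intro equalityI subsetI)
    fix v assume "v \<in> \<alpha> ` {y \<in> {1..k}. \<alpha> y \<le> \<alpha> x}"
    then show "v \<in> {1..\<alpha> x}" using symgrp_in[OF assms(1)] by force
  next
    fix v assume v: "v \<in> {1..\<alpha> x}"
    then have "v \<in> {1..k}" using symgrp_in[OF assms] by simp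
    then obtain y where "y \<in> {1..k}" "\<alpha> y = v" using symgrp_surj[OF assms(1)] by blast
    then show "v \<in> \<alpha> ` {y \<in> {1..k}. \<alpha> y \<le> \<alpha> x}" using v by auto
  qed
  moreover have "inj_on \<alpha> A" for A using symgrp_eq_iff[OF assms(1)] by (auto simp: inj_on_def)
  ultimately show ?thesis
    using card_image[of \<alpha> "{y \<in> {1..k}. \<alpha> y \<le> \<alpha> x}"] by simp
qed

lemma symgrp_eqI_order:
  assumes "\<alpha> \<in> symgrp k" "\<beta> \<in> symgrp k"
    and "\<And>x y. x \<in> {1..k} \<Longrightarrow> y \<in> {1..k} \<Longrightarrow> \<alpha> x < \<alpha> y \<longleftrightarrow> \<beta> x < \<beta> y"
  shows "\<alpha> = \<beta>"
proof
  fix x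
  show "\<alpha> x = \<beta> x"
  proof (cases "x \<in> {1..k}")
    case True
    then have "{y \<in> {1..k}. \<alpha> y \<le> \<alpha> x} = {y \<in> {1..k}. \<beta> y \<le> \<beta> x}"
      using assms(3) by (auto simp: not_less[symmetric])
    then show ?thesis using perm_eq_card[OF assms(1) True] perm_eq_card[OF assms(2) True] by simp
  qed (simp add: symgrp_out[OF assms(1)] symgrp_out[OF assms(2)])
qed

text \<open>Each point is sent to its rank, the size of its down-set \<open>D x\<close>;
  transitivity and irreflexivity make down-sets grow strictly. This builds inflations and their
  inner permutations from their order patterns without explicit formulas.\<close>

lemma perm_of_order:
  assumes irr: "\<And>x. x \<in> {1..k} \<Longrightarrow> \<not> R x x"
    and tr: "\<And>x y w. x \<in> {1..k} \<Longrightarrow> y \<in> {1..k} \<Longrightarrow> w \<in> {1..k} \<Longrightarrow> R x y \<Longrightarrow> R y w \<Longrightarrow> R x w"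
    and tot: "\<And>x y. x \<in> {1..k} \<Longrightarrow> y \<in> {1..k} \<Longrightarrow> x \<noteq> y \<Longrightarrow> R x y \<or> R y x"
  obtains \<alpha> where "\<alpha> \<in> symgrp k" "\<And>x y. x \<in> {1..k} \<Longrightarrow> y \<in> {1..k} \<Longrightarrow> \<alpha> x < \<alpha> y \<longleftrightarrow> R x y"
proof
  define D where "D x = {y \<in> {1..k}. y = x \<or> R y x}" for x
  define \<alpha> where "\<alpha> x = (if x \<in> {1..k} then card (D x) else x)" for x
  have fin: "finite (D x)" for x by (simp add: D_def)
  have less: "\<alpha> x < \<alpha> y" if "x \<in> {1..k}" "y \<in> {1..k}" "R x y" for x y
  proof -
    have "D x \<subseteq> D y" using that tr unfolding D_def by blast
    moreover have "y \<in> D y" "y \<notin> D x" using that irr tr unfolding D_def by blast+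
    ultimately have "D x \<subset> D y" by blast
    then show ?thesis using that fin by (simp add: \<alpha>_def psubset_card_mono)
  qed
  show "\<alpha> \<in> symgrp k"
  proof (rule symgrpI)
    fix x assume x: "x \<in> {1..k}"
    have "D x \<subseteq> {1..k}" "D x \<noteq> {}" using x by (auto simp: D_def)
    then have "card (D x) \<le> k" "0 < card (D x)" using card_mono[of "{1..k}" "D x"] fin by (auto simp: card_gt_0_iff)
    then show "\<alpha> x \<in> {1..k}" using x by (simp add: \<alpha>_def)
  next
    show "inj_on \<alpha> {1..k}" by (rule inj_onI) (metis less less_irrefl tot)
  qed (auto simp: \<alpha>_def)
  show "\<alpha> x < \<alpha> y \<longleftrightarrow> R x y" if "x \<in> {1..k}" "y \<in> {1..k}" for x y
    using that less tot by (metis less_asym less_irrefl)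
qed

text \<open>No order of \<open>x\<close> and \<open>y\<close> is assumed: the second disjunct
  already forces \<open>y < x\<close>, and for \<open>x = y\<close> both sides are false.\<close>

lemma invA_less_iff:
  assumes "\<alpha> \<in> symgrp k" "x \<in> {1..k}" "y \<in> {1..k}"
  shows "\<alpha> x < \<alpha> y \<longleftrightarrow> x < y \<and> (x, y) \<notin> invA k \<alpha> \<or> (y, x) \<in> invA k \<alpha>"
  using assms symgrp_eq_iff[OF assms(1), of x y] unfolding invA_def posA_def by force

lemma invA_subset: "invA k \<alpha> \<subseteq> posA k"
  unfolding invA_def by blast

lemma invA_inject: "\<alpha> \<in> symgrp k \<Longrightarrow> \<beta> \<in> symgrp k \<Longrightarrow> invA k \<alpha> = invA k \<beta> \<Longrightarrow> \<alpha> = \<beta>"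
  by (rule symgrp_eqI_order) (auto simp: invA_less_iff)

lemma invA_id [simp]: "invA k id = {}"
  unfolding invA_def posA_def by auto

lemma invA_eq_empty_iff: "\<alpha> \<in> symgrp k \<Longrightarrow> invA k \<alpha> = {} \<longleftrightarrow> \<alpha> = id"
  using invA_inject[OF _ id_symgrp] by auto

lemma invA_revperm [simp]: "invA k (revperm k) = posA k"
  unfolding invA_def posA_def revperm_def by auto

lemma revperm_less_iff: "x \<in> {1..k} \<Longrightarrow> y \<in> {1..k} \<Longrightarrow> revperm k x < revperm k y \<longleftrightarrow> y < x"
  unfolding revperm_def by auto

lemma invA_rev_comp:
  assumes "\<alpha> \<in> symgrp k"
  shows "invA k (revperm k \<circ> \<alpha>) = posA k - invA k \<alpha>"
proof -
  have "\<alpha> y < \<alpha> x \<longleftrightarrow> \<not> revperm k (\<alpha> y) < revperm k (\<alpha> x)" if "(x, y) \<in> posA k" for x y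
  proof -
    have "x \<in> {1..k}" "y \<in> {1..k}" "\<alpha> x \<noteq> \<alpha> y"
      using that symgrp_eq_iff[OF assms] by (auto simp: posA_def)
    then show ?thesis using symgrp_in[OF assms] revperm_less_iff[of _ k] by fastforce
  qed
  then show ?thesis unfolding invA_def by auto
qed

text \<open>Closedness; the next lemma is the same property of the complement. Together they yield
  the triangle condition in \<open>colouring_of_disj_union\<close>.\<close>

lemma invA_trans:
  "(x, y) \<in> invA k \<alpha> \<Longrightarrow> (y, w) \<in> invA k \<alpha> \<Longrightarrow> (x, w) \<in> invA k \<alpha>"
  unfolding invA_def posA_def by auto

lemma invA_cotrans:
  "(x, w) \<in> invA k \<alpha> \<Longrightarrow> x < y \<Longrightarrow> y < w \<Longrightarrow> (x, y) \<in> invA k \<alpha> \<or> (y, w) \<in> invA k \<alpha>"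
  unfolding invA_def posA_def by auto

section \<open>Partitions into intervals\<close>

definition composition :: "nat \<Rightarrow> nat \<Rightarrow> (nat \<Rightarrow> nat) \<Rightarrow> bool" where
  "composition k s z \<longleftrightarrow> (\<Sum>i = 1..s. z i) = k \<and> (\<forall>i\<in>{1..s}. 1 \<le> z i)"

definition blk :: "(nat \<Rightarrow> nat) \<Rightarrow> nat \<Rightarrow> nat \<Rightarrow> nat" where
  "blk z s x = (THE i. i \<in> {1..s} \<and> x \<in> intvl z i)"

text \<open>Positions inside an interval count from 1, so \<open>(blk, loc)\<close> inverts the map
  from \<open>(i, x)\<close> to \<open>offset z i + x\<close>.\<close>

definition loc :: "(nat \<Rightarrow> nat) \<Rightarrow> nat \<Rightarrow> nat \<Rightarrow> nat" where
  "loc z s x = x - offset z (blk z s x)"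

lemma offset_Suc: "1 \<le> i \<Longrightarrow> offset z (Suc i) = offset z i + z i"
  unfolding offset_def by simp

lemma offset_mono:
  assumes "1 \<le> i" "i < j"
  shows "offset z i + z i \<le> offset z j"
  using assms(2)
proof (induction j)
  case (Suc j)
  then show ?case using offset_Suc[of j z] offset_Suc[of i z] assms(1)
    by (cases "i = j") auto
qed simp

lemma offset_le:
  assumes "composition k s z" "i \<in> {1..s}"
  shows "offset z i + z i \<le> k"
proof -
  have "offset z (Suc s) = k"
    using assms(1) unfolding composition_def offset_def by (simp add: atLeastLessThanSuc_atLeastAtMost)
  then show ?thesis using offset_mono[of i "Suc s" z] assms(2) by simp
qed

lemma intvl_less: "x \<in> intvl z i \<Longrightarrow> y \<in> intvl z j \<Longrightarrow> 1 \<le> i \<Longrightarrow> i < j \<Longrightarrow> x < y"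
  using offset_mono[of i j z] unfolding intvl_def by simp

lemma intvl_ex:
  assumes "composition k s z" "x \<in> {1..k}"
  shows "\<exists>i\<in>{1..s}. x \<in> intvl z i"
proof -
  have "x \<le> offset z (Suc j) \<Longrightarrow> \<exists>i\<in>{1..j}. x \<in> intvl z i" for j
  proof (induction j)
    case 0
    then show ?case using assms(2) by (simp add: offset_def)
  next
    case (Suc j)
    then show ?case
      by (cases "x \<le> offset z (Suc j)") (force simp: intvl_def offset_Suc)+
  qed
  moreover have "offset z (Suc s) = k"
    using assms(1) unfolding composition_def offset_def by (simp add: atLeastLessThanSuc_atLeastAtMost)
  ultimately show ?thesis using assms(2) by simp
qed

lemma blk_eq:
  assumes "i \<in> {1..s}" "x \<in> intvl z i"
  shows "blk z s x = i"
  unfolding blk_def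
proof (rule the_equality)
  fix j assume "j \<in> {1..s} \<and> x \<in> intvl z j"
  then show "j = i" using assms intvl_less[of x z i x j] intvl_less[of x z j x i]
    by (cases i j rule: linorder_cases) auto
qed (use assms in simp)

lemma blk_in:
  assumes "composition k s z" "x \<in> {1..k}"
  shows "blk z s x \<in> {1..s}" "x \<in> intvl z (blk z s x)"
  using intvl_ex[OF assms] blk_eq[of _ s x z] by auto

lemma blk_less:
  assumes "composition k s z" "x \<in> {1..k}" "y \<in> {1..k}" "blk z s x < blk z s y"
  shows "x < y"
  using intvl_less[OF blk_in(2)[OF assms(1,2)] blk_in(2)[OF assms(1,3)]] assms(4)
    blk_in(1)[OF assms(1,2)] by simp

lemma blk_mono:
  assumes "composition k s z" "x \<in> {1..k}" "y \<in> {1..k}" "x \<le> y"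
  shows "blk z s x \<le> blk z s y"
  using blk_less[OF assms(1,3,2)] assms(4) by linarith

lemma loc_in:
  assumes "composition k s z" "x \<in> {1..k}"
  shows "loc z s x \<in> {1..z (blk z s x)}" "offset z (blk z s x) + loc z s x = x"
  using blk_in(2)[OF assms] unfolding loc_def intvl_def by auto

lemma loc_less_iff:
  assumes "composition k s z" "x \<in> {1..k}" "y \<in> {1..k}" "blk z s x = blk z s y"
  shows "loc z s x < loc z s y \<longleftrightarrow> x < y"
  using loc_in(2)[OF assms(1,2)] loc_in(2)[OF assms(1,3)] assms(4) by auto

lemma loc_eq_iff:
  assumes "composition k s z" "x \<in> {1..k}" "y \<in> {1..k}" "blk z s x = blk z s y"
  shows "loc z s x = loc z s y \<longleftrightarrow> x = y"
  using loc_less_iff[OF assms] loc_less_iff[OF assms(1,3,2) assms(4)[symmetric]]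
  by (metis linorder_neq_iff)

lemma offset_plus:
  assumes "composition k s z" "i \<in> {1..s}" "x \<in> {1..z i}"
  shows "offset z i + x \<in> {1..k}" "blk z s (offset z i + x) = i" "loc z s (offset z i + x) = x"
proof -
  have *: "offset z i + x \<in> intvl z i" using assms(3) by (auto simp: intvl_def)
  show b: "blk z s (offset z i + x) = i" using blk_eq[OF assms(2) *] .
  show "offset z i + x \<in> {1..k}" using offset_le[OF assms(1,2)] assms(3) by auto
  show "loc z s (offset z i + x) = x" by (simp add: loc_def b)
qed

lemma blk_rep:
  assumes "composition k s z" "i \<in> {1..s}"
  obtains x where "x \<in> {1..k}" "blk z s x = i"
proof -
  have "1 \<in> {1..z i}" using assms unfolding composition_def by auto
  then show ?thesis using that offset_plus[OF assms] by blast
qed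

lemma composition_1:
  assumes "composition k s z" "1 \<le> s"
  shows "1 \<in> {1..k}" "k \<in> {1..k}" "blk z s 1 = 1" "blk z s k = s"
proof -
  obtain x y where x: "x \<in> {1..k}" "blk z s x = 1" and y: "y \<in> {1..k}" "blk z s y = s"
    using blk_rep[OF assms(1), of 1] blk_rep[OF assms(1), of s] assms(2) by (metis atLeastAtMost_iff order_refl)
  show k: "1 \<in> {1..k}" "k \<in> {1..k}" using x by auto
  show "blk z s 1 = 1" using blk_mono[OF assms(1) k(1) x(1)] x blk_in(1)[OF assms(1) k(1)] by auto
  show "blk z s k = s" using blk_mono[OF assms(1) y(1) k(2)] y blk_in(1)[OF assms(1) k(2)] by auto
qed

section \<open>Inflation in the symmetric group\<close>

lemma inflationA_composition: "inflationA k \<alpha> s z \<sigma> \<beta> \<Longrightarrow> composition k s z"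
  unfolding inflationA_def composition_def by blast

text \<open>In the coordinates \<open>(blk, loc)\<close> the two order conditions of the definition
  become a single rule for all pairs of points, with no quantification over intervals.\<close>

lemma inflationA_iff_order:
  "inflationA k \<alpha> s z \<sigma> \<beta> \<longleftrightarrow> composition k s z \<and> \<alpha> \<in> symgrp k \<and> \<sigma> \<in> symgrp s \<and>
     (\<forall>i\<in>{1..s}. \<beta> i \<in> symgrp (z i)) \<and>
     (\<forall>x\<in>{1..k}. \<forall>y\<in>{1..k}. \<alpha> x < \<alpha> y \<longleftrightarrow>
        (if blk z s x = blk z s y then \<beta> (blk z s x) (loc z s x) < \<beta> (blk z s x) (loc z s y)
         else \<sigma> (blk z s x) < \<sigma> (blk z s y)))"
  (is "?L \<longleftrightarrow> ?R")
proof
  assume L: ?L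
  note c = inflationA_composition[OF L]
  have same: "\<forall>i\<in>{1..s}. \<forall>x\<in>{1..z i}. \<forall>y\<in>{1..z i}.
        \<alpha> (offset z i + x) < \<alpha> (offset z i + y) \<longleftrightarrow> \<beta> i x < \<beta> i y"
    using L unfolding inflationA_def by blast
  have "\<alpha> x < \<alpha> y \<longleftrightarrow>
        (if blk z s x = blk z s y then \<beta> (blk z s x) (loc z s x) < \<beta> (blk z s x) (loc z s y)
         else \<sigma> (blk z s x) < \<sigma> (blk z s y))" if xy: "x \<in> {1..k}" "y \<in> {1..k}" for x y
  proof (cases "blk z s x = blk z s y")
    case True
    have "\<alpha> (offset z (blk z s x) + loc z s x) < \<alpha> (offset z (blk z s x) + loc z s y)
        \<longleftrightarrow> \<beta> (blk z s x) (loc z s x) < \<beta> (blk z s x) (loc z s y)"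
      using bspec[OF bspec[OF bspec[OF same blk_in(1)[OF c xy(1)]] loc_in(1)[OF c xy(1)]],
          of "loc z s y"] loc_in(1)[OF c xy(2)] True by simp
    then show ?thesis using loc_in[OF c xy(1)] loc_in[OF c xy(2)] True by simp
  next
    case False
    then show ?thesis using L blk_in[OF c xy(1)] blk_in[OF c xy(2)]
      unfolding inflationA_def by simp
  qed
  then show ?R using L c unfolding inflationA_def by blast
next
  assume R: ?R
  then have c: "composition k s z" by blast
  have "\<alpha> (offset z i + x) < \<alpha> (offset z i + y) \<longleftrightarrow> \<beta> i x < \<beta> i y"
    if "i \<in> {1..s}" "x \<in> {1..z i}" "y \<in> {1..z i}" for i x y
    using R offset_plus[OF c that(1,2)] offset_plus[OF c that(1,3)] by simp
  moreover have "\<alpha> a < \<alpha> b \<longleftrightarrow> \<sigma> i < \<sigma> j"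
    if "i \<in> {1..s}" "j \<in> {1..s}" "i \<noteq> j" "a \<in> intvl z i" "b \<in> intvl z j" for i j a b
  proof -
    have "a \<in> {1..k}" "b \<in> {1..k}"
      using offset_le[OF c that(1)] offset_le[OF c that(2)] that(4,5) unfolding intvl_def by auto
    then show ?thesis using R blk_eq[OF that(1,4)] blk_eq[OF that(2,5)] that(3) by simp
  qed
  ultimately show ?L using R unfolding inflationA_def composition_def by blast
qed

text \<open>The inversion set assembled from an outer set \<open>S\<close> and inner sets
  \<open>B i\<close>. It is a predicate rather than a set since it is only meaningful on
  \<open>posA k\<close>.\<close>

definition liftA :: "(nat \<Rightarrow> nat) \<Rightarrow> nat \<Rightarrow> (nat \<times> nat) set \<Rightarrow> (nat \<Rightarrow> (nat \<times> nat) set) \<Rightarrow> nat \<times> nat \<Rightarrow> bool" where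
  "liftA z s S B = (\<lambda>(x, y). if blk z s x = blk z s y
     then (loc z s x, loc z s y) \<in> B (blk z s x) else (blk z s x, blk z s y) \<in> S)"

text \<open>Each pair is governed either by the outer permutation or by exactly one inner one. This
  independence is what later splits every statement about inversion sets into statements about
  components.\<close>

lemma inflationA_iff:
  "inflationA k \<alpha> s z \<sigma> \<beta> \<longleftrightarrow> composition k s z \<and> \<alpha> \<in> symgrp k \<and> \<sigma> \<in> symgrp s \<and>
     (\<forall>i\<in>{1..s}. \<beta> i \<in> symgrp (z i)) \<and>
     (\<forall>v\<in>posA k. v \<in> invA k \<alpha> \<longleftrightarrow> liftA z s (invA s \<sigma>) (\<lambda>i. invA (z i) (\<beta> i)) v)"
  (is "?L \<longleftrightarrow> ?R")
proof -
  have "(\<forall>x\<in>{1..k}. \<forall>y\<in>{1..k}. \<alpha> x < \<alpha> y \<longleftrightarrow>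
        (if blk z s x = blk z s y then \<beta> (blk z s x) (loc z s x) < \<beta> (blk z s x) (loc z s y)
         else \<sigma> (blk z s x) < \<sigma> (blk z s y))) \<longleftrightarrow>
     (\<forall>v\<in>posA k. v \<in> invA k \<alpha> \<longleftrightarrow> liftA z s (invA s \<sigma>) (\<lambda>i. invA (z i) (\<beta> i)) v)"
    (is "?A \<longleftrightarrow> ?B")
    if c: "composition k s z" and a: "\<alpha> \<in> symgrp k" and s: "\<sigma> \<in> symgrp s"
      and b: "\<forall>i\<in>{1..s}. \<beta> i \<in> symgrp (z i)"
  proof -
    define P where "P x y \<longleftrightarrow> (\<alpha> x < \<alpha> y \<longleftrightarrow>
        (if blk z s x = blk z s y then \<beta> (blk z s x) (loc z s x) < \<beta> (blk z s x) (loc z s y)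
         else \<sigma> (blk z s x) < \<sigma> (blk z s y)))" for x y
    have P: "P x y \<longleftrightarrow> ((x, y) \<in> invA k \<alpha> \<longleftrightarrow>
         liftA z s (invA s \<sigma>) (\<lambda>i. invA (z i) (\<beta> i)) (x, y))"
      "P y x \<longleftrightarrow> P x y"
      if xy: "x \<in> {1..k}" "y \<in> {1..k}" "x < y" for x y
    proof -
      have 1: "\<alpha> x < \<alpha> y \<longleftrightarrow> (x, y) \<notin> invA k \<alpha>" "\<alpha> y < \<alpha> x \<longleftrightarrow> (x, y) \<in> invA k \<alpha>"
        using invA_less_iff[OF a xy(1,2)] invA_less_iff[OF a xy(2,1)] xy(3) invA_subset[of k \<alpha>]
        by (auto simp: posA_def)
      show "P x y \<longleftrightarrow> ((x, y) \<in> invA k \<alpha> \<longleftrightarrow>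
          liftA z s (invA s \<sigma>) (\<lambda>i. invA (z i) (\<beta> i)) (x, y))" "P y x \<longleftrightarrow> P x y"
      proof (atomize (full), cases "blk z s x = blk z s y")
        case True
        let ?i = "blk z s x"
        have bi: "\<beta> ?i \<in> symgrp (z ?i)" using b blk_in[OF c xy(1)] by blast
        have lx: "loc z s x \<in> {1..z ?i}" and ly: "loc z s y \<in> {1..z ?i}"
          using loc_in(1)[OF c xy(1)] loc_in(1)[OF c xy(2)] True by auto
        have l: "loc z s x < loc z s y" using loc_less_iff[OF c xy(1,2) True] xy(3) by simp
        have "\<beta> ?i (loc z s x) < \<beta> ?i (loc z s y) \<longleftrightarrow> (loc z s x, loc z s y) \<notin> invA (z ?i) (\<beta> ?i)"
          "\<beta> ?i (loc z s y) < \<beta> ?i (loc z s x) \<longleftrightarrow> (loc z s x, loc z s y) \<in> invA (z ?i) (\<beta> ?i)"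
          using invA_less_iff[OF bi lx ly] invA_less_iff[OF bi ly lx] l invA_subset[of "z ?i" "\<beta> ?i"]
          by (auto simp: posA_def)
        then show "(P x y \<longleftrightarrow> ((x, y) \<in> invA k \<alpha> \<longleftrightarrow>
          liftA z s (invA s \<sigma>) (\<lambda>i. invA (z i) (\<beta> i)) (x, y))) \<and> (P y x \<longleftrightarrow> P x y)"
          using 1 True unfolding P_def liftA_def by auto
      next
        case False
        let ?i = "blk z s x" and ?j = "blk z s y"
        have i: "?i \<in> {1..s}" "?j \<in> {1..s}" using blk_in[OF c xy(1)] blk_in[OF c xy(2)] by auto
        have l: "?i < ?j" using blk_mono[OF c xy(1,2)] xy(3) False by simp
        have "\<sigma> ?i < \<sigma> ?j \<longleftrightarrow> (?i, ?j) \<notin> invA s \<sigma>" "\<sigma> ?j < \<sigma> ?i \<longleftrightarrow> (?i, ?j) \<in> invA s \<sigma>"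
          using invA_less_iff[OF s i] invA_less_iff[OF s i(2,1)] l invA_subset[of s \<sigma>]
          by (auto simp: posA_def)
        then show "(P x y \<longleftrightarrow> ((x, y) \<in> invA k \<alpha> \<longleftrightarrow>
          liftA z s (invA s \<sigma>) (\<lambda>i. invA (z i) (\<beta> i)) (x, y))) \<and> (P y x \<longleftrightarrow> P x y)"
          using 1 False unfolding P_def liftA_def by auto
      qed
    qed
    \<comment> \<open>The order rule is trivial on the diagonal and symmetric in its arguments, so
      it only has to be compared on pairs with \<open>x < y\<close>, where it speaks about
      inversions.\<close>
    have "P x x" for x unfolding P_def by simp
    then have "(\<forall>x\<in>{1..k}. \<forall>y\<in>{1..k}. P x y) \<longleftrightarrow> (\<forall>x\<in>{1..k}. \<forall>y\<in>{1..k}. x < y \<longrightarrow> P x y)"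
      using P(2) by (metis linorder_neqE_nat)
    also have "\<dots> \<longleftrightarrow> ?B" using P(1) by (fastforce simp: posA_def)
    finally show ?thesis unfolding P_def .
  qed
  then show ?thesis unfolding inflationA_iff_order by blast
qed

lemma inflationA_exists:
  assumes c: "composition k s z" and s: "\<sigma> \<in> symgrp s" and b: "\<forall>i\<in>{1..s}. \<beta> i \<in> symgrp (z i)"
  obtains \<alpha> where "inflationA k \<alpha> s z \<sigma> \<beta>"
proof -
  define R where "R x y \<longleftrightarrow>
        (if blk z s x = blk z s y then \<beta> (blk z s x) (loc z s x) < \<beta> (blk z s x) (loc z s y)
         else \<sigma> (blk z s x) < \<sigma> (blk z s y))" for x y
  obtain \<alpha> where a: "\<alpha> \<in> symgrp k" "\<And>x y. x \<in> {1..k} \<Longrightarrow> y \<in> {1..k} \<Longrightarrow> \<alpha> x < \<alpha> y \<longleftrightarrow> R x y"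
  proof (rule perm_of_order[of k R])
    fix x y w assume "R x y" "R y w"
    then show "R x w" unfolding R_def by (auto split: if_splits)
  next
    fix x y assume xy: "x \<in> {1..k}" "y \<in> {1..k}" "x \<noteq> y"
    show "R x y \<or> R y x"
    proof (cases "blk z s x = blk z s y")
      case True
      then have "\<beta> (blk z s x) (loc z s x) \<noteq> \<beta> (blk z s x) (loc z s y)"
        using b blk_in[OF c xy(1)] loc_eq_iff[OF c xy(1,2)] xy(3) symgrp_eq_iff by metis
      then show ?thesis using True unfolding R_def by auto
    next
      case False
      then show ?thesis using symgrp_eq_iff[OF s, of "blk z s x" "blk z s y"] unfolding R_def by auto
    qed
  qed (auto simp: R_def)
  have "inflationA k \<alpha> s z \<sigma> \<beta>"
    unfolding inflationA_iff_order R_def[symmetric] using a assms by blast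
  then show ?thesis by (rule that)
qed

lemma inflationA_order_same:
  assumes "inflationA k \<alpha> s z \<sigma> \<beta>" "x \<in> {1..k}" "y \<in> {1..k}" "blk z s x = blk z s y"
  shows "\<alpha> x < \<alpha> y \<longleftrightarrow> \<beta> (blk z s x) (loc z s x) < \<beta> (blk z s x) (loc z s y)"
proof -
  have "\<forall>x\<in>{1..k}. \<forall>y\<in>{1..k}. \<alpha> x < \<alpha> y \<longleftrightarrow>
        (if blk z s x = blk z s y then \<beta> (blk z s x) (loc z s x) < \<beta> (blk z s x) (loc z s y)
         else \<sigma> (blk z s x) < \<sigma> (blk z s y))"
    using assms(1) unfolding inflationA_iff_order by blast
  from bspec[OF bspec[OF this assms(2)] assms(3)] show ?thesis using assms(4) by simp
qed

lemma inflationA_order_diff: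
  assumes "inflationA k \<alpha> s z \<sigma> \<beta>" "x \<in> {1..k}" "y \<in> {1..k}" "blk z s x \<noteq> blk z s y"
  shows "\<alpha> x < \<alpha> y \<longleftrightarrow> \<sigma> (blk z s x) < \<sigma> (blk z s y)"
proof -
  have "\<forall>x\<in>{1..k}. \<forall>y\<in>{1..k}. \<alpha> x < \<alpha> y \<longleftrightarrow>
        (if blk z s x = blk z s y then \<beta> (blk z s x) (loc z s x) < \<beta> (blk z s x) (loc z s y)
         else \<sigma> (blk z s x) < \<sigma> (blk z s y))"
    using assms(1) unfolding inflationA_iff_order by blast
  from bspec[OF bspec[OF this assms(2)] assms(3)] show ?thesis using assms(4) by simp
qed

lemma inflationA_unique:
  assumes i: "inflationA k \<alpha> s z \<sigma> \<beta>" "inflationA k \<alpha>' s z \<sigma> \<beta>'"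
    and eq: "\<And>i. i \<in> {1..s} \<Longrightarrow> \<beta> i = \<beta>' i"
  shows "\<alpha> = \<alpha>'"
proof (rule symgrp_eqI_order)
  fix x y assume xy: "x \<in> {1..k}" "y \<in> {1..k}"
  show "\<alpha> x < \<alpha> y \<longleftrightarrow> \<alpha>' x < \<alpha>' y"
    using inflationA_order_same[OF i(1) xy] inflationA_order_same[OF i(2) xy]
      inflationA_order_diff[OF i(1) xy] inflationA_order_diff[OF i(2) xy]
      eq[OF blk_in(1)[OF inflationA_composition[OF i(1)] xy(1)]]
    by (cases "blk z s x = blk z s y") simp_all
qed (use i inflationA_def in blast)+

lemma inflationA_outer_unique:
  assumes "inflationA k \<alpha> s z \<sigma> \<beta>" "inflationA k \<alpha> s z \<sigma>' \<beta>'"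
  shows "\<sigma> = \<sigma>'"
proof (rule symgrp_eqI_order)
  note c = inflationA_composition[OF assms(1)]
  fix i j assume ij: "i \<in> {1..s}" "j \<in> {1..s}"
  obtain x where x: "x \<in> {1..k}" "blk z s x = i" using blk_rep[OF c ij(1)] .
  obtain y where y: "y \<in> {1..k}" "blk z s y = j" using blk_rep[OF c ij(2)] .
  show "\<sigma> i < \<sigma> j \<longleftrightarrow> \<sigma>' i < \<sigma>' j"
    using inflationA_order_diff[OF assms(1) x(1) y(1)] inflationA_order_diff[OF assms(2) x(1) y(1)] x y
    by (cases "i = j") simp_all
qed (use assms inflationA_def in blast)+

lemma inflationA_inner_unique:
  assumes "inflationA k \<alpha> s z \<sigma> \<beta>" "inflationA k \<alpha> s z \<sigma>' \<beta>'" "i \<in> {1..s}"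
  shows "\<beta> i = \<beta>' i"
  by (rule symgrp_eqI_order[of _ "z i"]) (use assms in \<open>simp_all add: inflationA_def\<close>)

text \<open>Being an inflation is a condition on pairs in different intervals only: the inner
  permutations are then read off as the patterns of \<open>\<alpha>\<close> on the
  intervals.\<close>

lemma inflationA_of_cross:
  assumes c: "composition k s z" and a: "\<alpha> \<in> symgrp k" and s: "\<sigma> \<in> symgrp s"
    and cross: "\<And>x y. (x, y) \<in> posA k \<Longrightarrow> blk z s x \<noteq> blk z s y \<Longrightarrow>
        (x, y) \<in> invA k \<alpha> \<longleftrightarrow> (blk z s x, blk z s y) \<in> invA s \<sigma>"
  obtains \<beta> where "inflationA k \<alpha> s z \<sigma> \<beta>"
proof -
  have "\<exists>b. b \<in> symgrp (z i) \<and> (\<forall>x\<in>{1..z i}. \<forall>y\<in>{1..z i}.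
      b x < b y \<longleftrightarrow> \<alpha> (offset z i + x) < \<alpha> (offset z i + y))" for i
  proof -
    obtain b where "b \<in> symgrp (z i)" "\<And>x y. x \<in> {1..z i} \<Longrightarrow> y \<in> {1..z i} \<Longrightarrow>
        b x < b y \<longleftrightarrow> \<alpha> (offset z i + x) < \<alpha> (offset z i + y)"
      by (rule perm_of_order[of "z i" "\<lambda>x y. \<alpha> (offset z i + x) < \<alpha> (offset z i + y)"])
        (use symgrp_eq_iff[OF a] in \<open>auto simp: neq_iff[symmetric]\<close>)
    then show ?thesis by blast
  qed
  then obtain \<beta> where b: "\<And>i. \<beta> i \<in> symgrp (z i)"
    "\<And>i x y. x \<in> {1..z i} \<Longrightarrow> y \<in> {1..z i} \<Longrightarrow> \<beta> i x < \<beta> i y \<longleftrightarrow> \<alpha> (offset z i + x) < \<alpha> (offset z i + y)"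
    by metis
  have "v \<in> invA k \<alpha> \<longleftrightarrow> liftA z s (invA s \<sigma>) (\<lambda>i. invA (z i) (\<beta> i)) v" if v: "v \<in> posA k" for v
  proof -
    obtain x y where vxy: "v = (x, y)" and xy: "x \<in> {1..k}" "y \<in> {1..k}" "x < y"
      using v unfolding posA_def by auto
    show ?thesis
    proof (cases "blk z s x = blk z s y")
      case True
      have l: "loc z s x < loc z s y" using loc_less_iff[OF c xy(1,2) True] xy(3) by simp
      show ?thesis
        using b(2)[of "loc z s y" "blk z s x" "loc z s x"] loc_in[OF c xy(1)] loc_in[OF c xy(2)] True l xy
        unfolding vxy liftA_def invA_def posA_def by auto
    qed (use v cross vxy in \<open>auto simp: liftA_def\<close>)
  qed
  then show ?thesis using that[of \<beta>] assms b(1) unfolding inflationA_iff by blast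
qed

section \<open>Disjoint unions tested point by point\<close>

definition du :: "bool \<Rightarrow> nat \<Rightarrow> (nat \<Rightarrow> bool) \<Rightarrow> bool" where
  "du d r f \<longleftrightarrow> (d \<longleftrightarrow> (\<exists>a\<in>{1..r}. f a)) \<and> (\<forall>a\<in>{1..r}. \<forall>b\<in>{1..r}. f a \<longrightarrow> f b \<longrightarrow> a = b)"

lemma du_cong:
  "d = d' \<Longrightarrow> (\<And>a. a \<in> {1..r} \<Longrightarrow> f a = f' a) \<Longrightarrow> du d r f = du d' r f'"
  unfolding du_def by auto

lemma disj_union_iff_du: "disj_union D r F \<longleftrightarrow> (\<forall>x. du (x \<in> D) r (\<lambda>a. x \<in> F a))"
  unfolding disj_union_def du_def disjoint_family_on_def by blast

text \<open>The map \<open>h\<close> has to be onto but not injective. This matters for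
  \<open>pair_root\<close>, which sends a pair and its mirror image to the same root.\<close>

lemma disj_union_transfer:
  assumes "h ` U = U'" "D \<subseteq> U" "\<And>a. a \<in> {1..r} \<Longrightarrow> F a \<subseteq> U" "D' \<subseteq> U'" "\<And>a. a \<in> {1..r} \<Longrightarrow> F' a \<subseteq> U'"
    and "\<And>x. x \<in> U \<Longrightarrow> x \<in> D \<longleftrightarrow> h x \<in> D'"
    and "\<And>x a. x \<in> U \<Longrightarrow> a \<in> {1..r} \<Longrightarrow> x \<in> F a \<longleftrightarrow> h x \<in> F' a"
  shows "disj_union D r F \<longleftrightarrow> disj_union D' r F'"
proof -
  have "(\<forall>x. du (x \<in> D) r (\<lambda>a. x \<in> F a)) \<longleftrightarrow> (\<forall>x\<in>U. du (x \<in> D) r (\<lambda>a. x \<in> F a))"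
    using assms(2,3) unfolding du_def by blast
  also have "\<dots> \<longleftrightarrow> (\<forall>x\<in>U. du (h x \<in> D') r (\<lambda>a. h x \<in> F' a))"
    by (intro ball_cong refl du_cong assms(6,7))
  also have "\<dots> \<longleftrightarrow> (\<forall>x. du (x \<in> D') r (\<lambda>a. x \<in> F' a))"
    using assms(1,4,5) unfolding du_def by blast
  finally show ?thesis unfolding disj_union_iff_du .
qed

text \<open>A pair in \<open>posA k\<close> tests exactly one component, and conversely every pair
  of a component is realized by some pair in \<open>posA k\<close>. Pairs outside
  \<open>posA\<close> lie in no inversion set and satisfy the pointwise condition trivially.\<close>

lemma inflationA_disj_union:
  assumes i: "inflationA k \<alpha> s z \<sigma> \<beta>"
    and ia: "\<And>a. a \<in> {1..r} \<Longrightarrow> inflationA k (\<alpha>' a) s z (\<sigma>' a) (\<beta>' a)"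
  shows "disj_union (invA k \<alpha>) r (\<lambda>a. invA k (\<alpha>' a)) \<longleftrightarrow>
     disj_union (invA s \<sigma>) r (\<lambda>a. invA s (\<sigma>' a)) \<and>
     (\<forall>i\<in>{1..s}. disj_union (invA (z i) (\<beta> i)) r (\<lambda>a. invA (z i) (\<beta>' a i)))"
proof -
  note c = inflationA_composition[OF i]
  let ?P = "\<lambda>v. du (v \<in> invA k \<alpha>) r (\<lambda>a. v \<in> invA k (\<alpha>' a))"
  let ?Q = "\<lambda>v. du (v \<in> invA s \<sigma>) r (\<lambda>a. v \<in> invA s (\<sigma>' a))"
  let ?T = "\<lambda>i v. du (v \<in> invA (z i) (\<beta> i)) r (\<lambda>a. v \<in> invA (z i) (\<beta>' a i))"
  have triv: "du (v \<in> invA m g) r (\<lambda>a. v \<in> invA m (h a))" if "v \<notin> posA m" for v m g h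
    using that invA_subset unfolding du_def by blast
  have mem: "v \<in> invA k \<alpha> \<longleftrightarrow> liftA z s (invA s \<sigma>) (\<lambda>i. invA (z i) (\<beta> i)) v"
    "a \<in> {1..r} \<Longrightarrow> v \<in> invA k (\<alpha>' a) \<longleftrightarrow> liftA z s (invA s (\<sigma>' a)) (\<lambda>i. invA (z i) (\<beta>' a i)) v"
    if "v \<in> posA k" for v a
    using i ia that unfolding inflationA_iff by blast+
  have P: "?P (x, y) \<longleftrightarrow> (if blk z s x = blk z s y then ?T (blk z s x) (loc z s x, loc z s y)
      else ?Q (blk z s x, blk z s y))" if "(x, y) \<in> posA k" for x y
    using mem[OF that] unfolding du_def by (simp add: liftA_def)
  have "(\<forall>v. ?P v) \<longleftrightarrow> (\<forall>v. ?Q v) \<and> (\<forall>i\<in>{1..s}. \<forall>v. ?T i v)"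
  proof (intro iffI conjI allI ballI)
    fix v assume all: "\<forall>v. ?P v"
    show "?Q v"
    proof (cases "v \<in> posA s")
      case True
      then obtain p q where v: "v = (p, q)" "p \<in> {1..s}" "q \<in> {1..s}" "p < q"
        unfolding posA_def by auto
      obtain x y where xy: "x \<in> {1..k}" "blk z s x = p" "y \<in> {1..k}" "blk z s y = q"
        using blk_rep[OF c] v by metis
      then have "(x, y) \<in> posA k" using blk_less[OF c, of x y] v unfolding posA_def by auto
      then show ?thesis using P[of x y] all xy v by auto
    qed (rule triv)
  next
    fix i v assume all: "\<forall>v. ?P v" and i: "i \<in> {1..s}"
    show "?T i v"
    proof (cases "v \<in> posA (z i)")
      case True
      then obtain p q where v: "v = (p, q)" "p \<in> {1..z i}" "q \<in> {1..z i}" "p < q"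
        unfolding posA_def by auto
      then have "(offset z i + p, offset z i + q) \<in> posA k"
        using offset_plus[OF c i, of p] offset_plus[OF c i, of q] unfolding posA_def by auto
      then show ?thesis using P[of "offset z i + p" "offset z i + q"] all v
          offset_plus[OF c i, of p] offset_plus[OF c i, of q] by simp
    qed (rule triv)
  next
    fix v assume all: "(\<forall>v. ?Q v) \<and> (\<forall>i\<in>{1..s}. \<forall>v. ?T i v)"
    show "?P v"
    proof (cases "v \<in> posA k")
      case True
      then obtain x y where v: "v = (x, y)" by (cases v)
      have "blk z s x \<in> {1..s}" using blk_in(1)[OF c, of x] True v unfolding posA_def by simp
      then show ?thesis using P[of x y] True all unfolding v by simp
    qed (rule triv)
  qed
  then show ?thesis unfolding disj_union_iff_du by blast
qed

section \<open>The embedding into the symmetric group\<close>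

lemma weyl_neg: "w \<in> weyl n \<Longrightarrow> w (- a) = - w a"
  unfolding weyl_def by blast

lemma weyl_zero [simp]: "w \<in> weyl n \<Longrightarrow> w 0 = 0"
  unfolding weyl_def permutes_def by simp

lemma weyl_out: "w \<in> weyl n \<Longrightarrow> \<bar>a\<bar> > int n \<Longrightarrow> w a = a"
proof -
  assume "w \<in> weyl n" "\<bar>a\<bar> > int n"
  then have "w permutes ({- int n..int n} - {0})" "a \<notin> {- int n..int n} - {0}"
    unfolding weyl_def by auto
  then show "w a = a" by (rule permutes_not_in)
qed

lemma weyl_eq_iff: "w \<in> weyl n \<Longrightarrow> w a = w b \<longleftrightarrow> a = b"
proof -
  assume "w \<in> weyl n"
  then have "inj w" unfolding weyl_def by (auto intro: permutes_inj)
  then show ?thesis by (rule inj_eq)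
qed

lemma weyl_abs: "w \<in> weyl n \<Longrightarrow> \<bar>a\<bar> \<le> int n \<Longrightarrow> \<bar>w a\<bar> \<le> int n"
proof -
  assume w: "w \<in> weyl n" and a: "\<bar>a\<bar> \<le> int n"
  show "\<bar>w a\<bar> \<le> int n"
  proof (cases "a = 0")
    case False
    then have "a \<in> {- int n..int n} - {0}" using a by auto
    then have "w a \<in> {- int n..int n} - {0}"
      using w permutes_in_image[of w "{- int n..int n} - {0}" a] unfolding weyl_def by blast
    then show ?thesis by auto
  qed (use w in simp)
qed

lemma weylI:
  assumes "\<And>a. \<bar>a\<bar> \<le> int n \<Longrightarrow> a \<noteq> 0 \<Longrightarrow> \<bar>w a\<bar> \<le> int n \<and> w a \<noteq> 0"
    and "\<And>a b. \<bar>a\<bar> \<le> int n \<Longrightarrow> \<bar>b\<bar> \<le> int n \<Longrightarrow> w a = w b \<Longrightarrow> a = b"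
    and "\<And>a. w (- a) = - w a" and "\<And>a. \<bar>a\<bar> > int n \<Longrightarrow> w a = a"
  shows "w \<in> weyl n"
proof -
  have 0: "w 0 = 0" using assms(3)[of 0] by simp
  have "w permutes ({- int n..int n} - {0})"
  proof (rule inj_imp_permutes)
    show "inj_on w ({- int n..int n} - {0})" by (rule inj_onI) (rule assms(2), auto)
    show "w a \<in> {- int n..int n} - {0}" if "a \<in> {- int n..int n} - {0}" for a
    proof -
      have "\<bar>a\<bar> \<le> int n" "a \<noteq> 0" using that by auto
      from assms(1)[OF this] show ?thesis by auto
    qed
    show "w a = a" if "a \<notin> {- int n..int n} - {0}" for a
      using assms(4)[of a] 0 that by (cases "a = 0") auto
  qed simp
  then show ?thesis using assms(3) unfolding weyl_def by blast
qed

lemma id_weyl: "id \<in> weyl n"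
  by (rule weylI) auto

lemma weyl_comp: "w \<in> weyl n \<Longrightarrow> w' \<in> weyl n \<Longrightarrow> w \<circ> w' \<in> weyl n"
  unfolding weyl_def by (auto intro: permutes_compose)

text \<open>Positions \<open>1..deg X n\<close> are identified with the signed indices in
  \<open>vset\<close>, with inverse \<open>vpos\<close>. Reversal of positions becomes negation of
  indices, and the middle position of type B has index 0.\<close>

definition vidx :: "bctype \<Rightarrow> nat \<Rightarrow> nat \<Rightarrow> int" where
  "vidx X n i = (if i \<le> n then int i else if X = TypeB \<and> i = n + 1 then 0
     else - int (deg X n + 1 - i))"

definition vpos :: "bctype \<Rightarrow> nat \<Rightarrow> int \<Rightarrow> nat" where
  "vpos X n a = (if a > 0 then nat a else if a = 0 then n + 1 else nat (int (deg X n) + 1 + a))"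

definition vset :: "bctype \<Rightarrow> nat \<Rightarrow> int set" where
  "vset X n = {a. \<bar>a\<bar> \<le> int n \<and> (X = TypeC \<longrightarrow> a \<noteq> 0)}"

lemma vidx_in: "i \<in> {1..deg X n} \<Longrightarrow> vidx X n i \<in> vset X n"
  and vpos_vidx: "i \<in> {1..deg X n} \<Longrightarrow> vpos X n (vidx X n i) = i"
  and vidx_rev: "i \<in> {1..deg X n} \<Longrightarrow> vidx X n (deg X n + 1 - i) = - vidx X n i"
  unfolding vidx_def vpos_def vset_def deg_def by (cases X; auto)+

lemma vpos_in: "a \<in> vset X n \<Longrightarrow> vpos X n a \<in> {1..deg X n}"
  and vidx_vpos: "a \<in> vset X n \<Longrightarrow> vidx X n (vpos X n a) = a"
  and vpos_neg: "a \<in> vset X n \<Longrightarrow> vpos X n (- a) = deg X n + 1 - vpos X n a"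
  unfolding vidx_def vpos_def vset_def deg_def by (cases X; auto)+

lemma vset_abs: "a \<in> vset X n \<Longrightarrow> \<bar>a\<bar> \<le> int n"
  unfolding vset_def by simp

lemma weyl_vset: "w \<in> weyl n \<Longrightarrow> a \<in> vset X n \<Longrightarrow> w a \<in> vset X n"
  using weyl_abs[of w n a] weyl_eq_iff[of w n a 0] unfolding vset_def by auto

lemma eps_inject: "eps a = eps b \<longleftrightarrow> a = b"
proof
  assume e: "eps a = eps b"
  have "eps a (nat \<bar>a\<bar>) = of_int (sgn a)" "eps b (nat \<bar>b\<bar>) = of_int (sgn b)"
    unfolding eps_def by simp_all
  moreover have "eps b (nat \<bar>a\<bar>) = (if \<bar>a\<bar> = \<bar>b\<bar> then of_int (sgn b) else 0)"
    "eps a (nat \<bar>b\<bar>) = (if \<bar>a\<bar> = \<bar>b\<bar> then of_int (sgn a) else 0)"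
    unfolding eps_def by auto
  ultimately have sg: "sgn a = (if \<bar>a\<bar> = \<bar>b\<bar> then sgn b else 0)"
    "sgn b = (if \<bar>a\<bar> = \<bar>b\<bar> then sgn a else 0)"
    using e by (simp_all split: if_splits)
  show "a = b"
  proof (cases "\<bar>a\<bar> = \<bar>b\<bar>")
    case True
    then have "sgn a = sgn b" using sg(1) by argo
    then show ?thesis using True by (metis mult_sgn_abs)
  next
    case False
    then have "sgn a = 0" "sgn b = 0" using sg by simp_all
    then show ?thesis by (simp add: sgn_0_0)
  qed
qed simp

lemma eps_neg: "eps (- a) k = - eps a k"
  unfolding eps_def by simp

lemma eps_0 [simp]: "eps 0 = (\<lambda>k. 0)"
  unfolding eps_def by auto

lemma act_eps:
  assumes "w \<in> weyl n" "\<bar>a\<bar> \<le> int n"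
  shows "act n w (eps a) = eps (w a)"
proof
  fix k
  have "act n w (eps a) k = (\<Sum>i = 1..n. if i = nat \<bar>a\<bar> then of_int (sgn a) * eps (w (int i)) k else 0)"
    unfolding act_def by (rule sum.cong) (auto simp: eps_def)
  also have "\<dots> = (if a = 0 then 0 else of_int (sgn a) * eps (w \<bar>a\<bar>) k)"
    using assms(2) by auto
  also have "\<dots> = eps (w a) k"
    using assms(1) weyl_neg[OF assms(1), of a] by (auto simp: abs_if eps_neg)
  finally show "act n w (eps a) k = eps (w a) k" .
qed

lemma act_diff: "act n w (\<lambda>k. c * (u k - v k)) = (\<lambda>k. c * (act n w u k - act n w v k))"
  unfolding act_def by (rule ext) (simp add: sum_subtractf[symmetric] sum_distrib_left algebra_simps)

lemma epsx_eq: "epsx X n i = eps (vidx X n i)"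
  unfolding epsx_def vidx_def using eps_neg by (intro ext) simp

text \<open>This removes the definite description from \<open>iota\<close>: on positions,
  \<open>w\<close> acts as its conjugate under \<open>vidx\<close> and \<open>vpos\<close>.\<close>

lemma iota_eq:
  assumes w: "w \<in> weyl n" and i: "i \<in> {1..deg X n}"
  shows "iota X n w i = vpos X n (w (vidx X n i))"
proof -
  have act: "act n w (epsx X n i) = eps (w (vidx X n i))"
    unfolding epsx_eq using act_eps[OF w vset_abs[OF vidx_in[OF i]]] .
  have v: "w (vidx X n i) \<in> vset X n" using weyl_vset[OF w vidx_in[OF i]] .
  have "(THE j. j \<in> {1..deg X n} \<and> act n w (epsx X n i) = epsx X n j) = vpos X n (w (vidx X n i))"
    unfolding epsx_eq act[unfolded epsx_eq] eps_inject
  proof (rule the_equality)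
    show "vpos X n (w (vidx X n i)) \<in> {1..deg X n} \<and> w (vidx X n i) = vidx X n (vpos X n (w (vidx X n i)))"
      using vpos_in[OF v] vidx_vpos[OF v] by simp
    show "j = vpos X n (w (vidx X n i))" if "j \<in> {1..deg X n} \<and> w (vidx X n i) = vidx X n j" for j
      using that vpos_vidx by metis
  qed
  then show ?thesis using i unfolding iota_def by simp
qed

lemma iota_out: "i \<notin> {1..deg X n} \<Longrightarrow> iota X n w i = i"
  unfolding iota_def by auto

lemma vidx_iota:
  assumes "w \<in> weyl n" "i \<in> {1..deg X n}"
  shows "vidx X n (iota X n w i) = w (vidx X n i)"
  using iota_eq[OF assms] vidx_vpos[OF weyl_vset[OF assms(1) vidx_in[OF assms(2)]]] by simp

lemma iota_symgrp:
  assumes w: "w \<in> weyl n"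
  shows "iota X n w \<in> symgrp (deg X n)"
proof (rule symgrpI)
  show "iota X n w i \<in> {1..deg X n}" if "i \<in> {1..deg X n}" for i
    using iota_eq[OF w that] vpos_in[OF weyl_vset[OF w vidx_in[OF that]]] by simp
  show "inj_on (iota X n w) {1..deg X n}"
  proof (rule inj_onI)
    fix i j assume ij: "i \<in> {1..deg X n}" "j \<in> {1..deg X n}" "iota X n w i = iota X n w j"
    then have "w (vidx X n i) = w (vidx X n j)" using vidx_iota[OF w] by metis
    then show "i = j" using weyl_eq_iff[OF w] vpos_vidx ij by metis
  qed
qed (rule iota_out)

definition symmetric :: "nat \<Rightarrow> (nat \<Rightarrow> nat) \<Rightarrow> bool" where
  "symmetric k \<alpha> \<longleftrightarrow> (\<forall>x\<in>{1..k}. \<alpha> (k + 1 - x) = k + 1 - \<alpha> x)"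

lemma iota_symmetric:
  assumes w: "w \<in> weyl n"
  shows "symmetric (deg X n) (iota X n w)"
  unfolding symmetric_def
proof
  fix i assume i: "i \<in> {1..deg X n}"
  then have i': "deg X n + 1 - i \<in> {1..deg X n}" by auto
  show "iota X n w (deg X n + 1 - i) = deg X n + 1 - iota X n w i"
    using iota_eq[OF w i] iota_eq[OF w i'] vidx_rev[OF i] weyl_neg[OF w]
      vpos_neg[OF weyl_vset[OF w vidx_in[OF i]]] by simp
qed

lemma iota_inject:
  assumes "w \<in> weyl n" "w' \<in> weyl n" "iota X n w = iota X n w'"
  shows "w = w'"
proof
  fix a
  consider "\<bar>a\<bar> > int n" | "a = 0" | "\<bar>a\<bar> \<le> int n" "a \<noteq> 0" by linarith
  then show "w a = w' a"
  proof cases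
    case 1
    then show ?thesis using weyl_out[OF assms(1)] weyl_out[OF assms(2)] by simp
  next
    case 2
    then show ?thesis using weyl_zero[OF assms(1)] weyl_zero[OF assms(2)] by simp
  next
    case 3
    then have a: "a \<in> vset X n" unfolding vset_def by simp
    show ?thesis
      using vidx_iota[OF assms(1) vpos_in[OF a]] vidx_iota[OF assms(2) vpos_in[OF a]] assms(3)
        vidx_vpos[OF a] by simp
  qed
qed

text \<open>With \<open>iota_symmetric\<close>, the image of the embedding is exactly the set of
  permutations commuting with reversal: such a \<open>q\<close> is carried over to signed indices,
  where the symmetry becomes oddness.\<close>

lemma iota_surj:
  assumes q: "q \<in> symgrp (deg X n)" and sy: "symmetric (deg X n) q"
  obtains w where "w \<in> weyl n" "iota X n w = q"
proof -
  define w where "w a = (if a \<in> vset X n then vidx X n (q (vpos X n a)) else a)" for a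
  have in_v: "w a \<in> vset X n" if "a \<in> vset X n" for a
    using that vidx_in[OF symgrp_in[OF q vpos_in[OF that]]] by (simp add: w_def)
  have neg: "w (- a) = - w a" for a
  proof (cases "a \<in> vset X n")
    case True
    then have "- a \<in> vset X n" by (simp add: vset_def)
    then show ?thesis
      using True vpos_neg[OF True] sy vpos_in[OF True] vidx_rev[OF symgrp_in[OF q vpos_in[OF True]]]
      unfolding w_def symmetric_def by simp
  next
    case False
    then have "- a \<notin> vset X n" by (simp add: vset_def)
    then show ?thesis using False by (simp add: w_def)
  qed
  have inj: "a = b" if "a \<in> vset X n" "b \<in> vset X n" "w a = w b" for a b
  proof -
    have "vidx X n (q (vpos X n a)) = vidx X n (q (vpos X n b))"
      using that by (simp add: w_def)
    from arg_cong[OF this, of "vpos X n"] have "q (vpos X n a) = q (vpos X n b)"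
      by (simp only: vpos_vidx[OF symgrp_in[OF q vpos_in[OF that(1)]]]
          vpos_vidx[OF symgrp_in[OF q vpos_in[OF that(2)]]])
    then have "vpos X n a = vpos X n b" by (simp only: symgrp_eq_iff[OF q])
    from arg_cong[OF this, of "vidx X n"] show ?thesis
      by (simp only: vidx_vpos[OF that(1)] vidx_vpos[OF that(2)])
  qed
  \<comment> \<open>In type B the index 0 lies in \<open>vset\<close>, so it is oddness and not the
    default value that fixes it.\<close>
  have w0: "w 0 = 0" using neg[of 0] by simp
  have nz: "a \<in> vset X n" if "\<bar>a\<bar> \<le> int n" "a \<noteq> 0" for a using that by (simp add: vset_def)
  have w: "w \<in> weyl n"
  proof (rule weylI)
    show "\<bar>w a\<bar> \<le> int n \<and> w a \<noteq> 0" if a: "\<bar>a\<bar> \<le> int n" "a \<noteq> 0" for a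
    proof
      show "\<bar>w a\<bar> \<le> int n" using vset_abs[OF in_v[OF nz[OF a]]] .
      show "w a \<noteq> 0"
      proof
        assume 0: "w a = 0"
        then have "0 \<in> vset X n" using in_v[OF nz[OF a]] by simp
        then show False using inj[OF nz[OF a], of 0] 0 w0 a by simp
      qed
    qed
    show "a = b" if "\<bar>a\<bar> \<le> int n" "\<bar>b\<bar> \<le> int n" "w a = w b" for a b
    proof (cases "a \<in> vset X n"; cases "b \<in> vset X n")
      assume "a \<in> vset X n" "b \<in> vset X n"
      then show ?thesis using inj that by blast
    next
      assume ab: "a \<in> vset X n" "b \<notin> vset X n"
      then have "b = 0" using nz[of b] that by blast
      then show ?thesis using in_v[OF ab(1)] ab(2) that(3) w0 by simp
    next
      assume ab: "a \<notin> vset X n" "b \<in> vset X n"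
      then have "a = 0" using nz[of a] that by blast
      then show ?thesis using in_v[OF ab(2)] ab(1) that(3)[symmetric] w0 by simp
    next
      assume "a \<notin> vset X n" "b \<notin> vset X n"
      then show ?thesis using nz that by metis
    qed
  qed (use neg in \<open>auto simp: w_def vset_def\<close>)
  have "iota X n w = q"
  proof
    fix i
    show "iota X n w i = q i"
    proof (cases "i \<in> {1..deg X n}")
      case True
      then show ?thesis
        using iota_eq[OF w True] vidx_in[OF True] vpos_vidx[OF True] vpos_vidx[OF symgrp_in[OF q True]]
        by (simp add: w_def)
    qed (use iota_out symgrp_out[OF q] in simp)
  qed
  then show ?thesis using that w by blast
qed

lemma iota_id [simp]: "iota X n id = id"
proof
  fix i show "iota X n id i = id i"
    by (cases "i \<in> {1..deg X n}") (auto simp: iota_eq[OF id_weyl] vpos_vidx iota_out)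
qed

lemma iota_comp:
  assumes "w \<in> weyl n" "w' \<in> weyl n"
  shows "iota X n (w \<circ> w') = iota X n w \<circ> iota X n w'"
proof
  fix i
  show "iota X n (w \<circ> w') i = (iota X n w \<circ> iota X n w') i"
  proof (cases "i \<in> {1..deg X n}")
    case True
    then show ?thesis
      using iota_eq[OF weyl_comp[OF assms] True] vidx_iota[OF assms(2) True]
        iota_eq[OF assms(1) symgrp_in[OF iota_symgrp[OF assms(2)] True]] by simp
  qed (simp add: iota_out)
qed

section \<open>Roots as orbits of pairs\<close>

text \<open>In type B the pair \<open>(i, \<tilde>n + 2 - i)\<close> gives \<open>2\<epsilon>\<^sub>i\<close>, whence the factor \<open>1/2\<close>.\<close>

definition pair_root :: "bctype \<Rightarrow> nat \<Rightarrow> nat \<times> nat \<Rightarrow> nat \<Rightarrow> real" where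
  "pair_root X n = (\<lambda>(i, j) k. (if X = TypeB \<and> i + j = deg X n + 1 then 1 / 2 else 1) *
     (eps (vidx X n i) k - eps (vidx X n j) k))"

lemma pos_rootsI:
  "1 \<le> i \<Longrightarrow> i < j \<Longrightarrow> j \<le> int n \<Longrightarrow> (\<lambda>k. eps i k + eps j k) \<in> pos_roots X n"
  "1 \<le> i \<Longrightarrow> i < j \<Longrightarrow> j \<le> int n \<Longrightarrow> (\<lambda>k. eps i k - eps j k) \<in> pos_roots X n"
  "1 \<le> i \<Longrightarrow> i \<le> int n \<Longrightarrow> eps i \<in> pos_roots TypeB n"
  "1 \<le> i \<Longrightarrow> i \<le> int n \<Longrightarrow> (\<lambda>k. 2 * eps i k) \<in> pos_roots TypeC n"
  unfolding pos_roots_def by auto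

text \<open>The cases place the pair relative to the middle: both positions in the first half, the
  second one in the middle, opposite halves, the first one in the middle, both in the second half.
  Opposite halves give a sum of two basis vectors, or a root on one basis vector if the positions
  mirror each other.\<close>

lemma pair_root_pos:
  assumes "v \<in> posA (deg X n)"
  shows "pair_root X n v \<in> pos_roots X n"
proof -
  obtain i j where v: "v = (i, j)" and ij: "1 \<le> i" "i < j" "j \<le> deg X n"
    using assms unfolding posA_def by auto
  define j' where "j' = deg X n + 1 - j"
  define i' where "i' = deg X n + 1 - i"
  consider (a) "j \<le> n" | (b) "X = TypeB" "i \<le> n" "j = n + 1"
    | (c) "i \<le> n" "j > n" "\<not> (X = TypeB \<and> j = n + 1)"
    | (d) "X = TypeB" "i = n + 1" "j > n + 1" | (e) "i > n" "\<not> (X = TypeB \<and> i = n + 1)"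
    using ij by force
  then show ?thesis
  proof cases
    case a
    then have "pair_root X n v = (\<lambda>k. eps (int i) k - eps (int j) k)"
      using ij unfolding pair_root_def v vidx_def deg_def by (intro ext) (cases X; simp)
    then show ?thesis using pos_rootsI(2)[of "int i" "int j"] a ij by simp
  next
    case b
    then have "pair_root X n v = eps (int i)"
      using ij unfolding pair_root_def v vidx_def deg_def by (intro ext) simp
    then show ?thesis using pos_rootsI(3)[of "int i"] b ij by simp
  next
    case c
    then have j': "vidx X n j = - int j'" "1 \<le> j'" "j' \<le> n" "vidx X n i = int i"
      using ij unfolding vidx_def j'_def deg_def by (cases X; auto)+
    consider "i < j'" | "i = j'" | "i > j'" by linarith
    then show ?thesis
    proof cases
      case 1
      then have "i + j \<noteq> deg X n + 1" using ij unfolding j'_def by auto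
      then have "pair_root X n v = (\<lambda>k. eps (int i) k + eps (int j') k)"
        unfolding pair_root_def v case_prod_conv j'(1,4) by (intro ext) (simp add: eps_neg)
      then show ?thesis using pos_rootsI(1)[of "int i" "int j'"] 1 j' ij by simp
    next
      case 2
      then have "i + j = deg X n + 1" using ij unfolding j'_def by simp
      then have "pair_root X n v = (\<lambda>k. (if X = TypeB then 1 else 2) * eps (int i) k)"
        using 2 unfolding pair_root_def v case_prod_conv j'(1,4) by (intro ext) (simp add: eps_neg)
      then show ?thesis using pos_rootsI(3,4)[of "int i" n] c ij by (cases X) simp_all
    next
      case 3
      then have "i + j \<noteq> deg X n + 1" using ij unfolding j'_def by auto
      then have "pair_root X n v = (\<lambda>k. eps (int j') k + eps (int i) k)"
        unfolding pair_root_def v case_prod_conv j'(1,4) by (intro ext) (simp add: eps_neg)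
      then show ?thesis using pos_rootsI(1)[of "int j'" "int i"] 3 j' c by simp
    qed
  next
    case d
    then have "vidx X n i = 0" "vidx X n j = - int j'" "i + j \<noteq> deg X n + 1" "1 \<le> j'" "j' \<le> n"
      using ij unfolding vidx_def deg_def j'_def by auto
    then have "pair_root X n v = eps (int j')" "1 \<le> j'" "j' \<le> n"
      unfolding pair_root_def v by (auto simp: eps_neg intro!: ext)
    then show ?thesis using pos_rootsI(3)[of "int j'"] d by simp
  next
    case e
    then have "vidx X n i = - int i'" "vidx X n j = - int j'" "1 \<le> j'" "j' < i'" "i' \<le> n"
      "i + j \<noteq> deg X n + 1"
      using ij unfolding vidx_def j'_def i'_def deg_def by (cases X; auto)+
    then have "pair_root X n v = (\<lambda>k. eps (int j') k - eps (int i') k)"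
      unfolding pair_root_def v by (intro ext) (simp add: eps_neg)
    then show ?thesis using pos_rootsI(2)[of "int j'" "int i'"] \<open>1 \<le> j'\<close> \<open>j' < i'\<close> \<open>i' \<le> n\<close> by simp
  qed
qed

lemma pair_root_surj:
  assumes "u \<in> pos_roots X n"
  shows "u \<in> pair_root X n ` posA (deg X n)"
proof -
  let ?N = "deg X n"
  consider (a) i j where "u = (\<lambda>k. eps i k + eps j k)" "1 \<le> i" "i < j" "j \<le> int n"
    | (b) i j where "u = (\<lambda>k. eps i k - eps j k)" "1 \<le> i" "i < j" "j \<le> int n"
    | (c) i where "X = TypeB" "u = eps i" "1 \<le> i" "i \<le> int n"
    | (d) i where "X = TypeC" "u = (\<lambda>k. 2 * eps i k)" "1 \<le> i" "i \<le> int n"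
    using assms unfolding pos_roots_def by (cases X) auto
  then show ?thesis
  proof cases
    case a
    let ?v = "(nat i, ?N + 1 - nat j)"
    have "?v \<in> posA ?N" using a unfolding posA_def deg_def by (cases X) auto
    moreover have "vidx X n (nat i) = i" "vidx X n (?N + 1 - nat j) = - j"
      "nat i + (?N + 1 - nat j) \<noteq> ?N + 1"
      using a unfolding vidx_def deg_def by (cases X; auto)+
    then have "pair_root X n ?v = u" unfolding pair_root_def a(1) by (intro ext) (simp add: eps_neg)
    ultimately show ?thesis by blast
  next
    case b
    let ?v = "(nat i, nat j)"
    have "?v \<in> posA ?N" using b unfolding posA_def deg_def by (cases X) auto
    moreover have "vidx X n (nat i) = i" "vidx X n (nat j) = j" "nat i + nat j \<noteq> ?N + 1"
      using b unfolding vidx_def deg_def by (cases X; auto)+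
    then have "pair_root X n ?v = u" unfolding pair_root_def b(1) by (intro ext) simp
    ultimately show ?thesis by blast
  next
    case c
    let ?v = "(nat i, n + 1)"
    have "?v \<in> posA ?N" using c unfolding posA_def deg_def by auto
    moreover have "vidx X n (nat i) = i" "vidx X n (n + 1) = 0" "nat i + (n + 1) \<noteq> ?N + 1"
      using c unfolding vidx_def deg_def by auto
    then have "pair_root X n ?v = u" unfolding pair_root_def c(2) by (intro ext) simp
    ultimately show ?thesis by blast
  next
    case d
    let ?v = "(nat i, ?N + 1 - nat i)"
    have "?v \<in> posA ?N" using d unfolding posA_def deg_def by auto
    moreover have "vidx X n (nat i) = i" "vidx X n (?N + 1 - nat i) = - i"
      using d unfolding vidx_def deg_def by auto
    then have "pair_root X n ?v = u" unfolding pair_root_def d(1,2) by (intro ext) (simp add: eps_neg)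
    ultimately show ?thesis by blast
  qed
qed

text \<open>A linear functional whose weights \<open>n + 1 - k\<close> are positive and decreasing,
  so that it is positive on every positive root. It serves to show that the negative of a positive
  root is not positive.\<close>

definition ht :: "nat \<Rightarrow> (nat \<Rightarrow> real) \<Rightarrow> real" where
  "ht n v = (\<Sum>k = 1..n. v k * real (n + 1 - k))"

lemma ht_eps: "1 \<le> i \<Longrightarrow> i \<le> int n \<Longrightarrow> ht n (eps i) = real_of_int (int n + 1 - i)"
proof -
  assume i: "1 \<le> i" "i \<le> int n"
  have "ht n (eps i) = (\<Sum>k = 1..n. if k = nat i then real (n + 1 - k) else 0)"
    unfolding ht_def by (rule sum.cong) (use i in \<open>auto simp: eps_def\<close>)
  also have "\<dots> = real (n + 1 - nat i)"
  proof -
    have "nat i \<in> {1..n}" using i by (simp add: nat_le_iff Suc_le_eq)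
    then show ?thesis by (simp only: sum.delta finite_atLeastAtMost if_True)
  qed
  also have "\<dots> = real_of_int (int n + 1 - i)" using i by (simp add: of_nat_diff)
  finally show ?thesis .
qed

lemma ht_linear: "ht n (\<lambda>k. u k + v k) = ht n u + ht n v" "ht n (\<lambda>k. u k - v k) = ht n u - ht n v"
  "ht n (\<lambda>k. c * u k) = c * ht n u" "ht n (\<lambda>k. - u k) = - ht n u"
  unfolding ht_def by (simp_all add: sum.distrib sum_subtractf sum_negf sum_distrib_left algebra_simps)

lemma ht_pos: "v \<in> pos_roots X n \<Longrightarrow> ht n v > 0"
  unfolding pos_roots_def by (cases X) (auto simp: ht_linear ht_eps)

lemma pair_root_pos_iff:
  assumes "i \<in> {1..deg X n}" "j \<in> {1..deg X n}" "i \<noteq> j"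
  shows "pair_root X n (i, j) \<in> pos_roots X n \<longleftrightarrow> i < j"
proof (cases "i < j")
  case True
  then show ?thesis using pair_root_pos[of "(i, j)" X n] assms by (simp add: posA_def)
next
  case False
  then have "pair_root X n (j, i) \<in> pos_roots X n"
    using pair_root_pos[of "(j, i)" X n] assms by (simp add: posA_def)
  moreover have "pair_root X n (j, i) = (\<lambda>k. - pair_root X n (i, j) k)"
    unfolding pair_root_def by (intro ext) (auto simp: add.commute field_simps)
  ultimately have "\<not> ht n (pair_root X n (i, j)) > 0" using ht_pos ht_linear(4) by fastforce
  then show ?thesis using False ht_pos by blast
qed

lemma act_pair_root:
  assumes w: "w \<in> weyl n" and ij: "i \<in> {1..deg X n}" "j \<in> {1..deg X n}"
  shows "act n w (pair_root X n (i, j)) = pair_root X n (iota X n w i, iota X n w j)"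
proof -
  \<comment> \<open>The factor in \<open>pair_root\<close> depends on whether the two positions
    mirror each other, a property preserved by \<open>iota\<close> since its values commute with
    reversal.\<close>
  have "iota X n w i + iota X n w j = deg X n + 1 \<longleftrightarrow> i + j = deg X n + 1"
  proof -
    have "iota X n w i + iota X n w j = deg X n + 1 \<longleftrightarrow> iota X n w j = iota X n w (deg X n + 1 - i)"
      using iota_symmetric[OF w, of X] symgrp_in[OF iota_symgrp[OF w] ij(1)] ij(1)
      unfolding symmetric_def by auto
    also have "\<dots> \<longleftrightarrow> i + j = deg X n + 1"
      using symgrp_eq_iff[OF iota_symgrp[OF w, of X]] ij by auto
    finally show ?thesis .
  qed
  then show ?thesis
    unfolding pair_root_def case_prod_conv act_diff vidx_iota[OF w ij(1)] vidx_iota[OF w ij(2)]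
    using act_eps[OF w vset_abs[OF vidx_in[OF ij(1)]]] act_eps[OF w vset_abs[OF vidx_in[OF ij(2)]]]
    by simp
qed

lemma pair_root_inv_iff:
  assumes w: "w \<in> weyl n" and v: "v \<in> posA (deg X n)"
  shows "v \<in> invA (deg X n) (iota X n w) \<longleftrightarrow> pair_root X n v \<in> invBC X n w"
proof -
  obtain i j where vij: "v = (i, j)" and ij: "i \<in> {1..deg X n}" "j \<in> {1..deg X n}" "i < j"
    using v unfolding posA_def by auto
  have "iota X n w i \<noteq> iota X n w j" using symgrp_eq_iff[OF iota_symgrp[OF w, of X]] ij by simp
  then have "pair_root X n (iota X n w i, iota X n w j) \<in> pos_roots X n \<longleftrightarrow> iota X n w i < iota X n w j"
    using pair_root_pos_iff symgrp_in[OF iota_symgrp[OF w, of X]] ij by simp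
  then show ?thesis
    using act_pair_root[OF w ij(1,2)] pair_root_pos[OF v] v \<open>iota X n w i \<noteq> iota X n w j\<close>
    unfolding vij invBC_def invA_def by auto
qed

lemma pair_root_image: "pair_root X n ` posA (deg X n) = pos_roots X n"
  using pair_root_pos pair_root_surj by blast

text \<open>The bridge from roots to pairs: decompositions in the signed group can be tested on
  inversion sets of symmetric permutations.\<close>

lemma disj_union_invBC_iff:
  assumes "w \<in> weyl n" "\<forall>a\<in>{1..r}. w' a \<in> weyl n"
  shows "disj_union (invBC X n w) r (\<lambda>a. invBC X n (w' a)) \<longleftrightarrow>
    disj_union (invA (deg X n) (iota X n w)) r (\<lambda>a. invA (deg X n) (iota X n (w' a)))"
  by (rule disj_union_transfer[OF pair_root_image[of X n], symmetric])
    (use assms in \<open>simp_all add: pair_root_inv_iff invA_subset invBC_def\<close>)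

lemma invBC_inject:
  assumes "w \<in> weyl n" "w' \<in> weyl n" "invBC X n w = invBC X n w'"
  shows "w = w'"
proof -
  have "invA (deg X n) (iota X n w) = invA (deg X n) (iota X n w')"
    using pair_root_inv_iff[OF assms(1)] pair_root_inv_iff[OF assms(2)] assms(3) invA_subset by blast
  then show ?thesis using invA_inject iota_symgrp iota_inject assms by metis
qed

lemma invBC_id [simp]: "invBC X n id = {}"
  using pair_root_surj pair_root_inv_iff[OF id_weyl] unfolding invBC_def by fastforce

lemma invBC_eq_empty_iff: "w \<in> weyl n \<Longrightarrow> invBC X n w = {} \<longleftrightarrow> w = id"
  using invBC_inject[OF _ id_weyl] by auto

section \<open>The longest element is -1\<close>

definition negation :: "nat \<Rightarrow> int \<Rightarrow> int" where
  "negation n a = (if \<bar>a\<bar> \<le> int n then - a else a)"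

lemma negation_weyl: "negation n \<in> weyl n"
  by (rule weylI) (auto simp: negation_def split: if_splits)

lemma iota_negation: "iota X n (negation n) = revperm (deg X n)"
proof
  fix i show "iota X n (negation n) i = revperm (deg X n) i"
  proof (cases "i \<in> {1..deg X n}")
    case True
    then show ?thesis
      using iota_eq[OF negation_weyl True] vset_abs[OF vidx_in[OF True]] vpos_neg[OF vidx_in[OF True]]
        vpos_vidx[OF True] by (simp add: negation_def revperm_def)
  qed (auto simp: iota_out revperm_def)
qed

lemma invBC_negation: "invBC X n (negation n) = pos_roots X n"
  using pair_root_surj pair_root_inv_iff[OF negation_weyl] iota_negation unfolding invBC_def by fastforce

text \<open>Injectivity of inversion sets makes the definite description unique, so
  \<open>longest\<close> can be replaced by the explicit element -1, whose image is the
  reversal.\<close>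

lemma longest_eq: "longest X n = negation n"
  unfolding longest_def
proof (rule the_equality)
  fix w assume "w \<in> weyl n \<and> invBC X n w = pos_roots X n"
  then show "w = negation n" using invBC_inject negation_weyl invBC_negation by metis
qed (simp add: negation_weyl invBC_negation)

section \<open>Symmetric inflations\<close>

text \<open>Conjugation by reversal. Its fixed points in the symmetric group of degree
  \<open>deg X n\<close> are the images of signed permutations, and it also describes the mirrored
  inner entries.\<close>

definition conjrev :: "nat \<Rightarrow> (nat \<Rightarrow> nat) \<Rightarrow> nat \<Rightarrow> nat" where
  "conjrev k \<alpha> = revperm k \<circ> \<alpha> \<circ> revperm k"

lemma conjrev_symgrp: "\<alpha> \<in> symgrp k \<Longrightarrow> conjrev k \<alpha> \<in> symgrp k"
  unfolding conjrev_def by (intro symgrp_comp revperm_symgrp)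

lemma conjrev_conjrev [simp]: "conjrev k (conjrev k \<alpha>) = \<alpha>"
proof -
  have "revperm k (revperm k x) = x" for x unfolding revperm_def by auto
  then show ?thesis unfolding conjrev_def by (simp add: fun_eq_iff)
qed

lemma conjrev_apply:
  assumes "\<alpha> \<in> symgrp k" "x \<in> {1..k}"
  shows "conjrev k \<alpha> x = k + 1 - \<alpha> (k + 1 - x)"
proof -
  have "k + 1 - x \<in> {1..k}" using assms(2) by auto
  from symgrp_in[OF assms(1) this] assms(2) show ?thesis by (simp add: conjrev_def revperm_def)
qed

lemma symmetric_iff_conjrev:
  assumes a: "\<alpha> \<in> symgrp k"
  shows "symmetric k \<alpha> \<longleftrightarrow> conjrev k \<alpha> = \<alpha>"
proof
  assume sy: "symmetric k \<alpha>"
  show "conjrev k \<alpha> = \<alpha>"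
  proof
    fix x show "conjrev k \<alpha> x = \<alpha> x"
    proof (cases "x \<in> {1..k}")
      case True
      then show ?thesis
        using conjrev_apply[OF a True] sy symgrp_in[OF a True] unfolding symmetric_def by simp
    qed (simp only: symgrp_out[OF a] symgrp_out[OF conjrev_symgrp[OF a]] not_False_eq_True)
  qed
next
  assume e: "conjrev k \<alpha> = \<alpha>"
  show "symmetric k \<alpha>" unfolding symmetric_def
  proof
    fix x assume x: "x \<in> {1..k}"
    then have x': "k + 1 - x \<in> {1..k}" by auto
    then show "\<alpha> (k + 1 - x) = k + 1 - \<alpha> x"
      using conjrev_apply[OF a x'] e x by simp
  qed
qed

lemma conjrev_less_iff:
  assumes a: "\<alpha> \<in> symgrp k" and "x \<in> {1..k}" "y \<in> {1..k}"
  shows "conjrev k \<alpha> x < conjrev k \<alpha> y \<longleftrightarrow> \<alpha> (k + 1 - y) < \<alpha> (k + 1 - x)"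
proof -
  have "k + 1 - x \<in> {1..k}" "k + 1 - y \<in> {1..k}" using assms by auto
  from symgrp_in[OF a this(1)] symgrp_in[OF a this(2)] show ?thesis
    unfolding conjrev_apply[OF a assms(2)] conjrev_apply[OF a assms(3)] atLeastAtMost_iff by arith
qed

lemma invA_conjrev:
  assumes a: "\<alpha> \<in> symgrp k" and v: "(x, y) \<in> posA k"
  shows "(x, y) \<in> invA k (conjrev k \<alpha>) \<longleftrightarrow> (k + 1 - y, k + 1 - x) \<in> invA k \<alpha>"
  using conjrev_less_iff[OF a, of y x] v unfolding invA_def posA_def by auto

text \<open>Reflection permutes \<open>posA k\<close> and carries the inversion sets along. Hence
  the mirrored entries of a symmetric inflation impose no conditions beyond those of the first
  \<open>m\<close> entries.\<close>

lemma disj_union_conjrev: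
  assumes "\<alpha> \<in> symgrp k" "\<And>a. a \<in> {1..r} \<Longrightarrow> \<alpha>' a \<in> symgrp k"
  shows "disj_union (invA k (conjrev k \<alpha>)) r (\<lambda>a. invA k (conjrev k (\<alpha>' a))) \<longleftrightarrow>
     disj_union (invA k \<alpha>) r (\<lambda>a. invA k (\<alpha>' a))"
proof (rule disj_union_transfer[where U = "posA k" and U' = "posA k"
      and h = "\<lambda>(x, y). (k + 1 - y, k + 1 - x)"])
  show "(\<lambda>(x, y). (k + 1 - y, k + 1 - x)) ` posA k = posA k"
  proof (intro equalityI subsetI)
    fix v assume "v \<in> posA k"
    then have "v = (\<lambda>(x, y). (k + 1 - y, k + 1 - x)) (k + 1 - snd v, k + 1 - fst v)"
      "(k + 1 - snd v, k + 1 - fst v) \<in> posA k"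
      unfolding posA_def by auto
    then show "v \<in> (\<lambda>(x, y). (k + 1 - y, k + 1 - x)) ` posA k" by blast
  qed (auto simp: posA_def)
qed (use assms invA_conjrev invA_subset in auto)

text \<open>For palindromic lengths, the intervals before number \<open>s + 1 - i\<close> are as
  long in total as those after number \<open>i\<close>.\<close>

lemma offset_rev:
  assumes c: "composition k s z" and sy: "\<forall>i\<in>{1..s}. z (s + 1 - i) = z i" and i: "i \<in> {1..s}"
  shows "offset z (s + 1 - i) + (offset z i + z i) = k"
proof -
  have "offset z (s + 1 - i) = (\<Sum>j = Suc i..<Suc s. z j)"
    unfolding offset_def
    by (rule sum.reindex_bij_witness[where i = "\<lambda>j. s + 1 - j" and j = "\<lambda>j. s + 1 - j"])
      (use i sy in auto)
  moreover have "offset z i + z i = (\<Sum>j = 1..<Suc i. z j)" using i by (simp add: offset_def)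
  moreover have "(\<Sum>j = 1..<Suc i. z j) + (\<Sum>j = Suc i..<Suc s. z j) = (\<Sum>j = 1..<Suc s. z j)"
    by (rule sum.atLeastLessThan_concat) (use i in auto)
  moreover have "(\<Sum>j = 1..<Suc s. z j) = k"
    using c unfolding composition_def by (simp add: atLeastLessThanSuc_atLeastAtMost)
  ultimately show ?thesis by simp
qed

lemma blk_rev:
  assumes c: "composition k s z" and sy: "\<forall>i\<in>{1..s}. z (s + 1 - i) = z i" and x: "x \<in> {1..k}"
  shows "blk z s (k + 1 - x) = s + 1 - blk z s x"
    and "loc z s (k + 1 - x) = z (blk z s x) + 1 - loc z s x"
proof -
  let ?i = "blk z s x"
  have i: "?i \<in> {1..s}" using blk_in(1)[OF c x] .
  then have i': "s + 1 - ?i \<in> {1..s}" by auto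
  have l: "z ?i + 1 - loc z s x \<in> {1..z (s + 1 - ?i)}" using loc_in(1)[OF c x] bspec[OF sy i] by auto
  have "k + 1 - x = offset z (s + 1 - ?i) + (z ?i + 1 - loc z s x)"
    using offset_rev[OF c sy i] loc_in[OF c x] by auto
  then show "blk z s (k + 1 - x) = s + 1 - ?i" "loc z s (k + 1 - x) = z ?i + 1 - loc z s x"
    using offset_plus(2,3)[OF c i' l] by simp_all
qed

text \<open>Reversal swaps the intervals \<open>i\<close> and \<open>s + 1 - i\<close>. Palindromic
  lengths are what makes the mirrored partition equal to the original one, so that uniqueness can
  compare the two inflations.\<close>

lemma inflationA_conjrev:
  assumes infl: "inflationA k \<alpha> s z \<sigma> \<beta>" and sy: "\<forall>i\<in>{1..s}. z (s + 1 - i) = z i"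
  shows "inflationA k (conjrev k \<alpha>) s z (conjrev s \<sigma>) (\<lambda>i. conjrev (z i) (\<beta> (s + 1 - i)))"
proof -
  note c = inflationA_composition[OF infl]
  have a: "\<alpha> \<in> symgrp k" and s: "\<sigma> \<in> symgrp s" and b: "\<And>i. i \<in> {1..s} \<Longrightarrow> \<beta> i \<in> symgrp (z i)"
    using infl unfolding inflationA_def by blast+
  have b': "\<beta> (s + 1 - i) \<in> symgrp (z i)" if "i \<in> {1..s}" for i
  proof -
    have "s + 1 - i \<in> {1..s}" using that by auto
    from b[OF this] show ?thesis unfolding bspec[OF sy that] .
  qed
  have "conjrev k \<alpha> x < conjrev k \<alpha> y \<longleftrightarrow>
        (if blk z s x = blk z s y
         then conjrev (z (blk z s x)) (\<beta> (s + 1 - blk z s x)) (loc z s x)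
            < conjrev (z (blk z s x)) (\<beta> (s + 1 - blk z s x)) (loc z s y)
         else conjrev s \<sigma> (blk z s x) < conjrev s \<sigma> (blk z s y))"
    if x: "x \<in> {1..k}" and y: "y \<in> {1..k}" for x y
  proof -
    have x': "k + 1 - x \<in> {1..k}" and y': "k + 1 - y \<in> {1..k}" using x y by auto
    have bx: "blk z s x \<in> {1..s}" and b_y: "blk z s y \<in> {1..s}" using blk_in(1)[OF c] x y by auto
    note rx = blk_rev[OF c sy x] and ry = blk_rev[OF c sy y]
    show ?thesis
    proof (cases "blk z s x = blk z s y")
      case True
      have "\<alpha> (k + 1 - y) < \<alpha> (k + 1 - x) \<longleftrightarrow>
         \<beta> (s + 1 - blk z s x) (z (blk z s x) + 1 - loc z s y)
         < \<beta> (s + 1 - blk z s x) (z (blk z s x) + 1 - loc z s x)"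
        using inflationA_order_same[OF infl y' x'] unfolding rx ry True by simp
      then show ?thesis
        using conjrev_less_iff[OF a x y] conjrev_less_iff[OF b'[OF bx] loc_in(1)[OF c x]]
          loc_in(1)[OF c y] True by simp
    next
      case False
      then have "s + 1 - blk z s y \<noteq> s + 1 - blk z s x" using bx b_y by auto
      then have "\<alpha> (k + 1 - y) < \<alpha> (k + 1 - x) \<longleftrightarrow> \<sigma> (s + 1 - blk z s y) < \<sigma> (s + 1 - blk z s x)"
        using inflationA_order_diff[OF infl y' x'] unfolding rx ry by simp
      then show ?thesis
        using conjrev_less_iff[OF a x y] conjrev_less_iff[OF s bx b_y] False by simp
    qed
  qed
  then show ?thesis
    unfolding inflationA_iff_order using c conjrev_symgrp[OF a] conjrev_symgrp[OF s] conjrev_symgrp[OF b']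
    by blast
qed

lemma inflationA_cong:
  assumes "\<And>i. i \<in> {1..s} \<Longrightarrow> \<beta> i = \<beta>' i"
  shows "inflationA k \<alpha> s z \<sigma> \<beta> \<longleftrightarrow> inflationA k \<alpha> s z \<sigma> \<beta>'"
  unfolding inflationA_def using assms by (intro conj_cong ball_cong refl) simp_all

section \<open>Palindromic lengths and entries\<close>

definition lengths_ok :: "nat \<Rightarrow> nat \<Rightarrow> (nat \<Rightarrow> nat) \<Rightarrow> nat \<Rightarrow> bool" where
  "lengths_ok n m z p \<longleftrightarrow> (\<Sum>b = 1..m. z b) + p = n \<and> (\<forall>b\<in>{1..m}. 1 \<le> z b)"

lemma outer_cases: obtains (B) "outer X p = TypeB" | (C) "outer X p = TypeC" "X = TypeC" "p = 0"
  by (cases "X = TypeC \<and> p = 0") (auto simp: outer_def)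

lemma sym_lengths_rev:
  "i \<in> {1..deg (outer X p) m} \<Longrightarrow> sym_lengths X m z p (deg (outer X p) m + 1 - i) = sym_lengths X m z p i"
  by (cases rule: outer_cases[of X p]) (auto simp: sym_lengths_def deg_def)

lemma sym_lengths_palindrome:
  "\<forall>i\<in>{1..deg (outer X p) m}.
     sym_lengths X m z p (deg (outer X p) m + 1 - i) = sym_lengths X m z p i"
  by (intro ballI sym_lengths_rev)

lemma sym_index_cases:
  assumes "i \<in> {1..deg (outer X p) m}"
  obtains (low) "i \<in> {1..m}" | (mid) "outer X p = TypeB" "i = m + 1"
  | (high) b where "b \<in> {1..m}" "i = deg (outer X p) m + 1 - b" "i > m" "\<not> (outer X p = TypeB \<and> i = m + 1)"
proof -
  consider "i \<le> m" | "outer X p = TypeB" "i = m + 1" | "i > m" "\<not> (outer X p = TypeB \<and> i = m + 1)"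
    by linarith
  then show ?thesis
  proof cases
    case 3
    then have "deg (outer X p) m + 1 - i \<in> {1..m}" "i = deg (outer X p) m + 1 - (deg (outer X p) m + 1 - i)"
      using assms by (cases "outer X p"; auto simp: deg_def)+
    then show ?thesis using high 3 by blast
  qed (use assms low mid in auto)
qed

lemma deg_gt: "b \<in> {1..m} \<Longrightarrow> b \<in> {1..deg Y m}" "b \<in> {1..m} \<Longrightarrow> deg Y m + 1 - b \<in> {1..deg Y m}"
  "b \<in> {1..m} \<Longrightarrow> deg Y m + 1 - b > m"
  "b \<in> {1..m} \<Longrightarrow> \<not> (Y = TypeB \<and> deg Y m + 1 - b = m + 1)" "b \<in> {1..m} \<Longrightarrow> deg Y m + 1 - (deg Y m + 1 - b) = b"
  unfolding deg_def by (cases Y; auto)+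

lemma mid_in: "Y = TypeB \<Longrightarrow> m + 1 \<in> {1..deg Y m}" "Y = TypeB \<Longrightarrow> deg Y m + 1 - (m + 1) = m + 1"
  unfolding deg_def by auto

lemma sym_lengths_low: "b \<in> {1..m} \<Longrightarrow> sym_lengths X m z p b = z b"
  and sym_lengths_mid: "outer X p = TypeB \<Longrightarrow> sym_lengths X m z p (m + 1) = deg X p"
  and sym_entries_low: "b \<in> {1..m} \<Longrightarrow> sym_entries X m z p \<beta> \<gamma> b = \<beta> b"
  and sym_entries_mid: "outer X p = TypeB \<Longrightarrow> sym_entries X m z p \<beta> \<gamma> (m + 1) = iota X p \<gamma>"
  unfolding sym_lengths_def sym_entries_def by auto

lemma sym_entries_high:
  assumes "b \<in> {1..m}"
  shows "sym_entries X m z p \<beta> \<gamma> (deg (outer X p) m + 1 - b) = conjrev (z b) (\<beta> b)"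
  using deg_gt(3,4,5)[OF assms, of "outer X p"] unfolding sym_entries_def conjrev_def
  by (auto simp: Let_def)

lemma composition_sym:
  assumes "lengths_ok n m z p"
  shows "composition (deg X n) (deg (outer X p) m) (sym_lengths X m z p)"
proof -
  let ?s = "deg (outer X p) m" and ?Z = "sym_lengths X m z p"
  have sum: "(\<Sum>b = 1..m. z b) + p = n" and pos: "\<And>b. b \<in> {1..m} \<Longrightarrow> 1 \<le> z b"
    using assms unfolding lengths_ok_def by auto
  have low: "(\<Sum>i = 1..<m + 1. ?Z i) = (\<Sum>b = 1..m. z b)"
    by (rule sum.cong) (auto simp: sym_lengths_def)
  have high: "(\<Sum>i = ?s + 1 - m..<?s + 1. ?Z i) = (\<Sum>b = 1..m. z b)"
  proof (rule sum.reindex_bij_witness[where i = "\<lambda>b. ?s + 1 - b" and j = "\<lambda>b. ?s + 1 - b"])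
    fix i assume i: "i \<in> {?s + 1 - m..<?s + 1}"
    then show "?s + 1 - (?s + 1 - i) = i" "?s + 1 - i \<in> {1..m}" unfolding deg_def by (auto split: bctype.splits)
    from this(1) show "z (?s + 1 - i) = ?Z i"
      using sym_lengths_rev[of "?s + 1 - i" X p m z] deg_gt(2)[of "?s + 1 - i" m "outer X p"]
        sym_lengths_low[OF \<open>?s + 1 - i \<in> {1..m}\<close>] deg_gt(1)[OF \<open>?s + 1 - i \<in> {1..m}\<close>, of "outer X p"]
      by simp
  next
    fix b assume b: "b \<in> {1..m}"
    then show "?s + 1 - (?s + 1 - b) = b" "?s + 1 - b \<in> {?s + 1 - m..<?s + 1}"
      unfolding deg_def by (auto split: bctype.splits)
  qed
  have "(\<Sum>i = 1..<?s + 1. ?Z i) = deg X n"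
  proof (cases rule: outer_cases[of X p])
    case B
    then have s: "?s = 2 * m + 1" by (simp add: deg_def)
    have "(\<Sum>i = 1..<?s + 1. ?Z i) = (\<Sum>i = 1..<m + 1. ?Z i) + (\<Sum>i = m + 1..<?s + 1. ?Z i)"
      by (rule sum.atLeastLessThan_concat[symmetric]) (use s in auto)
    also have "(\<Sum>i = m + 1..<?s + 1. ?Z i) = ?Z (m + 1) + (\<Sum>i = m + 2..<?s + 1. ?Z i)"
      using s by (subst sum.atLeast_Suc_lessThan) auto
    finally have "(\<Sum>i = 1..<?s + 1. ?Z i) = (\<Sum>b = 1..m. z b) + deg X p + (\<Sum>b = 1..m. z b)"
      using low high sym_lengths_mid[OF B, of m z] s by simp
    then show ?thesis using sum by (cases X) (auto simp: deg_def)
  next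
    case C
    then have s: "?s = 2 * m" by (simp add: deg_def)
    have "(\<Sum>i = 1..<?s + 1. ?Z i) = (\<Sum>i = 1..<m + 1. ?Z i) + (\<Sum>i = m + 1..<?s + 1. ?Z i)"
      by (rule sum.atLeastLessThan_concat[symmetric]) (use s in auto)
    then have "(\<Sum>i = 1..<?s + 1. ?Z i) = 2 * (\<Sum>b = 1..m. z b)"
      using low high s by simp
    then show ?thesis using sum C by (auto simp: deg_def)
  qed
  moreover have "1 \<le> ?Z i" if "i \<in> {1..?s}" for i
    using that
  proof (cases rule: sym_index_cases)
    case low
    then show ?thesis using pos sym_lengths_low by metis
  next
    case mid
    \<comment> \<open>Only type C with \<open>p = 0\<close> has degree 0, and there the outer type
      would be C.\<close>
    then have "1 \<le> deg X p" unfolding outer_def deg_def by (cases X) (auto split: if_splits)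
    then show ?thesis using mid sym_lengths_mid by metis
  next
    case (high b)
    then show ?thesis using pos sym_lengths_low sym_lengths_rev[of b X p m z] deg_gt(1)[of b m "outer X p"]
      by metis
  qed
  ultimately show ?thesis
    unfolding composition_def by (simp add: atLeastLessThanSuc_atLeastAtMost)
qed

lemma sym_entries_symgrp:
  assumes b: "\<And>b. b \<in> {1..m} \<Longrightarrow> \<beta> b \<in> symgrp (z b)" and g: "\<gamma> \<in> weyl p"
    and i: "i \<in> {1..deg (outer X p) m}"
  shows "sym_entries X m z p \<beta> \<gamma> i \<in> symgrp (sym_lengths X m z p i)"
  using i
proof (cases rule: sym_index_cases)
  case low
  then show ?thesis using b by (simp add: sym_lengths_low sym_entries_low)
next
  case mid
  then show ?thesis
    using iota_symgrp[OF g, of X] sym_lengths_mid[OF mid(1), of m z] sym_entries_mid[OF mid(1), of m z \<beta> \<gamma>]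
    by simp
next
  case (high c)
  then show ?thesis
    using conjrev_symgrp[OF b[OF high(1)]] sym_entries_high[OF high(1), of X z p \<beta> \<gamma>]
      sym_lengths_rev[of c X p m z] sym_lengths_low[OF high(1), of X z p] deg_gt(1)[OF high(1), of "outer X p"]
    by simp
qed

text \<open>The entry list is a palindrome up to conjugation. The first and last entries are
  conjugate by construction; the middle one is fixed since it comes from a signed
  permutation.\<close>

lemma sym_entries_rev:
  assumes g: "\<gamma> \<in> weyl p" and i: "i \<in> {1..deg (outer X p) m}"
  shows "conjrev (sym_lengths X m z p i) (sym_entries X m z p \<beta> \<gamma> (deg (outer X p) m + 1 - i))
     = sym_entries X m z p \<beta> \<gamma> i"
  using i
proof (cases rule: sym_index_cases)
  case low
  then show ?thesis by (simp add: sym_lengths_low sym_entries_low sym_entries_high del: One_nat_def)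
next
  case mid
  have "conjrev (deg X p) (iota X p \<gamma>) = iota X p \<gamma>"
    using iota_symmetric[OF g] symmetric_iff_conjrev[OF iota_symgrp[OF g]] by blast
  then show ?thesis unfolding mid(2) mid_in(2)[OF mid(1)] sym_lengths_mid[OF mid(1)] sym_entries_mid[OF mid(1)] .
next
  case (high c)
  show ?thesis
    unfolding high(2) deg_gt(5)[OF high(1)] sym_entries_high[OF high(1)]
      sym_lengths_rev[OF deg_gt(1)[OF high(1)]] sym_lengths_low[OF high(1)] sym_entries_low[OF high(1)] ..
qed

section \<open>Inflations of signed permutations\<close>

lemma inflationBC_lengths: "inflationBC X n \<alpha> m z p \<sigma> \<beta> \<gamma> \<Longrightarrow> lengths_ok n m z p"
  unfolding inflationBC_def lengths_ok_def by blast

lemma inflationBC_iff: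
  "inflationBC X n \<alpha> m z p \<sigma> \<beta> \<gamma> \<longleftrightarrow>
     lengths_ok n m z p \<and> (\<forall>b\<in>{1..m}. \<beta> b \<in> symgrp (z b)) \<and> \<gamma> \<in> weyl p \<and> \<sigma> \<in> weyl m \<and> \<alpha> \<in> weyl n \<and>
     inflationA (deg X n) (iota X n \<alpha>) (deg (outer X p) m)
       (sym_lengths X m z p) (iota (outer X p) m \<sigma>) (sym_entries X m z p \<beta> \<gamma>)"
  unfolding inflationBC_def lengths_ok_def by blast

text \<open>The inflation \<open>q\<close> exists in the symmetric group. Its conjugate by reversal
  is an inflation with the same data, so uniqueness makes \<open>q\<close> symmetric and
  \<open>iota_surj\<close> lifts it.\<close>

lemma inflationBC_exists:
  assumes len: "lengths_ok n m z p" and b: "\<forall>b\<in>{1..m}. \<beta> b \<in> symgrp (z b)"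
    and g: "\<gamma> \<in> weyl p" and s: "\<sigma> \<in> weyl m"
  obtains \<alpha> where "inflationBC X n \<alpha> m z p \<sigma> \<beta> \<gamma>"
proof -
  let ?N = "deg X n" and ?s = "deg (outer X p) m" and ?Z = "sym_lengths X m z p"
    and ?E = "sym_entries X m z p \<beta> \<gamma>" and ?S = "iota (outer X p) m \<sigma>"
  have E: "\<forall>i\<in>{1..?s}. ?E i \<in> symgrp (?Z i)"
    using sym_entries_symgrp[of m \<beta> z \<gamma> p _ X] b g by blast
  obtain q where q: "inflationA ?N q ?s ?Z ?S ?E"
    using inflationA_exists[OF composition_sym[OF len, of X] iota_symgrp[OF s, of "outer X p"] E] .
  have "conjrev ?s ?S = ?S"
    using iota_symmetric[OF s] symmetric_iff_conjrev[OF iota_symgrp[OF s]] by blast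
  then have "inflationA ?N (conjrev ?N q) ?s ?Z ?S (\<lambda>i. conjrev (?Z i) (?E (?s + 1 - i)))"
    using inflationA_conjrev[OF q sym_lengths_palindrome] by simp
  then have "conjrev ?N q = q"
    by (rule inflationA_unique[OF _ q]) (rule sym_entries_rev[OF g])
  moreover have "q \<in> symgrp ?N" using q unfolding inflationA_def by blast
  ultimately obtain \<alpha> where "\<alpha> \<in> weyl n" "iota X n \<alpha> = q"
    using iota_surj symmetric_iff_conjrev by metis
  then have "inflationBC X n \<alpha> m z p \<sigma> \<beta> \<gamma>"
    unfolding inflationBC_iff using assms q by blast
  then show ?thesis by (rule that)
qed

lemma inflationBC_unique:
  assumes "inflationBC X n \<alpha> m z p \<sigma> \<beta> \<gamma>" "inflationBC X n \<alpha>' m z p \<sigma> \<beta> \<gamma>"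
  shows "\<alpha> = \<alpha>'"
  using assms iota_inject inflationA_unique unfolding inflationBC_iff by metis

lemma inflationBC_data_unique:
  assumes "inflationBC X n \<alpha> m z p \<sigma> \<beta> \<gamma>" "inflationBC X n \<alpha> m z p \<sigma>' \<beta>' \<gamma>'"
  shows "\<sigma> = \<sigma>'" "\<And>b. b \<in> {1..m} \<Longrightarrow> \<beta> b = \<beta>' b" "\<gamma> = \<gamma>'"
proof -
  let ?s = "deg (outer X p) m"
  have i: "inflationA (deg X n) (iota X n \<alpha>) ?s (sym_lengths X m z p)
      (iota (outer X p) m \<sigma>) (sym_entries X m z p \<beta> \<gamma>)"
    "inflationA (deg X n) (iota X n \<alpha>) ?s (sym_lengths X m z p)
      (iota (outer X p) m \<sigma>') (sym_entries X m z p \<beta>' \<gamma>')"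
    using assms unfolding inflationBC_iff by blast+
  note eq = inflationA_inner_unique[OF i]
  show "\<sigma> = \<sigma>'"
    using inflationA_outer_unique[OF i] assms iota_inject unfolding inflationBC_iff by metis
  show "\<beta> b = \<beta>' b" if "b \<in> {1..m}" for b
    using eq[OF deg_gt(1)[OF that]] by (simp only: sym_entries_low[OF that])
  have g: "\<gamma> \<in> weyl p" "\<gamma>' \<in> weyl p" using assms unfolding inflationBC_iff by blast+
  show "\<gamma> = \<gamma>'"
  proof (cases rule: outer_cases[of X p])
    case B
    then have "iota X p \<gamma> = iota X p \<gamma>'" using eq[OF mid_in(1)[OF B]] by (simp only: sym_entries_mid[OF B])
    then show ?thesis using iota_inject[OF g] by blast
  next
    case C
    \<comment> \<open>There is no middle entry to compare, but the group of rank 0 is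
      trivial.\<close>
    then show ?thesis using g unfolding weyl_def by simp
  qed
qed

text \<open>Signed version of \<open>inflationA_of_cross\<close>. The inner entries \<open>E\<close>
  found there are unique, so mirroring shows that they form a palindrome: the first \<open>m\<close>
  give \<open>\<beta>\<close>, the rest are determined by these and the middle entry.\<close>

lemma inflationBC_of_cross:
  assumes len: "lengths_ok n m z p" and w: "w \<in> weyl n" and t: "\<tau> \<in> weyl m"
    and cross: "\<And>x y. (x, y) \<in> posA (deg X n) \<Longrightarrow>
        blk (sym_lengths X m z p) (deg (outer X p) m) x \<noteq> blk (sym_lengths X m z p) (deg (outer X p) m) y \<Longrightarrow>
        (x, y) \<in> invA (deg X n) (iota X n w) \<longleftrightarrow>
        (blk (sym_lengths X m z p) (deg (outer X p) m) x, blk (sym_lengths X m z p) (deg (outer X p) m) y)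
          \<in> invA (deg (outer X p) m) (iota (outer X p) m \<tau>)"
  obtains \<beta> \<gamma> where "\<beta> \<in> (\<Pi>\<^sub>E b\<in>{1..m}. symgrp (z b))" "inflationBC X n w m z p \<tau> \<beta> \<gamma>"
proof -
  let ?N = "deg X n" and ?s = "deg (outer X p) m" and ?Z = "sym_lengths X m z p"
    and ?S = "iota (outer X p) m \<tau>" and ?q = "iota X n w"
  obtain E where E: "inflationA ?N ?q ?s ?Z ?S E"
    using inflationA_of_cross[OF composition_sym[OF len, of X] iota_symgrp[OF w] iota_symgrp[OF t] cross] by metis
  have Ein: "E i \<in> symgrp (?Z i)" if "i \<in> {1..?s}" for i using E that unfolding inflationA_def by blast
  have "conjrev ?s ?S = ?S" "conjrev ?N ?q = ?q"
    using iota_symmetric symmetric_iff_conjrev iota_symgrp w t by blast+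
  then have "inflationA ?N ?q ?s ?Z ?S (\<lambda>i. conjrev (?Z i) (E (?s + 1 - i)))"
    using inflationA_conjrev[OF E sym_lengths_palindrome] by simp
  then have rev: "conjrev (?Z i) (E (?s + 1 - i)) = E i" if "i \<in> {1..?s}" for i
    using inflationA_inner_unique[OF _ E that] by blast
  define \<beta> where "\<beta> = restrict E {1..m}"
  \<comment> \<open>A middle entry is its own conjugate and therefore comes from a signed
    permutation; if there is none, the identity serves.\<close>
  have "\<exists>\<gamma>. \<gamma> \<in> weyl p \<and> (outer X p = TypeB \<longrightarrow> iota X p \<gamma> = E (m + 1))"
  proof (cases rule: outer_cases[of X p])
    case B
    have "E (m + 1) \<in> symgrp (deg X p)"
      using Ein[OF mid_in(1)[OF B]] unfolding sym_lengths_mid[OF B] .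
    moreover have "conjrev (deg X p) (E (m + 1)) = E (m + 1)"
      using rev[OF mid_in(1)[OF B]] unfolding sym_lengths_mid[OF B] mid_in(2)[OF B] .
    ultimately show ?thesis using iota_surj symmetric_iff_conjrev by metis
  qed (use id_weyl in auto)
  then obtain \<gamma> where g: "\<gamma> \<in> weyl p" "outer X p = TypeB \<Longrightarrow> iota X p \<gamma> = E (m + 1)" by blast
  have b: "\<beta> \<in> (\<Pi>\<^sub>E b\<in>{1..m}. symgrp (z b))"
    using Ein deg_gt(1)[of _ m "outer X p"] sym_lengths_low[of _ m X z p] unfolding \<beta>_def
    by (fastforce simp: restrict_PiE_iff)
  have "sym_entries X m z p \<beta> \<gamma> i = E i" if "i \<in> {1..?s}" for i
    using that
  proof (cases rule: sym_index_cases)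
    case low
    then show ?thesis by (simp add: sym_entries_low \<beta>_def)
  next
    case mid
    then show ?thesis using g(2) sym_entries_mid by metis
  next
    case (high c)
    have "E i = conjrev (z c) (E c)"
      using rev[OF that] unfolding high(2) deg_gt(5)[OF high(1)] sym_lengths_rev[OF deg_gt(1)[OF high(1)]]
        sym_lengths_low[OF high(1)] by simp
    moreover have "sym_entries X m z p \<beta> \<gamma> i = conjrev (z c) (\<beta> c)"
      unfolding high(2) by (rule sym_entries_high[OF high(1)])
    ultimately show ?thesis using high(1) by (simp add: \<beta>_def)
  qed
  then have "inflationA ?N ?q ?s ?Z ?S (sym_entries X m z p \<beta> \<gamma>)" using E inflationA_cong by metis
  then have "inflationBC X n w m z p \<tau> \<beta> \<gamma>"
    unfolding inflationBC_iff using len b g(1) w t by (auto simp: PiE_iff)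
  then show ?thesis using that b by blast
qed

text \<open>This passes to the extensional representative of \<open>\<beta>\<close>, the form in
  which \<open>inflated_decomp\<close> asks for uniqueness.\<close>

lemma inflationBC_restrict:
  assumes "inflationBC X n \<alpha> m z p \<sigma> \<beta> \<gamma>"
  shows "inflationBC X n \<alpha> m z p \<sigma> (restrict \<beta> {1..m}) \<gamma>"
proof -
  have "sym_entries X m z p (restrict \<beta> {1..m}) \<gamma> i = sym_entries X m z p \<beta> \<gamma> i"
    if "i \<in> {1..deg (outer X p) m}" for i
    using that by (cases rule: sym_index_cases) (auto simp: sym_entries_low sym_entries_high sym_entries_mid
        simp del: One_nat_def Suc_eq_plus1 add_Suc_right add_Suc)
  then have "inflationA k q (deg (outer X p) m) Z S (sym_entries X m z p (restrict \<beta> {1..m}) \<gamma>)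
      \<longleftrightarrow> inflationA k q (deg (outer X p) m) Z S (sym_entries X m z p \<beta> \<gamma>)" for k q Z S
    by (rule inflationA_cong)
  then show ?thesis using assms unfolding inflationBC_iff by simp
qed

lemma ball_sym_index:
  assumes "\<And>b. b \<in> {1..m} \<Longrightarrow> P (deg Y m + 1 - b) \<longleftrightarrow> P b" and Y: "Y = outer X p"
  shows "(\<forall>i\<in>{1..deg Y m}. P i) \<longleftrightarrow> (\<forall>b\<in>{1..m}. P b) \<and> (Y = TypeB \<longrightarrow> P (m + 1))"
proof (intro iffI ballI)
  fix i assume h: "(\<forall>b\<in>{1..m}. P b) \<and> (Y = TypeB \<longrightarrow> P (m + 1))" and "i \<in> {1..deg Y m}"
  then have "i \<in> {1..deg (outer X p) m}" using Y by simp
  then show "P i" by (cases rule: sym_index_cases) (use assms h in auto)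
qed (use mid_in(1)[of Y m] deg_gt(1)[of _ m Y] in blast)

text \<open>The independence of components carried over to signed permutations: mirrored entries
  repeat the conditions of the originals, and for type C of rank 0 the condition on the middle is
  void because there are no roots.\<close>

lemma inflationBC_disj_union:
  assumes i: "inflationBC X n \<alpha> m z p \<sigma> \<beta> \<gamma>"
    and ia: "\<forall>a\<in>{1..r}. inflationBC X n (\<alpha>' a) m z p (\<sigma>' a) (\<beta>' a) (\<gamma>' a)"
  shows "disj_union (invBC X n \<alpha>) r (\<lambda>a. invBC X n (\<alpha>' a)) \<longleftrightarrow>
     disj_union (invBC (outer X p) m \<sigma>) r (\<lambda>a. invBC (outer X p) m (\<sigma>' a)) \<and>
     (\<forall>b\<in>{1..m}. disj_union (invA (z b) (\<beta> b)) r (\<lambda>a. invA (z b) (\<beta>' a b))) \<and>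
     disj_union (invBC X p \<gamma>) r (\<lambda>a. invBC X p (\<gamma>' a))"
proof -
  let ?s = "deg (outer X p) m" and ?Z = "sym_lengths X m z p"
  let ?P = "\<lambda>i. disj_union (invA (?Z i) (sym_entries X m z p \<beta> \<gamma> i)) r
      (\<lambda>a. invA (?Z i) (sym_entries X m z p (\<beta>' a) (\<gamma>' a) i))"
  note h = i[unfolded inflationBC_iff] and ha = ia[unfolded inflationBC_iff]
  have low: "?P b \<longleftrightarrow> disj_union (invA (z b) (\<beta> b)) r (\<lambda>a. invA (z b) (\<beta>' a b))" if "b \<in> {1..m}" for b
    unfolding sym_lengths_low[OF that] sym_entries_low[OF that] ..
  have high: "?P (?s + 1 - b) \<longleftrightarrow> ?P b" if b: "b \<in> {1..m}" for b
    unfolding low[OF b] unfolding sym_lengths_rev[OF deg_gt(1)[OF b]] sym_lengths_low[OF b] sym_entries_high[OF b]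
    by (rule disj_union_conjrev) (use h ha b in blast)+
  have g: "\<gamma> \<in> weyl p" "\<And>a. a \<in> {1..r} \<Longrightarrow> \<gamma>' a \<in> weyl p" using h ha by blast+
  have mid: "(outer X p = TypeB \<longrightarrow> ?P (m + 1)) \<longleftrightarrow> disj_union (invBC X p \<gamma>) r (\<lambda>a. invBC X p (\<gamma>' a))"
  proof (cases rule: outer_cases[of X p])
    case B
    have "disj_union (invBC X p \<gamma>) r (\<lambda>a. invBC X p (\<gamma>' a)) \<longleftrightarrow>
        disj_union (invA (deg X p) (iota X p \<gamma>)) r (\<lambda>a. invA (deg X p) (iota X p (\<gamma>' a)))"
      by (rule disj_union_invBC_iff) (use g in blast)+
    then show ?thesis unfolding sym_lengths_mid[OF B] sym_entries_mid[OF B] using B by blast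
  next
    case C
    then have "pos_roots X p = {}" by (auto simp: pos_roots_def)
    then have "invBC X p w = {}" for w unfolding invBC_def by blast
    then show ?thesis using C by (simp add: disj_union_iff_du du_def)
  qed
  have "disj_union (invBC X n \<alpha>) r (\<lambda>a. invBC X n (\<alpha>' a)) \<longleftrightarrow>
      disj_union (invA (deg X n) (iota X n \<alpha>)) r (\<lambda>a. invA (deg X n) (iota X n (\<alpha>' a)))"
    by (rule disj_union_invBC_iff) (use h ha in blast)+
  also have "\<dots> \<longleftrightarrow> disj_union (invA ?s (iota (outer X p) m \<sigma>)) r (\<lambda>a. invA ?s (iota (outer X p) m (\<sigma>' a)))
      \<and> (\<forall>i\<in>{1..?s}. ?P i)"
    by (rule inflationA_disj_union) (use h ha in blast)+
  also have "disj_union (invA ?s (iota (outer X p) m \<sigma>)) r (\<lambda>a. invA ?s (iota (outer X p) m (\<sigma>' a)))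
     \<longleftrightarrow> disj_union (invBC (outer X p) m \<sigma>) r (\<lambda>a. invBC (outer X p) m (\<sigma>' a))"
    by (rule disj_union_invBC_iff[symmetric]) (use h ha in blast)+
  also have "(\<forall>i\<in>{1..?s}. ?P i) \<longleftrightarrow> (\<forall>b\<in>{1..m}. ?P b) \<and> (outer X p = TypeB \<longrightarrow> ?P (m + 1))"
    by (rule ball_sym_index) (use high in auto)
  finally show ?thesis unfolding mid using low by auto
qed

section \<open>Simple permutations\<close>

text \<open>If no outside point separates two values of the interval, the image has no gap: a
  missing value between minimum and maximum would have an outside preimage \<open>t\<close>
  separating the points where these are attained.\<close>

lemma block_of_uniform:
  assumes a: "\<alpha> \<in> symgrp k" and ij: "1 \<le> i" "i \<le> j" "j \<le> k"
    and unif: "\<And>t u w. t \<in> {1..k} - {i..j} \<Longrightarrow> u \<in> {i..j} \<Longrightarrow> w \<in> {i..j} \<Longrightarrow> \<alpha> t < \<alpha> u \<longleftrightarrow> \<alpha> t < \<alpha> w"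
  shows "block k \<alpha> (j + 1 - i) {i..j}"
proof -
  let ?A = "\<alpha> ` {i..j}"
  have fin: "finite ?A" "?A \<noteq> {}" using ij by auto
  have sub: "{i..j} \<subseteq> {1..k}" using ij by auto
  have A: "?A = {Min ?A..Max ?A}"
  proof (intro equalityI subsetI)
    fix y assume y: "y \<in> {Min ?A..Max ?A}"
    obtain u w where u: "u \<in> {i..j}" "\<alpha> u = Min ?A" and w: "w \<in> {i..j}" "\<alpha> w = Max ?A"
      using Min_in[OF fin] Max_in[OF fin] by (metis imageE)
    have "\<alpha> u \<in> {1..k}" "\<alpha> w \<in> {1..k}" using symgrp_in[OF a] u(1) w(1) sub by blast+
    then have "y \<in> {1..k}" using y unfolding u(2) w(2) atLeastAtMost_iff by linarith
    then obtain t where t: "t \<in> {1..k}" "\<alpha> t = y" using symgrp_surj[OF a] by blast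
    show "y \<in> ?A"
    proof (rule ccontr)
      assume n: "y \<notin> ?A"
      then have t': "t \<in> {1..k} - {i..j}" using t by blast
      have "\<alpha> t \<noteq> \<alpha> w" "\<alpha> t \<noteq> \<alpha> u" using n t u w by blast+
      moreover have "Min ?A \<le> \<alpha> t" "\<alpha> t \<le> Max ?A" using y t(2) by simp_all
      ultimately have "\<alpha> t < \<alpha> w" "\<not> \<alpha> t < \<alpha> u" unfolding u(2) w(2) by linarith+
      then show False using unif[OF t' u(1) w(1)] by blast
    qed
  qed (use fin in auto)
  have "inj_on \<alpha> {i..j}" using symgrp_eq_iff[OF a] by (auto simp: inj_on_def)
  then have "card ?A = j + 1 - i" by (simp add: card_image)
  moreover have "card ?A = Max ?A + 1 - Min ?A" using A by (metis card_atLeastAtMost Suc_eq_plus1)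
  moreover have "Min ?A \<le> Max ?A" using fin by simp
  ultimately have "Suc (Max ?A) = Min ?A + (j + 1 - i)" by linarith
  then have "{Min ?A..Max ?A} = {Min ?A..<Min ?A + (j + 1 - i)}"
    by (metis atLeastLessThanSuc_atLeastAtMost)
  with A have "?A = {Min ?A..<Min ?A + (j + 1 - i)}" by (rule trans)
  moreover have "{i..j} = {i..<i + (j + 1 - i)}" using ij by auto
  ultimately show ?thesis unfolding block_def using sub by blast
qed

lemma inflationA_block:
  assumes infl: "inflationA k \<alpha> s z \<sigma> \<beta>" and i: "i \<in> {1..s}"
  shows "block k \<alpha> (z i) (intvl z i)"
proof -
  note c = inflationA_composition[OF infl]
  have zi: "1 \<le> z i" using c i unfolding composition_def by blast
  have a: "\<alpha> \<in> symgrp k" using infl unfolding inflationA_def by blast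
  have "block k \<alpha> (offset z i + z i + 1 - (offset z i + 1)) {offset z i + 1..offset z i + z i}"
  proof (rule block_of_uniform[OF a])
    fix t u w
    assume t: "t \<in> {1..k} - {offset z i + 1..offset z i + z i}"
      and u: "u \<in> {offset z i + 1..offset z i + z i}" and w: "w \<in> {offset z i + 1..offset z i + z i}"
    have b: "blk z s u = i" "blk z s w = i" using blk_eq[OF i] u w unfolding intvl_def by blast+
    have in_k: "u \<in> {1..k}" "w \<in> {1..k}" "t \<in> {1..k}" using u w t offset_le[OF c i] by auto
    have "blk z s t \<noteq> i" using blk_in(2)[OF c in_k(3)] t unfolding intvl_def by auto
    then show "\<alpha> t < \<alpha> u \<longleftrightarrow> \<alpha> t < \<alpha> w"
      using inflationA_order_diff[OF infl in_k(3,1)] inflationA_order_diff[OF infl in_k(3,2)] b by simp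
  qed (use zi offset_le[OF c i] in auto)
  then show ?thesis unfolding intvl_def by simp
qed

text \<open>Only the values \<open>Q i j\<close> with \<open>i < j\<close> matter: \<open>Q\<close> stands for an undirected graph on \<open>{1..s}\<close>
  that has no interval as a proper nontrivial module.\<close>

definition prime_graph :: "nat \<Rightarrow> (nat \<Rightarrow> nat \<Rightarrow> bool) \<Rightarrow> bool" where
  "prime_graph s Q \<longleftrightarrow> (\<forall>i j. 1 \<le> i \<longrightarrow> i < j \<longrightarrow> j \<le> s \<longrightarrow> (i, j) \<noteq> (1, s) \<longrightarrow>
     (\<exists>t\<in>{1..s} - {i..j}. \<exists>u\<in>{i..j}. \<exists>w\<in>{i..j}. Q (min t u) (max t u) \<noteq> Q (min t w) (max t w)))"

lemma prime_graphE:
  assumes "prime_graph s Q" "1 \<le> i" "i < j" "j \<le> s" "(i, j) \<noteq> (1, s)"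
  obtains t u w where "t \<in> {1..s} - {i..j}" "u \<in> {i..j}" "w \<in> {i..j}"
    "Q (min t u) (max t u)" "\<not> Q (min t w) (max t w)"
  using assms unfolding prime_graph_def by metis

lemma prime_graph_not: "prime_graph s (\<lambda>i j. \<not> Q i j) \<longleftrightarrow> prime_graph s Q"
  unfolding prime_graph_def by simp

text \<open>A point outside \<open>{i..j}\<close> lies entirely on one side of it, so being in
  inversion with all or none of its points means comparing uniformly with their values. Thus an
  interval module of the inversion graph would be a block.\<close>

lemma simple_prime_graph:
  assumes s: "simpleA s \<sigma>"
  shows "prime_graph s (\<lambda>i j. (i, j) \<in> invA s \<sigma>)"
  unfolding prime_graph_def
proof (intro allI impI, rule ccontr)
  fix i j assume ij: "1 \<le> i" "i < j" "j \<le> s" "(i, j) \<noteq> (1, s)"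
    and n: "\<not> (\<exists>t\<in>{1..s} - {i..j}. \<exists>u\<in>{i..j}. \<exists>w\<in>{i..j}.
      ((min t u, max t u) \<in> invA s \<sigma>) \<noteq> ((min t w, max t w) \<in> invA s \<sigma>))"
  have sg: "\<sigma> \<in> symgrp s" using s unfolding simpleA_def by blast
  have "block s \<sigma> (j + 1 - i) {i..j}"
  proof (rule block_of_uniform[OF sg])
    fix t u w assume t: "t \<in> {1..s} - {i..j}" and u: "u \<in> {i..j}" and w: "w \<in> {i..j}"
    have "(min t u, max t u) \<in> invA s \<sigma> \<longleftrightarrow> (min t w, max t w) \<in> invA s \<sigma>" using n t u w by blast
    moreover have "\<sigma> t < \<sigma> v \<longleftrightarrow> ((min t v, max t v) \<in> invA s \<sigma> \<longleftrightarrow> j < t)" if v: "v \<in> {i..j}" for v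
    proof -
      have "\<sigma> t < \<sigma> v \<longleftrightarrow> t < v \<and> (t, v) \<notin> invA s \<sigma> \<or> (v, t) \<in> invA s \<sigma>"
        using invA_less_iff[OF sg, of t v] t v ij by auto
      moreover have "t < i \<or> j < t" using t by auto
      ultimately show ?thesis using v invA_subset[of s \<sigma>] by (auto simp: posA_def min_def max_def)
    qed
    ultimately show "\<sigma> t < \<sigma> u \<longleftrightarrow> \<sigma> t < \<sigma> w" using u w by blast
  qed (use ij in auto)
  moreover have "1 < j + 1 - i" "j + 1 - i < s" using ij by auto
  ultimately show False using s unfolding simpleA_def by blast
qed

section \<open>Minus-decomposability and simplicity\<close>

lemma inflationA_cross_iff:
  assumes infl: "inflationA k \<alpha> s z \<sigma> \<beta>" and xy: "(x, y) \<in> posA k" and ne: "blk z s x \<noteq> blk z s y"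
  shows "(x, y) \<in> invA k \<alpha> \<longleftrightarrow> (blk z s x, blk z s y) \<in> invA s \<sigma>"
proof -
  have "(x, y) \<in> invA k \<alpha> \<longleftrightarrow> liftA z s (invA s \<sigma>) (\<lambda>i. invA (z i) (\<beta> i)) (x, y)"
    using infl xy unfolding inflationA_iff by blast
  then show ?thesis using ne by (simp add: liftA_def)
qed

lemma posA_blk:
  assumes "composition k s z" "x \<in> {1..k}" "y \<in> {1..k}" "blk z s x < blk z s y"
  shows "(x, y) \<in> posA k" "(blk z s x, blk z s y) \<in> posA s"
  using blk_less[OF assms] blk_in(1)[OF assms(1,2)] blk_in(1)[OF assms(1,3)] assms
  unfolding posA_def by auto

lemma minus_decomposable_rev:
  assumes infl: "inflationA k \<alpha> s z (revperm s) \<beta>" and s: "2 \<le> s"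
  shows "minus_decomposable k \<alpha>"
proof -
  note c = inflationA_composition[OF infl]
  have a: "\<alpha> \<in> symgrp k" using infl unfolding inflationA_def by blast
  have z: "1 \<le> z 1" "1 \<le> z 2" "z 1 + z 2 \<le> k"
    using c s offset_le[OF c, of 2] unfolding composition_def by (auto simp: offset_def numeral_2_eq_2)
  \<comment> \<open>The first interval is kept and all later ones are merged.\<close>
  define z' where "z' i = (if i = 1 then z 1 else k - z 1)" for i :: nat
  have c': "composition k 2 z'" unfolding composition_def z'_def using z by (auto simp: numeral_2_eq_2)
  have b': "blk z' 2 x = (if x \<le> z 1 then 1 else 2)" if "x \<in> {1..k}" for x
  proof (cases "x \<le> z 1")
    case True
    then show ?thesis using blk_eq[of 1 2 x z'] that by (simp add: intvl_def offset_def z'_def)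
  next
    case False
    then show ?thesis using blk_eq[of 2 2 x z'] that z by (simp add: intvl_def offset_def z'_def numeral_2_eq_2)
  qed
  have b: "blk z s x = 1 \<longleftrightarrow> x \<le> z 1" if "x \<in> {1..k}" for x
  proof
    assume "blk z s x = 1"
    then show "x \<le> z 1" using blk_in(2)[OF c that] by (simp add: intvl_def offset_def)
  next
    assume "x \<le> z 1"
    then show "blk z s x = 1" using blk_eq[of 1 s x z] that s by (simp add: intvl_def offset_def)
  qed
  obtain \<beta>' where "inflationA k \<alpha> 2 z' (revperm 2) \<beta>'"
  proof (rule inflationA_of_cross[OF c' a revperm_symgrp])
    fix x y assume xy: "(x, y) \<in> posA k" and ne: "blk z' 2 x \<noteq> blk z' 2 y"
    then have x: "x \<in> {1..k}" "y \<in> {1..k}" "x < y" unfolding posA_def by auto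
    have bx: "blk z s x = 1" "blk z s y \<noteq> 1" and bx': "blk z' 2 x = 1" "blk z' 2 y = 2"
      using ne x b b' by (auto split: if_splits)
    have "blk z s x < blk z s y" using bx blk_in(1)[OF c x(2)] by auto
    then have "(x, y) \<in> invA k \<alpha>"
      using inflationA_cross_iff[OF infl xy] posA_blk(2)[OF c x(1,2)] by simp
    then show "(x, y) \<in> invA k \<alpha> \<longleftrightarrow> (blk z' 2 x, blk z' 2 y) \<in> invA 2 (revperm 2)"
      using bx' by (simp add: posA_def)
  qed
  then show ?thesis unfolding minus_decomposable_def by blast
qed

lemma minus_decomposable_cut:
  assumes "minus_decomposable k \<alpha>"
  obtains l where "1 \<le> l" "l < k" "\<And>x y. 1 \<le> x \<Longrightarrow> x \<le> l \<Longrightarrow> l < y \<Longrightarrow> y \<le> k \<Longrightarrow> (x, y) \<in> invA k \<alpha>"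
proof -
  obtain z \<beta> where infl: "inflationA k \<alpha> 2 z (revperm 2) \<beta>"
    using assms unfolding minus_decomposable_def by blast
  note c = inflationA_composition[OF infl]
  have z: "1 \<le> z 1" "1 \<le> z 2" "z 1 + z 2 = k"
    using c unfolding composition_def by (auto simp: numeral_2_eq_2)
  have "(x, y) \<in> invA k \<alpha>" if "1 \<le> x" "x \<le> z 1" "z 1 < y" "y \<le> k" for x y
  proof -
    have "blk z 2 x = 1" using blk_eq[of 1 2 x z] that by (simp add: intvl_def offset_def)
    moreover have "blk z 2 y = 2" using blk_eq[of 2 2 y z] that z by (simp add: intvl_def offset_def numeral_2_eq_2)
    moreover have "(x, y) \<in> posA k" using that by (simp add: posA_def)
    ultimately show ?thesis using inflationA_cross_iff[OF infl] by (simp add: posA_def)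
  qed
  then show ?thesis using that[of "z 1"] z by simp
qed

text \<open>A cut at \<open>l\<close> with every pair across it inverted would give the inversion
  graph of \<open>\<sigma>\<close> an interval module: \<open>{2..s}\<close>, \<open>{1..t}\<close>
  or \<open>{1..s - 1}\<close>, according to the number t of the interval that contains
  \<open>l\<close>.\<close>

lemma not_minus_decomposable_simple:
  assumes infl: "inflationA k \<alpha> s z \<sigma> \<beta>" and s: "4 \<le> s" and simple: "simpleA s \<sigma>"
  shows "\<not> minus_decomposable k \<alpha>"
proof
  assume "minus_decomposable k \<alpha>"
  then obtain l where l: "1 \<le> l" "l < k"
    and inv: "\<And>x y. 1 \<le> x \<Longrightarrow> x \<le> l \<Longrightarrow> l < y \<Longrightarrow> y \<le> k \<Longrightarrow> (x, y) \<in> invA k \<alpha>"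
    by (rule minus_decomposable_cut) blast
  note c = inflationA_composition[OF infl]
  note prime = simple_prime_graph[OF simple]
  let ?t = "blk z s l"
  have lk: "l \<in> {1..k}" "k \<in> {1..k}" using l by auto
  have t: "?t \<in> {1..s}" using blk_in(1)[OF c lk(1)] .
  have inv1: "(i, j) \<in> invA s \<sigma>" if ij: "1 \<le> i" "i \<le> ?t" "?t < j" "j \<le> s" for i j
  proof -
    \<comment> \<open>The cut may run through the interval of \<open>l\<close>; the point
      \<open>l\<close> itself then represents that interval on the left side.\<close>
    obtain x where x: "x \<in> {1..k}" "x \<le> l" "blk z s x = i"
    proof (cases "i = ?t")
      case True
      then show ?thesis using that lk by blast
    next
      case False
      obtain x where x: "x \<in> {1..k}" "blk z s x = i" using blk_rep[OF c, of i] ij t by auto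
      then have "x < l" using blk_less[OF c x(1) lk(1)] False ij by simp
      then show ?thesis using that x by simp
    qed
    obtain y where y: "y \<in> {1..k}" "blk z s y = j" using blk_rep[OF c, of j] ij by auto
    then have "l < y" using blk_less[OF c lk(1) y(1)] ij by simp
    then show ?thesis using inv[of x y] x y inflationA_cross_iff[OF infl, of x y] ij
      by (simp add: posA_def)
  qed
  \<comment> \<open>If \<open>l\<close> lies in the last interval there is no interval beyond it,
    but the point \<open>k\<close> of that interval is still right of the cut.\<close>
  have inv2: "(i, s) \<in> invA s \<sigma>" if ij: "?t = s" "1 \<le> i" "i < s" for i
  proof -
    obtain x where x: "x \<in> {1..k}" "blk z s x = i" using blk_rep[OF c, of i] ij by auto
    then have "x < l" using blk_less[OF c x(1) lk(1)] ij by simp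
    moreover have "blk z s k = s" using composition_1(4)[OF c] s by simp
    ultimately show ?thesis using inv[of x k] x l inflationA_cross_iff[OF infl, of x k] ij
      by (simp add: posA_def)
  qed
  consider "?t = 1" | "1 < ?t" "?t < s" | "?t = s" using t by force
  then show False
  proof cases
    case 1
    obtain i u w where "i \<in> {1..s} - {2..s}" "w \<in> {2..s}" "(min i w, max i w) \<notin> invA s \<sigma>"
      by (rule prime_graphE[OF prime, of 2 s]) (use s in auto)
    moreover from this have "i = 1" by auto
    ultimately show False using inv1[of 1 w] 1 by (auto simp: min_def max_def)
  next
    case 2
    obtain i u w where "i \<in> {1..s} - {1..?t}" "w \<in> {1..?t}" "(min i w, max i w) \<notin> invA s \<sigma>"
      by (rule prime_graphE[OF prime, of 1 ?t]) (use 2 in auto)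
    then show False using inv1[of w i] by (auto simp: min_def max_def split: if_splits)
  next
    case 3
    obtain i u w where "i \<in> {1..s} - {1..s - 1}" "w \<in> {1..s - 1}" "(min i w, max i w) \<notin> invA s \<sigma>"
      by (rule prime_graphE[OF prime, of 1 "s - 1"]) (use s in auto)
    moreover from this have "i = s" by auto
    ultimately show False using inv2[of w] 3 by (auto simp: min_def max_def split: if_splits)
  qed
qed

text \<open>The intervals of an inflation are blocks, so in a simple permutation all have length 1.
  With \<open>m'\<close> different from \<open>m\<close> this leaves \<open>p > 0\<close>, and then
  the middle interval has length at least 2.\<close>

lemma simpleBC_of_simpleA:
  assumes w: "w \<in> weyl m" and simple: "simpleA (deg Y m) (iota Y m w)"
  shows "simpleBC Y m w"
  unfolding simpleBC_def
proof (intro conjI notI w, elim exE conjE)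
  fix m' z p \<sigma> \<beta> \<gamma>
  assume m': "m' \<noteq> 0" "m' \<noteq> m" and infl: "inflationBC Y m w m' z p \<sigma> \<beta> \<gamma>"
  let ?s = "deg (outer Y p) m'" and ?Z = "sym_lengths Y m' z p"
  have i: "inflationA (deg Y m) (iota Y m w) ?s ?Z (iota (outer Y p) m' \<sigma>) (sym_entries Y m' z p \<beta> \<gamma>)"
    and sum: "(\<Sum>b = 1..m'. z b) + p = m" and z: "\<And>b. b \<in> {1..m'} \<Longrightarrow> 1 \<le> z b"
    using infl unfolding inflationBC_def by blast+
  note c = inflationA_composition[OF i]
  have s: "2 \<le> ?s" using m' by (cases "outer Y p") (auto simp: deg_def)
  \<comment> \<open>A second interval \<open>j'\<close> keeps the \<open>j\<close>-th one from being
    everything, so simplicity bounds its length by 1.\<close>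
  have small: "?Z j \<le> 1" if j: "j \<in> {1..?s}" for j
  proof -
    define j' where "j' = (if j = 1 then 2 else 1 :: nat)"
    have j': "j' \<in> {1..?s}" "j' \<noteq> j" using s by (auto simp: j'_def)
    have "(\<Sum>i\<in>{j, j'}. ?Z i) \<le> (\<Sum>i = 1..?s. ?Z i)" by (rule sum_mono2) (use j j' in auto)
    then have "?Z j + ?Z j' \<le> deg Y m" using j'(2) c unfolding composition_def by simp
    moreover have "1 \<le> ?Z j'" using c j'(1) unfolding composition_def by blast
    ultimately show ?thesis
      using simple inflationA_block[OF i j] unfolding simpleA_def by (meson not_le add_strict_increasing2
          le_neq_implies_less less_le_trans less_add_same_cancel1 zero_less_one)
  qed
  have "z b = 1" if b: "b \<in> {1..m'}" for b
    using small[OF deg_gt(1)[OF b]] sym_lengths_low[OF b] z[OF b] by (metis le_antisym)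
  then have "m' + p = m" using sum by simp
  then have p: "p \<noteq> 0" using m' by simp
  then have B: "outer Y p = TypeB" by (simp add: outer_def)
  show False using small[OF mid_in(1)[OF B]] p unfolding sym_lengths_mid[OF B]
    by (cases Y) (auto simp: deg_def)
qed

section \<open>Edge colourings without rainbow triangles\<close>

text \<open>Stronger than having no rainbow triangle: the long edge of a triangle is never alone in
  its colour. Only the values \<open>c x y\<close> with \<open>x < y\<close> are constrained;
  \<open>col\<close> is the symmetric extension.\<close>

definition interval_colouring :: "nat \<Rightarrow> (nat \<Rightarrow> nat \<Rightarrow> 'c) \<Rightarrow> bool" where
  "interval_colouring k c \<longleftrightarrow>
     (\<forall>x y w. 1 \<le> x \<longrightarrow> x < y \<longrightarrow> y < w \<longrightarrow> w \<le> k \<longrightarrow> c x w = c x y \<or> c x w = c y w)"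

definition col :: "(nat \<Rightarrow> nat \<Rightarrow> 'c) \<Rightarrow> nat \<Rightarrow> nat \<Rightarrow> 'c" where
  "col c x y = c (min x y) (max x y)"

lemma col_commute: "col c x y = col c y x"
  unfolding col_def by (simp add: min.commute max.commute)

lemma col_less: "x < y \<Longrightarrow> col c x y = c x y"
  unfolding col_def by simp

lemma interval_colouringD:
  "interval_colouring k c \<Longrightarrow> 1 \<le> x \<Longrightarrow> x < y \<Longrightarrow> y < w \<Longrightarrow> w \<le> k \<Longrightarrow>
     col c x w = col c x y \<or> col c x w = col c y w"
  unfolding interval_colouring_def by (simp add: col_less)

lemma interval_colouring_mono: "interval_colouring k c \<Longrightarrow> l \<le> k \<Longrightarrow> interval_colouring l c"
  unfolding interval_colouring_def by (meson le_trans)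

text \<open>Whichever vertex lies in the middle, the long edge shares its colour with a short one,
  so three distinct colours cannot occur in a triangle.\<close>

lemma no_rainbow:
  assumes "interval_colouring k c" "x \<in> {1..k}" "y \<in> {1..k}" "v \<in> {1..k}" "x \<noteq> y" "v \<noteq> x" "v \<noteq> y"
    and "col c x y = a" "col c v x \<noteq> a" "col c v y \<noteq> a"
  shows "col c v x = col c v y"
proof -
  have D: "col c p q = col c p r \<or> col c r q = col c p q"
    if "p \<in> {1..k}" "q \<in> {1..k}" "r \<in> {1..k}" "p < r" "r < q" for p q r
    using interval_colouringD[OF assms(1), of p r q] that by auto
  consider "x < y" "y < v" | "x < v" "v < y" | "v < x" "x < y" | "y < x" "x < v" | "y < v" "v < x" | "v < y" "y < x"
    using assms(5-7) by linarith
  then show ?thesis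
    using D assms(2-4,8-10) col_commute[of c x y] col_commute[of c v x] col_commute[of c v y]
    by cases metis+
qed

section \<open>Connected components of a colour\<close>

definition colour_edges :: "nat \<Rightarrow> (nat \<Rightarrow> nat \<Rightarrow> 'c) \<Rightarrow> 'c \<Rightarrow> (nat \<times> nat) set" where
  "colour_edges k c a = {(x, y). x \<in> {1..k} \<and> y \<in> {1..k} \<and> x \<noteq> y \<and> col c x y = a}"

definition colour_component :: "nat \<Rightarrow> (nat \<Rightarrow> nat \<Rightarrow> 'c) \<Rightarrow> 'c \<Rightarrow> nat \<Rightarrow> nat set" where
  "colour_component k c a x = (colour_edges k c a)\<^sup>* `` {x}"

text \<open>Components partition the vertices, so testing the component of vertex 1 is
  enough.\<close>

definition spanning :: "nat \<Rightarrow> (nat \<Rightarrow> nat \<Rightarrow> 'c) \<Rightarrow> 'c \<Rightarrow> bool" where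
  "spanning k c a \<longleftrightarrow> colour_component k c a 1 = {1..k}"

lemma colour_component_self: "x \<in> colour_component k c a x"
  unfolding colour_component_def by simp

lemma colour_component_step: "y \<in> colour_component k c a x \<Longrightarrow> (y, w) \<in> colour_edges k c a \<Longrightarrow> w \<in> colour_component k c a x"
  unfolding colour_component_def by auto

lemma colour_component_induct [consumes 1, case_names self step]:
  assumes "y \<in> colour_component k c a x" "P x"
    and "\<And>y w. y \<in> colour_component k c a x \<Longrightarrow> (y, w) \<in> colour_edges k c a \<Longrightarrow> w \<in> colour_component k c a x \<Longrightarrow> P y \<Longrightarrow> P w"
  shows "P y"
proof -
  have "(x, y) \<in> (colour_edges k c a)\<^sup>*" using assms(1) unfolding colour_component_def by simp
  then show ?thesis
    by (induction rule: rtrancl_induct) (use assms(2,3) in \<open>auto simp: colour_component_def intro: rtrancl_into_rtrancl\<close>)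
qed

lemma colour_component_subset: "x \<in> {1..k} \<Longrightarrow> colour_component k c a x \<subseteq> {1..k}"
proof
  fix y assume "x \<in> {1..k}" "y \<in> colour_component k c a x"
  from this(2,1) show "y \<in> {1..k}" by (induction rule: colour_component_induct) (auto simp: colour_edges_def)
qed

lemma colour_edges_sym: "(x, y) \<in> colour_edges k c a \<Longrightarrow> (y, x) \<in> colour_edges k c a"
  unfolding colour_edges_def using col_commute by auto

lemma colour_component_sym: "y \<in> colour_component k c a x \<Longrightarrow> x \<in> colour_component k c a y"
proof -
  have "sym ((colour_edges k c a)\<^sup>*)" by (rule sym_rtrancl) (auto simp: sym_def intro: colour_edges_sym)
  then show "y \<in> colour_component k c a x \<Longrightarrow> x \<in> colour_component k c a y" unfolding colour_component_def by (auto dest: symD)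
qed

lemma colour_component_eq: "y \<in> colour_component k c a x \<Longrightarrow> colour_component k c a y = colour_component k c a x"
proof -
  have tr: "colour_component k c a y \<subseteq> colour_component k c a x" if "y \<in> colour_component k c a x" for x y
    using that unfolding colour_component_def by auto
  show "y \<in> colour_component k c a x \<Longrightarrow> colour_component k c a y = colour_component k c a x"
    using tr colour_component_sym by (metis subset_antisym)
qed

text \<open>An outside vertex \<open>v\<close> sees both ends of an edge of colour \<open>a\<close>
  in colours other than \<open>a\<close>, which are equal because the triangle is not rainbow.
  Induction along a path spreads this over the component.\<close>

lemma colour_component_module:
  assumes c: "interval_colouring k c" and x: "x \<in> {1..k}" and v: "v \<in> {1..k}" "v \<notin> colour_component k c a x"
    and y: "y \<in> colour_component k c a x"
  shows "col c v y = col c v x"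
  using y
proof (induction rule: colour_component_induct)
  case (step y w)
  have yw: "y \<in> {1..k}" "w \<in> {1..k}" "y \<noteq> w" "col c y w = a" using step(2) by (auto simp: colour_edges_def)
  have "col c v u \<noteq> a" if "u \<in> colour_component k c a x" for u
  proof
    assume "col c v u = a"
    then have "(u, v) \<in> colour_edges k c a"
      using that v subsetD[OF colour_component_subset[OF x] that] col_commute[of c u v] by (auto simp: colour_edges_def)
    then show False using colour_component_step[OF that] v(2) by blast
  qed
  moreover have "v \<noteq> y" "v \<noteq> w" using step v by auto
  ultimately have "col c v y = col c v w" using no_rainbow[OF c yw(1,2) v(1) yw(3)] yw(4) step by metis
  then show ?case using step by simp
qed simp

text \<open>A path of colour \<open>a\<close> from below \<open>v\<close> to above it has an edge
  passing over \<open>v\<close>. The interval condition gives one of the two edges from its ends to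
  \<open>v\<close> the colour \<open>a\<close>, so \<open>v\<close> belongs to the component after
  all.\<close>

lemma colour_component_interval:
  assumes c: "interval_colouring k c" and x: "x \<in> {1..k}" and u: "u \<in> colour_component k c a x" and w: "w \<in> colour_component k c a x"
    and v: "u < v" "v < w"
  shows "v \<in> colour_component k c a x"
proof (rule ccontr)
  assume n: "v \<notin> colour_component k c a x"
  have in_k: "u \<in> {1..k}" "w \<in> {1..k}" using subsetD[OF colour_component_subset[OF x] u] subsetD[OF colour_component_subset[OF x] w] .
  then have vk: "v \<in> {1..k}" using v by auto
  have eq: "colour_component k c a u = colour_component k c a x" using colour_component_eq[OF u] .
  have n': "v \<notin> colour_component k c a u" using n eq by simp
  have "w \<in> colour_component k c a u" using w eq by simp
  then have "w < v"
  proof (induction rule: colour_component_induct)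
    case (step y y')
    have yy: "y \<in> {1..k}" "y' \<in> {1..k}" "y \<noteq> y'" "col c y y' = a" using step(2) by (auto simp: colour_edges_def)
    show ?case
    proof (rule ccontr)
      assume "\<not> y' < v"
      then have "v < y'" using step(3) n' by (cases "v = y'") auto
      then consider "col c y y' = col c y v" | "col c y y' = col c v y'"
        using interval_colouringD[OF c, of y v y'] yy step(4) by auto
      then show False
      proof cases
        case 1
        then have "(y, v) \<in> colour_edges k c a" using yy vk step(4) unfolding colour_edges_def by simp
        then show False using colour_component_step[OF step(1)] n' by blast
      next
        case 2
        then have "col c y' v = a" using yy(4) col_commute[of c v y'] by simp
        then have "(y', v) \<in> colour_edges k c a" using yy vk \<open>v < y'\<close> unfolding colour_edges_def by simp
        then show False using colour_component_step[OF step(3)] n' by blast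
      qed
    qed
  qed (rule v(1))
  then show False using v by simp
qed

lemma colour_component_leave:
  assumes "y \<in> colour_component k c a x" "x \<in> B" "y \<notin> B"
  obtains u w where "u \<in> B" "w \<notin> B" "(u, w) \<in> colour_edges k c a"
proof -
  have "(\<exists>u w. u \<in> B \<and> w \<notin> B \<and> (u, w) \<in> colour_edges k c a) \<or> y \<in> B"
    using assms(1) by (induction rule: colour_component_induct) (use assms(2) in blast)+
  then show ?thesis using assms(3) that by blast
qed

lemma spanning_last:
  assumes "spanning (Suc k) c a" "1 \<le> k"
  obtains x where "x \<in> {1..k}" "col c x (Suc k) = a"
proof -
  have "Suc k \<in> colour_component (Suc k) c a 1" using assms unfolding spanning_def by simp
  then obtain u w where "u \<in> {1..k}" "w \<notin> {1..k}" "(u, w) \<in> colour_edges (Suc k) c a"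
    by (rule colour_component_leave[where B = "{1..k}"]) (use assms in auto)
  then have "u \<in> {1..k}" "col c u (Suc k) = a" unfolding colour_edges_def by (auto simp: le_Suc_eq)
  then show ?thesis by (rule that)
qed

text \<open>Gallai: an edge colouring of a complete graph without rainbow triangles has at most two
  connected spanning colours. Remove the last vertex and suppose that colour \<open>d\<close> falls apart; then all
  vertices outside the first component \<open>B\<close> are joined to the last vertex by \<open>d\<close>, while the two other
  colours lead from the last vertex into \<open>B\<close>, which the vertices outside \<open>B\<close> cannot distinguish.\<close>

lemma spanning_restrict:
  assumes c: "interval_colouring (Suc k) c" and k: "1 \<le> k" and ne: "a \<noteq> b" "a \<noteq> d" "b \<noteq> d"
    and sp: "spanning (Suc k) c a" "spanning (Suc k) c b" "spanning (Suc k) c d"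
  shows "spanning k c d"
proof (rule ccontr)
  assume n: "\<not> spanning k c d"
  let ?B = "colour_component k c d 1" and ?v = "Suc k"
  have ck: "interval_colouring k c" using interval_colouring_mono[OF c] by simp
  have one: "1 \<in> {1..k}" using k by simp
  have Bk: "?B \<subseteq> {1..k}" using colour_component_subset[OF one] .
  obtain y where y: "y \<in> {1..k}" "y \<notin> ?B" using n Bk unfolding spanning_def by blast
  \<comment> \<open>The component \<open>?B\<close> is an interval containing 1, hence an initial
    segment.\<close>
  have less: "x < y'" if "x \<in> ?B" "y' \<in> {1..k}" "y' \<notin> ?B" for x y'
  proof (rule ccontr)
    assume "\<not> x < y'"
    then have "1 < y'" "y' < x" using that colour_component_self[of 1 k c d] by (metis atLeastAtMost_iff le_neq_implies_less, metis linorder_neqE_nat)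
    then show False using colour_component_interval[OF ck one colour_component_self that(1)] that(3) by blast
  qed
  have "?v \<in> colour_component ?v c d 1" using sp(3) unfolding spanning_def by simp
  then obtain u w where u: "u \<in> ?B" "w \<notin> ?B" "(u, w) \<in> colour_edges ?v c d"
    by (rule colour_component_leave[where B = ?B]) (use colour_component_self Bk in auto)
  have "w = ?v"
  proof (rule ccontr)
    assume "w \<noteq> ?v"
    then have "(u, w) \<in> colour_edges k c d" using u Bk unfolding colour_edges_def by auto
    then show False using colour_component_step[OF u(1)] u(2) by blast
  qed
  then have ud: "col c u ?v = d" using u(3) unfolding colour_edges_def by simp
  have out: "col c y' ?v = d" if y': "y' \<in> {1..k}" "y' \<notin> ?B" for y'
  proof -
    have "u \<in> {1..k}" using u Bk by blast
    moreover have "col c u y' \<noteq> d"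
    proof
      assume "col c u y' = d"
      then have "(u, y') \<in> colour_edges k c d" using y' u \<open>u \<in> {1..k}\<close> unfolding colour_edges_def by auto
      then show False using colour_component_step[OF u(1)] y'(2) by blast
    qed
    moreover have "col c u ?v = col c u y' \<or> col c u ?v = col c y' ?v"
      using interval_colouringD[OF c, of u y' ?v] \<open>u \<in> {1..k}\<close> less[OF u(1) y'] y' by simp
    ultimately show ?thesis using ud by metis
  qed
  have see: "\<exists>x\<in>?B. col c x y = e" if sp: "spanning ?v c e" and e: "e \<noteq> d" for e
  proof -
    obtain x where x: "x \<in> {1..k}" "col c x ?v = e" using spanning_last[OF sp k] .
    then have "x \<in> ?B" using out e by blast
    moreover have "col c x ?v = col c x y \<or> col c x ?v = col c y ?v"
      using interval_colouringD[OF c, of x y ?v] x less[OF \<open>x \<in> ?B\<close> y] y by simp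
    ultimately show ?thesis using x e out[OF y] by metis
  qed
  obtain x x' where "x \<in> ?B" "col c x y = a" "x' \<in> ?B" "col c x' y = b"
    using see sp(1,2) ne(2,3) by meson
  then show False
    using colour_component_module[OF ck one y, of x] colour_component_module[OF ck one y, of x'] col_commute[of c y] ne(1) by metis
qed

text \<open>Vertices are removed one at a time, each colour in turn taking the part of
  \<open>d\<close> in \<open>spanning_restrict\<close>. Two vertices have only one edge, too few for
  three colours.\<close>

lemma not_three_spanning:
  assumes "2 \<le> k" "interval_colouring k c" "a \<noteq> b" "a \<noteq> d" "b \<noteq> d"
    "spanning k c a" "spanning k c b" "spanning k c d"
  shows False
  using assms
proof (induction k rule: nat_induct_at_least)
  case base
  have two: "(2::nat) = Suc 1" by simp
  have "col c 1 (Suc 1) = e" if "spanning 2 c e" for e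
    using spanning_last[of 1 c e] that unfolding two by auto
  then show ?case using base by metis
next
  case (Suc k)
  have c: "interval_colouring k c" using interval_colouring_mono[OF Suc.prems(1)] by simp
  note s = Suc.prems
  have "spanning k c a" "spanning k c b" "spanning k c d"
    using spanning_restrict[OF s(1) _ s(4) s(2)[symmetric] s(3)[symmetric] s(6,7,5)]
      spanning_restrict[OF s(1) _ s(3) s(2) s(4)[symmetric] s(5,7,6)]
      spanning_restrict[OF s(1) _ s(2,3,4) s(5,6,7)] Suc.hyps
    by (metis s(1-7) spanning_restrict Suc_1 Suc_leD)+
  then show ?case using Suc.IH[OF c s(2,3,4)] by blast
qed

text \<open>Since outside vertices see the component \<open>?C\<close> uniformly, the set of
  intervals met by \<open>?C\<close> is a module of the graph \<open>Q\<close>, which records where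
  colour \<open>e\<close> occurs. Primality makes it everything.\<close>

lemma spanning_of_cross:
  assumes comp: "composition k s z" and s: "4 \<le> s" and c: "interval_colouring k c"
    and prime: "prime_graph s Q"
    and cross: "\<And>x y. x \<in> {1..k} \<Longrightarrow> y \<in> {1..k} \<Longrightarrow> blk z s x < blk z s y \<Longrightarrow>
        c x y = e \<longleftrightarrow> Q (blk z s x) (blk z s y)"
    and xy: "x \<in> {1..k}" "y \<in> {1..k}" "blk z s x \<noteq> blk z s y" "col c x y = a"
  shows "spanning k c a"
proof -
  let ?g = "blk z s" and ?C = "colour_component k c a x"
  have sym_cross: "col c v y = e \<longleftrightarrow> Q (min (?g v) (?g y)) (max (?g v) (?g y))"
    if "v \<in> {1..k}" "y \<in> {1..k}" "?g v \<noteq> ?g y" for v y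
    using cross[OF that(1,2)] cross[OF that(2,1)] blk_less[OF comp that(1,2)] blk_less[OF comp that(2,1)] that(3)
    by (cases "?g v < ?g y") (auto simp: col_def min_def max_def)
  have Ck: "?C \<subseteq> {1..k}" using colour_component_subset[OF xy(1)] .
  have unif: "Q (min (?g v) (?g y)) (max (?g v) (?g y)) \<longleftrightarrow> Q (min (?g v) (?g w)) (max (?g v) (?g w))"
    if v: "v \<in> {1..k}" "v \<notin> ?C" and yw: "y \<in> ?C" "w \<in> ?C" "?g y \<noteq> ?g v" "?g w \<noteq> ?g v" for v y w
    using colour_component_module[OF c xy(1) v yw(1)] colour_component_module[OF c xy(1) v yw(2)]
      sym_cross[OF v(1), of y] sym_cross[OF v(1), of w] yw Ck by (metis subsetD)
  have conv: "v \<in> ?C" if "u \<in> ?C" "w \<in> ?C" "v \<in> {1..k}" "?g u < ?g v" "?g v < ?g w" for u v w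
    using colour_component_interval[OF c xy(1) that(1,2)] blk_less[OF comp _ that(3,4)] blk_less[OF comp that(3) _ that(5)]
      that Ck by blast
  have "y \<in> ?C" using colour_component_step[OF colour_component_self, of x y k c a] xy unfolding colour_edges_def by blast
  have fin: "finite (?g ` ?C)" "?g ` ?C \<noteq> {}" using finite_subset[OF Ck] colour_component_self[of x k c a] by auto
  define i where "i = Min (?g ` ?C)"
  define j where "j = Max (?g ` ?C)"
  have "i \<in> ?g ` ?C" "j \<in> ?g ` ?C" unfolding i_def j_def by (rule Min_in[OF fin] Max_in[OF fin])+
  then obtain ui uj where ui: "ui \<in> ?C" "?g ui = i" and uj: "uj \<in> ?C" "?g uj = j" by blast
  have le: "i \<le> ?g v" "?g v \<le> j" if "v \<in> ?C" for v using that fin unfolding i_def j_def by auto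
  \<comment> \<open>The given edge of colour \<open>a\<close> joins two different intervals.\<close>
  have "i < j" using le[OF \<open>y \<in> ?C\<close>] le[OF colour_component_self[of x k c a]] xy(3) by linarith
  have ij: "i \<in> {1..s}" "j \<in> {1..s}" using blk_in(1)[OF comp] ui uj Ck by blast+
  have rep: "\<exists>v\<in>?C. ?g v = t" if t: "t \<in> {i..j}" for t
  proof (cases "t = i \<or> t = j")
    case False
    obtain v where v: "v \<in> {1..k}" "?g v = t" using blk_rep[OF comp, of t] t ij by auto
    then show ?thesis using conv[OF ui(1) uj(1) v(1)] ui uj False t by auto
  qed (use ui uj in blast)
  have out: "v \<notin> ?C" if "?g v \<notin> {i..j}" for v using le[of v] that by auto
  \<comment> \<open>An interval outside \<open>{i..j}\<close> contains no vertex of the component,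
    so any of its vertices sees all intervals \<open>i..j\<close> alike, whereas a prime graph would
    separate two of them.\<close>
  have full: "(i, j) = (1, s)"
  proof (rule ccontr)
    assume ne: "(i, j) \<noteq> (1, s)"
    obtain t u w where t: "t \<in> {1..s} - {i..j}" "u \<in> {i..j}" "w \<in> {i..j}"
      "Q (min t u) (max t u)" "\<not> Q (min t w) (max t w)"
      by (rule prime_graphE[OF prime _ \<open>i < j\<close> _ ne]) (use ij in auto)
    obtain v where v: "v \<in> {1..k}" "?g v = t" using blk_rep[OF comp, of t] t by auto
    obtain y w' where "y \<in> ?C" "?g y = u" "w' \<in> ?C" "?g w' = w" using rep t by meson
    then show False using unif[OF v(1) out, of y w'] v t by auto
  qed
  \<comment> \<open>As the component is an interval of vertices reaching from interval 1 to interval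
    \<open>s\<close>, only vertices in these two could be missing. A missing one would see all other
    intervals alike, against primality for \<open>{2..s}\<close> or
    \<open>{1..s - 1}\<close>.\<close>
  have "v \<in> ?C" if v: "v \<in> {1..k}" for v
  proof (rule ccontr)
    assume n: "v \<notin> ?C"
    have uij: "?g ui = 1" "?g uj = s" using ui uj full by auto
    have "?g v = 1 \<or> ?g v = s"
      using conv[OF ui(1) uj(1) v] n uij blk_in(1)[OF comp v] by force
    then show False
    proof
      assume 1: "?g v = 1"
      obtain t u w where t: "t \<in> {1..s} - {2..s}" "u \<in> {2..s}" "w \<in> {2..s}"
        "Q (min t u) (max t u)" "\<not> Q (min t w) (max t w)"
        by (rule prime_graphE[OF prime, of 2 s]) (use s in auto)
      obtain y w' where "y \<in> ?C" "?g y = u" "w' \<in> ?C" "?g w' = w" using rep[of u] rep[of w] t full by auto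
      moreover have "t = 1" using t by auto
      ultimately show False using unif[OF v n, of y w'] 1 t by auto
    next
      assume 1: "?g v = s"
      obtain t u w where t: "t \<in> {1..s} - {1..s - 1}" "u \<in> {1..s - 1}" "w \<in> {1..s - 1}"
        "Q (min t u) (max t u)" "\<not> Q (min t w) (max t w)"
        by (rule prime_graphE[OF prime, of 1 "s - 1"]) (use s in auto)
      obtain y w' where "y \<in> ?C" "?g y = u" "w' \<in> ?C" "?g w' = w" using rep[of u] rep[of w] t full by auto
      moreover have "t = s" using t by auto
      ultimately show False using unif[OF v n, of y w'] 1 t by auto
    qed
  qed
  then have "?C = {1..k}" using Ck by blast
  moreover have "1 \<in> {1..k}" using xy(1) by simp
  ultimately show ?thesis unfolding spanning_def using colour_component_eq[of 1 k c a x] by blast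
qed

text \<open>Every colour between intervals is spanning, and \<open>e\<close> is one of them. Two
  further colours there would make three spanning colours.\<close>

lemma cross_colour_unique:
  assumes comp: "composition k s z" and s: "4 \<le> s" and c: "interval_colouring k c"
    and prime: "prime_graph s Q"
    and cross: "\<And>x y. x \<in> {1..k} \<Longrightarrow> y \<in> {1..k} \<Longrightarrow> blk z s x < blk z s y \<Longrightarrow>
        c x y = e \<longleftrightarrow> Q (blk z s x) (blk z s y)"
    and xy: "x \<in> {1..k}" "y \<in> {1..k}" "blk z s x < blk z s y" "c x y \<noteq> e"
    and xy': "x' \<in> {1..k}" "y' \<in> {1..k}" "blk z s x' < blk z s y'" "c x' y' \<noteq> e"
  shows "c x y = c x' y'"
proof (rule ccontr)
  assume ne: "c x y \<noteq> c x' y'"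
  \<comment> \<open>Primality at \<open>{1, 2}\<close> supplies an edge of \<open>Q\<close>, and so
    a pair between intervals whose colour is \<open>e\<close>.\<close>
  obtain t u w where t: "t \<in> {1..s} - {1..2}" "u \<in> {1..2}" "w \<in> {1..2::nat}" "Q (min t u) (max t u)"
    by (rule prime_graphE[OF prime, of 1 2]) (use s in auto)
  then have Q: "Q u t" "u < t" "u \<in> {1..s}" "t \<in> {1..s}" using s by auto
  obtain v where v: "v \<in> {1..k}" "blk z s v = u" using blk_rep[OF comp Q(3)] .
  obtain v' where v': "v' \<in> {1..k}" "blk z s v' = t" using blk_rep[OF comp Q(4)] .
  have e: "c v v' = e" using cross[OF v(1) v'(1)] v v' Q by simp
  have sp: "spanning k c (c x y)" if "x \<in> {1..k}" "y \<in> {1..k}" "blk z s x < blk z s y" for x y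
    by (rule spanning_of_cross[OF comp s c prime cross that(1,2)])
      (use that blk_less[OF comp that] col_less[of x y c] in auto)
  have "2 \<le> k" using blk_less[OF comp xy(1-3)] xy by auto
  then show False
    using not_three_spanning[OF _ c, of "c x y" "c x' y'" e] ne xy(4) xy'(4) sp[OF xy(1-3)] sp[OF xy'(1-3)]
      sp[OF v(1) v'(1)] v v' Q e by auto
qed

section \<open>Reducibility\<close>

text \<open>The union has at least one member by \<open>1 \<le> r\<close>; inside an empty inversion
  set that member is empty too and hence equal to it, which is forbidden.\<close>

lemma reducible_nonempty: "reducible G \<Phi> \<alpha> \<Longrightarrow> \<Phi> \<alpha> \<noteq> {}"
proof
  assume "reducible G \<Phi> \<alpha>" "\<Phi> \<alpha> = {}"
  then obtain r \<gamma> where "1 \<le> r" "\<forall>a\<in>{1..r}. \<gamma> a \<in> G \<and> \<Phi> (\<gamma> a) \<noteq> \<Phi> \<alpha>"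
    "disj_union (\<Phi> \<alpha>) r (\<lambda>a. \<Phi> (\<gamma> a))"
    unfolding reducible_def by blast
  moreover from this have "1 \<in> {1..r}" by simp
  ultimately show False using \<open>\<Phi> \<alpha> = {}\<close> unfolding disj_union_def by blast
qed

text \<open>Reducibility depends on an element only through its inversion set, so the existential
  witness can be taken to be the given \<open>\<alpha> a\<close>.\<close>

lemma irreducible_decomp_iff:
  assumes "\<And>a. a \<in> {1..r} \<Longrightarrow> \<alpha> a \<in> G"
  shows "irreducible_decomp G \<Phi> r (\<lambda>a. \<Phi> (\<alpha> a)) \<longleftrightarrow> (\<forall>a\<in>{1..r}. \<not> reducible G \<Phi> (\<alpha> a))"
proof -
  have "reducible G \<Phi> \<gamma> \<longleftrightarrow> reducible G \<Phi> \<delta>" if "\<Phi> \<gamma> = \<Phi> \<delta>" for \<gamma> \<delta>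
    unfolding reducible_def that ..
  then show ?thesis unfolding irreducible_decomp_def using assms by metis
qed

lemma irreducible_member:
  assumes "\<not> reducible G \<Phi> \<alpha>" "1 \<le> r" "\<And>a. a \<in> {1..r} \<Longrightarrow> \<gamma> a \<in> G"
    and "disj_union (\<Phi> \<alpha>) r (\<lambda>a. \<Phi> (\<gamma> a))"
  obtains a where "a \<in> {1..r}" "\<Phi> (\<gamma> a) = \<Phi> \<alpha>"
proof -
  have "\<exists>a\<in>{1..r}. \<Phi> (\<gamma> a) = \<Phi> \<alpha>"
  proof (rule ccontr)
    assume "\<not> (\<exists>a\<in>{1..r}. \<Phi> (\<gamma> a) = \<Phi> \<alpha>)"
    then have "\<forall>a\<in>{1..r}. \<gamma> a \<in> G \<and> \<Phi> (\<gamma> a) \<noteq> \<Phi> \<alpha>" using assms(3) by blast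
    then show False using assms(1,2,4) unfolding reducible_def by blast
  qed
  then show ?thesis using that by blast
qed

section \<open>Passing decompositions through an inflation\<close>

lemma disj_union_mem_subset: "disj_union D r F \<Longrightarrow> a \<in> {1..r} \<Longrightarrow> F a \<subseteq> D"
  unfolding disj_union_def by blast

lemma disj_union_empty: "(\<And>a. a \<in> {1..r} \<Longrightarrow> F a = {}) \<Longrightarrow> disj_union {} r F"
  unfolding disj_union_def disjoint_family_on_def by auto

lemma disj_union_two: "disj_union D 2 F \<longleftrightarrow> D = F 1 \<union> F 2 \<and> F 1 \<inter> F 2 = {}"
proof -
  have "{1..2} = {1, 2::nat}" by auto
  then show ?thesis unfolding disj_union_def disjoint_family_on_def by auto
qed

lemma inflationBC_unique':
  assumes "inflationBC X n \<alpha> m z p \<sigma> \<beta> \<gamma>" "inflationBC X n \<alpha>' m z p \<sigma> \<beta>' \<gamma>"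
    and "\<And>b. b \<in> {1..m} \<Longrightarrow> \<beta> b = \<beta>' b"
  shows "\<alpha> = \<alpha>'"
proof -
  have "restrict \<beta> {1..m} = restrict \<beta>' {1..m}" using assms(3) by (auto simp: restrict_def)
  then show ?thesis
    using inflationBC_unique inflationBC_restrict[OF assms(1)] inflationBC_restrict[OF assms(2)] by metis
qed

text \<open>Simultaneous decompositions of all components combine to one of \<open>\<alpha>\<close>.
  By uniqueness of the components it suffices that each member differs from \<open>\<alpha>\<close>
  in one of them; the others may agree.\<close>

lemma reducible_lift:
  assumes infl: "inflationBC X n \<alpha> m z p \<sigma> \<beta> \<gamma>" and r: "1 \<le> r"
    and s: "\<And>a. a \<in> {1..r} \<Longrightarrow> \<sigma>' a \<in> weyl m"
    and b: "\<And>a b. a \<in> {1..r} \<Longrightarrow> b \<in> {1..m} \<Longrightarrow> \<beta>' a b \<in> symgrp (z b)"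
    and g: "\<And>a. a \<in> {1..r} \<Longrightarrow> \<gamma>' a \<in> weyl p"
    and ne: "\<And>a. a \<in> {1..r} \<Longrightarrow> \<sigma>' a \<noteq> \<sigma> \<or> (\<exists>b\<in>{1..m}. \<beta>' a b \<noteq> \<beta> b) \<or> \<gamma>' a \<noteq> \<gamma>"
    and ds: "disj_union (invBC (outer X p) m \<sigma>) r (\<lambda>a. invBC (outer X p) m (\<sigma>' a))"
    and db: "\<And>b. b \<in> {1..m} \<Longrightarrow> disj_union (invA (z b) (\<beta> b)) r (\<lambda>a. invA (z b) (\<beta>' a b))"
    and dg: "disj_union (invBC X p \<gamma>) r (\<lambda>a. invBC X p (\<gamma>' a))"
  shows "reducible (weyl n) (invBC X n) \<alpha>"
proof -
  have "\<exists>w. inflationBC X n w m z p (\<sigma>' a) (\<beta>' a) (\<gamma>' a)" if a: "a \<in> {1..r}" for a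
    using inflationBC_exists[OF inflationBC_lengths[OF infl], of "\<beta>' a" "\<gamma>' a" "\<sigma>' a" X] s[OF a] b[OF a] g[OF a]
    by metis
  then obtain \<alpha>' where a': "\<And>a. a \<in> {1..r} \<Longrightarrow> inflationBC X n (\<alpha>' a) m z p (\<sigma>' a) (\<beta>' a) (\<gamma>' a)"
    by metis
  have w: "\<alpha>' a \<in> weyl n" if "a \<in> {1..r}" for a using a'[OF that] unfolding inflationBC_def by blast
  have wa: "\<alpha> \<in> weyl n" using infl unfolding inflationBC_def by blast
  have "invBC X n (\<alpha>' a) \<noteq> invBC X n \<alpha>" if a: "a \<in> {1..r}" for a
  proof
    assume "invBC X n (\<alpha>' a) = invBC X n \<alpha>"
    then have "\<alpha>' a = \<alpha>" using invBC_inject[OF w[OF a] wa] by blast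
    then have i: "inflationBC X n \<alpha> m z p (\<sigma>' a) (\<beta>' a) (\<gamma>' a)" using a'[OF a] by simp
    show False using inflationBC_data_unique[OF i infl] ne[OF a] by blast
  qed
  moreover have "disj_union (invBC X n \<alpha>) r (\<lambda>a. invBC X n (\<alpha>' a))"
    using inflationBC_disj_union[OF infl, of r \<alpha>' \<sigma>' \<beta>' \<gamma>'] a' ds db dg by blast
  ultimately show ?thesis unfolding reducible_def using r w by blast
qed

text \<open>Otherwise \<open>\<alpha>\<close> splits into its outer part with trivial components
  inside and its inner part with trivial outer element.\<close>

lemma irreducible_outer:
  assumes infl: "inflationBC X n \<alpha> m z p \<sigma> \<beta> \<gamma>" and irr: "\<not> reducible (weyl n) (invBC X n) \<alpha>"
    and s: "\<sigma> \<noteq> id"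
  shows "b \<in> {1..m} \<Longrightarrow> \<beta> b = id" and "\<gamma> = id"
proof -
  have h: "\<sigma> \<in> weyl m" "\<gamma> \<in> weyl p" "\<And>b. b \<in> {1..m} \<Longrightarrow> \<beta> b \<in> symgrp (z b)"
    using infl unfolding inflationBC_def by blast+
  have "\<not> ((\<exists>b\<in>{1..m}. \<beta> b \<noteq> id) \<or> \<gamma> \<noteq> id)"
  proof
    assume ne: "(\<exists>b\<in>{1..m}. \<beta> b \<noteq> id) \<or> \<gamma> \<noteq> id"
    have "reducible (weyl n) (invBC X n) \<alpha>"
      by (rule reducible_lift[OF infl, of 2 "\<lambda>a. if a = 1 then \<sigma> else id"
            "\<lambda>a. if a = 1 then (\<lambda>b. id) else \<beta>" "\<lambda>a. if a = 1 then id else \<gamma>"])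
        (use h s ne in \<open>auto simp: disj_union_two id_weyl id_symgrp\<close>)
    then show False using irr by blast
  qed
  then show "b \<in> {1..m} \<Longrightarrow> \<beta> b = id" and "\<gamma> = id" by blast+
qed

text \<open>Otherwise the single component \<open>\<beta> b\<close> can be split off from everything
  else.\<close>

lemma irreducible_inner:
  assumes infl: "inflationBC X n \<alpha> m z p \<sigma> \<beta> \<gamma>" and irr: "\<not> reducible (weyl n) (invBC X n) \<alpha>"
    and b: "b \<in> {1..m}" "\<beta> b \<noteq> id"
  shows "\<sigma> = id" and "b' \<in> {1..m} \<Longrightarrow> b' \<noteq> b \<Longrightarrow> \<beta> b' = id" and "\<gamma> = id"
proof -
  have h: "\<sigma> \<in> weyl m" "\<gamma> \<in> weyl p" "\<And>b. b \<in> {1..m} \<Longrightarrow> \<beta> b \<in> symgrp (z b)"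
    using infl unfolding inflationBC_def by blast+
  have "\<not> (\<sigma> \<noteq> id \<or> (\<exists>b'\<in>{1..m}. b' \<noteq> b \<and> \<beta> b' \<noteq> id) \<or> \<gamma> \<noteq> id)"
  proof
    assume ne: "\<sigma> \<noteq> id \<or> (\<exists>b'\<in>{1..m}. b' \<noteq> b \<and> \<beta> b' \<noteq> id) \<or> \<gamma> \<noteq> id"
    have "reducible (weyl n) (invBC X n) \<alpha>"
    proof (rule reducible_lift[OF infl, of 2 "\<lambda>a. if a = 1 then id else \<sigma>"
          "\<lambda>a. if a = 1 then (\<lambda>b'. if b' = b then \<beta> b else id) else (\<lambda>b'. if b' = b then id else \<beta> b')"
          "\<lambda>a. if a = 1 then id else \<gamma>"])
      fix a :: nat assume "a \<in> {1..2}"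
      show "(if a = 1 then id else \<sigma>) \<noteq> \<sigma> \<or>
         (\<exists>b'\<in>{1..m}. (if a = 1 then \<lambda>b'. if b' = b then \<beta> b else id
            else (\<lambda>b'. if b' = b then id else \<beta> b')) b' \<noteq> \<beta> b') \<or> (if a = 1 then id else \<gamma>) \<noteq> \<gamma>"
      proof (cases "a = 1")
        case True
        then show ?thesis using ne by (simp; metis)
      next
        case False
        then show ?thesis using b by (simp; metis)
      qed
    qed (use h in \<open>auto simp: disj_union_two id_weyl id_symgrp\<close>)
    then show False using irr by blast
  qed
  then show "\<sigma> = id" and "b' \<in> {1..m} \<Longrightarrow> b' \<noteq> b \<Longrightarrow> \<beta> b' = id" and "\<gamma> = id" by blast+
qed

text \<open>Here and in the next two lemmas one component alone may be nontrivial; its decomposition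
  is lifted with identities in all other places.\<close>

lemma reducible_outer:
  assumes infl: "inflationBC X n \<alpha> m z p \<sigma> \<beta> \<gamma>" and i: "\<And>b. b \<in> {1..m} \<Longrightarrow> \<beta> b = id" "\<gamma> = id"
    and red: "reducible (weyl m) (invBC (outer X p) m) \<sigma>"
  shows "reducible (weyl n) (invBC X n) \<alpha>"
proof -
  obtain r \<sigma>' where r: "1 \<le> r" "\<And>a. a \<in> {1..r} \<Longrightarrow> \<sigma>' a \<in> weyl m"
    "\<And>a. a \<in> {1..r} \<Longrightarrow> invBC (outer X p) m (\<sigma>' a) \<noteq> invBC (outer X p) m \<sigma>"
    "disj_union (invBC (outer X p) m \<sigma>) r (\<lambda>a. invBC (outer X p) m (\<sigma>' a))"
    using red unfolding reducible_def by blast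
  show ?thesis
  proof (rule reducible_lift[OF infl r(1,2), where \<beta>' = "\<lambda>a b. id" and \<gamma>' = "\<lambda>a. id"])
    show "\<sigma>' a \<noteq> \<sigma> \<or> (\<exists>b\<in>{1..m}. id \<noteq> \<beta> b) \<or> id \<noteq> \<gamma>" if "a \<in> {1..r}" for a
      using r(3)[OF that] by metis
  qed (use i r(4) in \<open>auto simp: id_weyl id_symgrp disj_union_empty\<close>)
qed

lemma reducible_inner:
  assumes infl: "inflationBC X n \<alpha> m z p id \<beta> id" and b: "b \<in> {1..m}"
    and i: "\<And>b'. b' \<in> {1..m} \<Longrightarrow> b' \<noteq> b \<Longrightarrow> \<beta> b' = id"
    and red: "reducible (symgrp (z b)) (invA (z b)) (\<beta> b)"
  shows "reducible (weyl n) (invBC X n) \<alpha>"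
proof -
  obtain r \<delta> where r: "1 \<le> r" "\<And>a. a \<in> {1..r} \<Longrightarrow> \<delta> a \<in> symgrp (z b)"
    "\<And>a. a \<in> {1..r} \<Longrightarrow> invA (z b) (\<delta> a) \<noteq> invA (z b) (\<beta> b)"
    "disj_union (invA (z b) (\<beta> b)) r (\<lambda>a. invA (z b) (\<delta> a))"
    using red unfolding reducible_def by blast
  show ?thesis
  proof (rule reducible_lift[OF infl r(1), where \<sigma>' = "\<lambda>a. id" and \<gamma>' = "\<lambda>a. id"
        and \<beta>' = "\<lambda>a b'. if b' = b then \<delta> a else id"])
    show "id \<noteq> id \<or> (\<exists>b'\<in>{1..m}. (if b' = b then \<delta> a else id) \<noteq> \<beta> b') \<or> id \<noteq> id" if "a \<in> {1..r}" for a
      using r(3)[OF that] b by metis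
    show "disj_union (invA (z b') (\<beta> b')) r (\<lambda>a. invA (z b') (if b' = b then \<delta> a else id))"
      if "b' \<in> {1..m}" for b'
      using r(4) i[OF that] by (cases "b' = b") (simp_all add: disj_union_empty)
  qed (use r(2) in \<open>auto simp: id_weyl id_symgrp disj_union_empty\<close>)
qed

lemma reducible_middle:
  assumes infl: "inflationBC X n \<alpha> m z p id \<beta> \<gamma>" and i: "\<And>b. b \<in> {1..m} \<Longrightarrow> \<beta> b = id"
    and red: "reducible (weyl p) (invBC X p) \<gamma>"
  shows "reducible (weyl n) (invBC X n) \<alpha>"
proof -
  obtain r \<delta> where r: "1 \<le> r" "\<And>a. a \<in> {1..r} \<Longrightarrow> \<delta> a \<in> weyl p"
    "\<And>a. a \<in> {1..r} \<Longrightarrow> invBC X p (\<delta> a) \<noteq> invBC X p \<gamma>"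
    "disj_union (invBC X p \<gamma>) r (\<lambda>a. invBC X p (\<delta> a))"
    using red unfolding reducible_def by blast
  show ?thesis
  proof (rule reducible_lift[OF infl r(1), where \<sigma>' = "\<lambda>a. id" and \<gamma>' = \<delta> and \<beta>' = "\<lambda>a b. id"])
    show "id \<noteq> id \<or> (\<exists>b\<in>{1..m}. id \<noteq> \<beta> b) \<or> \<delta> a \<noteq> \<gamma>" if "a \<in> {1..r}" for a
      using r(3)[OF that] by metis
  qed (use i r in \<open>auto simp: id_weyl id_symgrp disj_union_empty\<close>)
qed

text \<open>In any decomposition of \<open>\<alpha>\<close> the members have trivial outer element
  and are trivial wherever \<open>\<alpha>\<close> is. Only one component remains, and its
  irreducibility makes some member equal to \<open>\<alpha>\<close>.\<close>

lemma irreducible_inflation_id: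
  assumes infl: "inflationBC X n \<alpha> m z p id \<beta> \<gamma>"
    and irr: "\<And>b. b \<in> {1..m} \<Longrightarrow> \<not> reducible (symgrp (z b)) (invA (z b)) (\<beta> b)"
      "\<not> reducible (weyl p) (invBC X p) \<gamma>"
    and one: "\<exists>!b. b \<in> {1..m + 1} \<and> (if b \<le> m then \<beta> b \<noteq> id else \<gamma> \<noteq> id)"
  shows "\<not> reducible (weyl n) (invBC X n) \<alpha>"
proof
  let ?N = "deg X n" and ?s = "deg (outer X p) m" and ?Z = "sym_lengths X m z p"
  assume "reducible (weyl n) (invBC X n) \<alpha>"
  then obtain r \<delta> where r: "1 \<le> r" and d: "\<And>a. a \<in> {1..r} \<Longrightarrow> \<delta> a \<in> weyl n"
    "\<And>a. a \<in> {1..r} \<Longrightarrow> invBC X n (\<delta> a) \<noteq> invBC X n \<alpha>"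
    and du: "disj_union (invBC X n \<alpha>) r (\<lambda>a. invBC X n (\<delta> a))"
    unfolding reducible_def by blast
  have a: "\<alpha> \<in> weyl n" and ia: "inflationA ?N (iota X n \<alpha>) ?s ?Z (iota (outer X p) m id) (sym_entries X m z p \<beta> \<gamma>)"
    using infl unfolding inflationBC_def by blast+
  have duA: "disj_union (invA ?N (iota X n \<alpha>)) r (\<lambda>a. invA ?N (iota X n (\<delta> a)))"
    using du disj_union_invBC_iff[OF a, of r \<delta> X] d(1) by blast
  have "\<exists>\<beta>' \<gamma>'. inflationBC X n (\<delta> a) m z p id \<beta>' \<gamma>'" if ar: "a \<in> {1..r}" for a
  proof -
    obtain \<beta>' \<gamma>' where "inflationBC X n (\<delta> a) m z p id \<beta>' \<gamma>'"
    proof (rule inflationBC_of_cross[OF inflationBC_lengths[OF infl] d(1)[OF ar] id_weyl, of X])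
      fix x y assume "(x, y) \<in> posA ?N" "blk ?Z ?s x \<noteq> blk ?Z ?s y"
      \<comment> \<open>The outer element is the identity, so \<open>\<alpha>\<close> has no
        inversions between intervals, and neither has any member of the decomposition.\<close>
      then have "(x, y) \<notin> invA ?N (iota X n \<alpha>)" using inflationA_cross_iff[OF ia] by simp
      then show "(x, y) \<in> invA ?N (iota X n (\<delta> a)) \<longleftrightarrow>
         (blk ?Z ?s x, blk ?Z ?s y) \<in> invA ?s (iota (outer X p) m id)"
        using disj_union_mem_subset[OF duA ar] by auto
    qed
    then show ?thesis by blast
  qed
  then obtain \<beta>' \<gamma>' where i': "\<And>a. a \<in> {1..r} \<Longrightarrow> inflationBC X n (\<delta> a) m z p id (\<beta>' a) (\<gamma>' a)" by metis
  have parts: "\<And>b. b \<in> {1..m} \<Longrightarrow> disj_union (invA (z b) (\<beta> b)) r (\<lambda>a. invA (z b) (\<beta>' a b))"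
    "disj_union (invBC X p \<gamma>) r (\<lambda>a. invBC X p (\<gamma>' a))"
    using inflationBC_disj_union[OF infl, of r \<delta> "\<lambda>a. id" \<beta>' \<gamma>'] i' du by blast+
  have in': "\<beta>' a b \<in> symgrp (z b)" "\<gamma>' a \<in> weyl p" if "a \<in> {1..r}" "b \<in> {1..m}" for a b
    using i'[OF that(1)] that unfolding inflationBC_def by blast+
  have in'': "\<gamma>' a \<in> weyl p" if "a \<in> {1..r}" for a using i'[OF that] unfolding inflationBC_def by blast
  have h: "\<gamma> \<in> weyl p" "\<And>b. b \<in> {1..m} \<Longrightarrow> \<beta> b \<in> symgrp (z b)"
    using infl unfolding inflationBC_def by blast+
  have zb: "\<beta>' a b = id" if "a \<in> {1..r}" "b \<in> {1..m}" "\<beta> b = id" for a b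
    using disj_union_mem_subset[OF parts(1)[OF that(2)] that(1)] that(3)
      invA_eq_empty_iff[OF in'(1)[OF that(1,2)]] by simp
  have zg: "\<gamma>' a = id" if "a \<in> {1..r}" "\<gamma> = id" for a
    using disj_union_mem_subset[OF parts(2) that(1)] that(2) invBC_eq_empty_iff[OF in''[OF that(1)]] by simp
  obtain b where b: "b \<in> {1..m + 1}" "if b \<le> m then \<beta> b \<noteq> id else \<gamma> \<noteq> id"
    and other: "\<And>c. c \<in> {1..m + 1} \<Longrightarrow> (if c \<le> m then \<beta> c \<noteq> id else \<gamma> \<noteq> id) \<Longrightarrow> c = b"
    using one by blast
  have "\<exists>a\<in>{1..r}. (\<forall>c\<in>{1..m}. \<beta>' a c = \<beta> c) \<and> \<gamma>' a = \<gamma>"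
  proof (cases "b \<le> m")
    case True
    then have bm: "b \<in> {1..m}" using b by simp
    have g: "\<gamma> = id" using other[of "m + 1"] True by auto
    have oth: "\<beta> c = id" if "c \<in> {1..m}" "c \<noteq> b" for c using other[of c] that by auto
    obtain a where a: "a \<in> {1..r}" "invA (z b) (\<beta>' a b) = invA (z b) (\<beta> b)"
      using irreducible_member[OF irr(1)[OF bm] r, of "\<lambda>a. \<beta>' a b"] in'(1)[OF _ bm] parts(1)[OF bm] by blast
    have "\<beta>' a b = \<beta> b" using invA_inject[OF in'(1)[OF a(1) bm] h(2)[OF bm] a(2)] .
    then have "\<beta>' a c = \<beta> c" if "c \<in> {1..m}" for c
      using zb[OF a(1) that] oth[OF that] by (cases "c = b") simp_all
    then show ?thesis using a(1) g zg[OF a(1) g] by blast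
  next
    case False
    have oth: "\<beta> c = id" if "c \<in> {1..m}" for c using other[of c] that False by auto
    obtain a where a: "a \<in> {1..r}" "invBC X p (\<gamma>' a) = invBC X p \<gamma>"
      using irreducible_member[OF irr(2) r, of \<gamma>'] in'' parts(2) by blast
    have "\<gamma>' a = \<gamma>" using invBC_inject[OF in''[OF a(1)] h(1) a(2)] .
    moreover have "\<beta>' a c = \<beta> c" if "c \<in> {1..m}" for c
      using zb[OF a(1) that oth[OF that]] oth[OF that] by simp
    ultimately show ?thesis using a(1) by blast
  qed
  then obtain a where a: "a \<in> {1..r}" "\<And>c. c \<in> {1..m} \<Longrightarrow> \<beta>' a c = \<beta> c" "\<gamma>' a = \<gamma>" by blast
  have "inflationBC X n (\<delta> a) m z p id (\<beta>' a) \<gamma>" using i'[OF a(1)] a(3) by simp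
  then have "\<delta> a = \<alpha>" using inflationBC_unique'[OF _ infl] a(2) by blast
  then show False using d(2)[OF a(1)] by simp
qed

text \<open>A pair gets the index of the set containing it, and 0 if it is no inversion of
  \<open>\<delta>\<close>. If the long edge has a nonzero colour, co-closedness of that member gives
  the triangle condition; if its colour is 0, closedness of \<open>invA k \<delta>\<close>
  does.\<close>

lemma colouring_of_disj_union:
  assumes du: "disj_union (invA k \<delta>) r (\<lambda>a. invA k (f a))"
  obtains c :: "nat \<Rightarrow> nat \<Rightarrow> nat" where "interval_colouring k c"
    "\<And>x y a. a \<in> {1..r} \<Longrightarrow> c x y = a \<longleftrightarrow> (x, y) \<in> invA k (f a)"
    "\<And>x y. c x y = 0 \<longleftrightarrow> (x, y) \<notin> invA k \<delta>" "\<And>x y. c x y \<le> r"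
proof -
  have D: "v \<in> invA k \<delta> \<longleftrightarrow> (\<exists>a\<in>{1..r}. v \<in> invA k (f a))"
    and uniq: "a \<in> {1..r} \<Longrightarrow> b \<in> {1..r} \<Longrightarrow> v \<in> invA k (f a) \<Longrightarrow> v \<in> invA k (f b) \<Longrightarrow> a = b" for v a b
    using du unfolding disj_union_iff_du du_def by blast+
  define c where "c x y = (if (x, y) \<in> invA k \<delta> then THE a. a \<in> {1..r} \<and> (x, y) \<in> invA k (f a) else 0)" for x y
  have c: "c x y \<in> {1..r}" "(x, y) \<in> invA k (f (c x y))" if xy: "(x, y) \<in> invA k \<delta>" for x y
  proof -
    obtain a where a: "a \<in> {1..r}" "(x, y) \<in> invA k (f a)" using D xy by blast
    have "(THE a. a \<in> {1..r} \<and> (x, y) \<in> invA k (f a)) = a"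
      by (rule the_equality) (use a uniq in blast)+
    then show "c x y \<in> {1..r}" "(x, y) \<in> invA k (f (c x y))" using a xy by (simp_all add: c_def)
  qed
  have 1: "c x y = a \<longleftrightarrow> (x, y) \<in> invA k (f a)" if a: "a \<in> {1..r}" for x y a
  proof
    assume "c x y = a"
    then have "(x, y) \<in> invA k \<delta>" using a by (auto simp: c_def split: if_splits)
    then show "(x, y) \<in> invA k (f a)" using c \<open>c x y = a\<close> by blast
  next
    assume xy: "(x, y) \<in> invA k (f a)"
    then have "(x, y) \<in> invA k \<delta>" using D a by blast
    then show "c x y = a" using uniq[OF c(1) a c(2) xy] by blast
  qed
  have 2: "c x y = 0 \<longleftrightarrow> (x, y) \<notin> invA k \<delta>" for x y
    using c(1)[of x y] by (auto simp: c_def)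
  have 3: "c x y \<le> r" for x y
    using c(1)[of x y] by (cases "(x, y) \<in> invA k \<delta>") (auto simp: c_def)
  have "interval_colouring k c"
    unfolding interval_colouring_def
  proof (intro allI impI)
    fix x y w assume xyw: "1 \<le> x" "x < y" "y < w" "w \<le> k"
    show "c x w = c x y \<or> c x w = c y w"
    proof (cases "(x, w) \<in> invA k \<delta>")
      case True
      then show ?thesis using invA_cotrans[OF c(2)[OF True] xyw(2,3)] 1[OF c(1)[OF True]] by metis
    next
      case False
      then have "(x, y) \<notin> invA k \<delta> \<or> (y, w) \<notin> invA k \<delta>" using invA_trans by blast
      then show ?thesis using False 2 by metis
    qed
  qed
  then show ?thesis using that 1 2 3 by blast
qed

lemma prime_graph_cong:
  assumes "\<And>i j. (i, j) \<in> posA s \<Longrightarrow> Q i j \<longleftrightarrow> Q' i j"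
  shows "prime_graph s Q \<longleftrightarrow> prime_graph s Q'"
proof -
  have imp: "prime_graph s Q'" if eq: "\<And>i j. (i, j) \<in> posA s \<Longrightarrow> Q i j \<longleftrightarrow> Q' i j" and prime: "prime_graph s Q"
    for Q Q'
    unfolding prime_graph_def
  proof (intro allI impI)
    fix i j assume ij: "1 \<le> i" "i < j" "j \<le> s" "(i, j) \<noteq> (1, s)"
    obtain t u w where t: "t \<in> {1..s} - {i..j}" "u \<in> {i..j}" "w \<in> {i..j}"
      "Q (min t u) (max t u)" "\<not> Q (min t w) (max t w)"
      by (rule prime_graphE[OF prime ij])
    have "(min t v, max t v) \<in> posA s" if "v \<in> {i..j}" for v
      using that t(1) ij by (auto simp: posA_def min_def max_def)
    then have "Q' (min t u) (max t u)" "\<not> Q' (min t w) (max t w)" using t eq by blast+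
    then show "\<exists>t\<in>{1..s} - {i..j}. \<exists>u\<in>{i..j}. \<exists>w\<in>{i..j}.
        Q' (min t u) (max t u) \<noteq> Q' (min t w) (max t w)" using t by blast
  qed
  show ?thesis using imp[of Q Q'] imp[of Q' Q] assms by blast
qed

lemma inv_symmetric:
  assumes w: "w \<in> weyl n" and xy: "(x, y) \<in> posA (deg X n)"
  shows "(deg X n + 1 - y, deg X n + 1 - x) \<in> invA (deg X n) (iota X n w) \<longleftrightarrow> (x, y) \<in> invA (deg X n) (iota X n w)"
proof -
  have "conjrev (deg X n) (iota X n w) = iota X n w"
    using iota_symmetric[OF w] symmetric_iff_conjrev[OF iota_symgrp[OF w]] by blast
  then show ?thesis using invA_conjrev[OF iota_symgrp[OF w] xy] by simp
qed

text \<open>Common input to the two irreducibility proofs below, each of which contradicts the last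
  property by showing that the inversions of \<open>\<alpha>\<close> carry one colour only. They all
  run between intervals because the inner components are trivial.\<close>

lemma colouring_of_reducible:
  assumes infl: "inflationBC X n \<alpha> m z p \<sigma> \<beta> \<gamma>" and b: "\<And>b. b \<in> {1..m} \<Longrightarrow> \<beta> b = id" and g: "\<gamma> = id"
    and red: "reducible (weyl n) (invBC X n) \<alpha>"
  obtains c :: "nat \<Rightarrow> nat \<Rightarrow> nat" where "interval_colouring (deg X n) c"
    "\<And>x y. c x y = 0 \<longleftrightarrow> (x, y) \<notin> invA (deg X n) (iota X n \<alpha>)"
    "\<And>x y. (x, y) \<in> invA (deg X n) (iota X n \<alpha>) \<Longrightarrow>
       blk (sym_lengths X m z p) (deg (outer X p) m) x < blk (sym_lengths X m z p) (deg (outer X p) m) y"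
    "\<And>x y. (x, y) \<in> posA (deg X n) \<Longrightarrow> c (deg X n + 1 - y) (deg X n + 1 - x) = c x y"
    "\<And>i. \<exists>x y. (x, y) \<in> invA (deg X n) (iota X n \<alpha>) \<and> c x y \<noteq> i"
proof -
  let ?N = "deg X n" and ?s = "deg (outer X p) m" and ?Z = "sym_lengths X m z p"
  obtain r \<delta> where d: "\<And>a. a \<in> {1..r} \<Longrightarrow> \<delta> a \<in> weyl n"
    "\<And>a. a \<in> {1..r} \<Longrightarrow> invBC X n (\<delta> a) \<noteq> invBC X n \<alpha>"
    and du: "disj_union (invBC X n \<alpha>) r (\<lambda>a. invBC X n (\<delta> a))"
    using red unfolding reducible_def by blast
  have a: "\<alpha> \<in> weyl n"
    and ia: "inflationA ?N (iota X n \<alpha>) ?s ?Z (iota (outer X p) m \<sigma>) (sym_entries X m z p \<beta> \<gamma>)"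
    using infl unfolding inflationBC_def by blast+
  note c = inflationA_composition[OF ia]
  have duA: "disj_union (invA ?N (iota X n \<alpha>)) r (\<lambda>a. invA ?N (iota X n (\<delta> a)))"
    using du disj_union_invBC_iff[OF a, of r \<delta> X] d(1) by blast
  obtain cl where cl: "interval_colouring ?N cl"
    "\<And>x y a. a \<in> {1..r} \<Longrightarrow> cl x y = a \<longleftrightarrow> (x, y) \<in> invA ?N (iota X n (\<delta> a))"
    "\<And>x y. cl x y = 0 \<longleftrightarrow> (x, y) \<notin> invA ?N (iota X n \<alpha>)" "\<And>x y. cl x y \<le> r"
    by (rule colouring_of_disj_union[OF duA]) blast
  have ent: "sym_entries X m z p \<beta> \<gamma> i = id" if "i \<in> {1..?s}" for i
    using that
  proof (cases rule: sym_index_cases)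
    case low
    then show ?thesis using b sym_entries_low by metis
  next
    case mid
    then show ?thesis using g sym_entries_mid iota_id by metis
  next
    case (high b')
    have "conjrev k id = id" for k by (auto simp: conjrev_def revperm_def fun_eq_iff)
    then show ?thesis using b high sym_entries_high by metis
  qed
  have cross: "blk ?Z ?s x < blk ?Z ?s y" if xy: "(x, y) \<in> invA ?N (iota X n \<alpha>)" for x y
  proof -
    have pos: "(x, y) \<in> posA ?N" using xy invA_subset by blast
    then have x: "x \<in> {1..?N}" "y \<in> {1..?N}" "x \<le> y" by (auto simp: posA_def)
    have "blk ?Z ?s x \<noteq> blk ?Z ?s y"
    proof
      assume eq: "blk ?Z ?s x = blk ?Z ?s y"
      have "sym_entries X m z p \<beta> \<gamma> (blk ?Z ?s x) = id" using ent blk_in(1)[OF c x(1)] by blast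
      then have "\<not> liftA ?Z ?s S (\<lambda>i. invA (?Z i) (sym_entries X m z p \<beta> \<gamma> i)) (x, y)" for S
        using eq by (simp add: liftA_def)
      then show False using ia pos xy unfolding inflationA_iff by blast
    qed
    then show ?thesis using blk_mono[OF c x] by simp
  qed
  \<comment> \<open>Each member comes from a signed permutation, so its inversion set is closed
    under mirroring, and likewise for the non-inversions of colour 0.\<close>
  have clsym: "cl (?N + 1 - y) (?N + 1 - x) = cl x y" if xy: "(x, y) \<in> posA ?N" for x y
  proof -
    have "cl (?N + 1 - y) (?N + 1 - x) = a \<longleftrightarrow> cl x y = a" if "a \<le> r" for a
    proof (cases "a = 0")
      case True
      then show ?thesis using cl(3) inv_symmetric[OF a xy] by simp
    next
      case False
      then have "a \<in> {1..r}" using that by simp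
      then show ?thesis using cl(2) inv_symmetric[OF d(1) xy] by simp
    qed
    then show ?thesis using cl(4) by blast
  qed
  \<comment> \<open>If all inversions had colour \<open>i\<close>, the member
    \<open>\<delta> i\<close> would have all inversions of \<open>\<alpha>\<close> and so be equal
    to it.\<close>
  have "\<exists>x y. (x, y) \<in> invA ?N (iota X n \<alpha>) \<and> cl x y \<noteq> i" for i
  proof (rule ccontr)
    assume "\<not> ?thesis"
    then have i: "\<And>x y. (x, y) \<in> invA ?N (iota X n \<alpha>) \<Longrightarrow> cl x y = i" by blast
    have "invA ?N (iota X n \<alpha>) \<noteq> {}"
      using reducible_nonempty[OF red] invBC_eq_empty_iff[OF a] invA_eq_empty_iff[OF iota_symgrp[OF a]]
        iota_inject[OF a id_weyl, of X] iota_id by metis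
    then obtain u v where uv: "(u, v) \<in> invA ?N (iota X n \<alpha>)" by auto
    have ir: "i \<in> {1..r}" using i[OF uv] cl(3)[of u v] cl(4)[of u v] uv by auto
    have "(x, y) \<in> invA ?N (iota X n (\<delta> i))" if "(x, y) \<in> invA ?N (iota X n \<alpha>)" for x y
      using i[OF that] cl(2)[OF ir] by blast
    then have "invA ?N (iota X n (\<delta> i)) = invA ?N (iota X n \<alpha>)"
      using disj_union_mem_subset[OF duA ir] by auto
    then have "\<delta> i = \<alpha>" using invA_inject iota_symgrp iota_inject d(1)[OF ir] a by metis
    then show False using d(2)[OF ir] by simp
  qed
  then show ?thesis using that cl(1,3) cross clsym by blast
qed

text \<open>The distinguished colour is 0 here, and the prime graph is the complement of the
  inversion graph. \<open>cross_colour_unique\<close> then leaves only one colour for the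
  inversions.\<close>

lemma irreducible_simple:
  assumes infl: "inflationBC X n \<alpha> m z p \<sigma> \<beta> \<gamma>" and b: "\<And>b. b \<in> {1..m} \<Longrightarrow> \<beta> b = id" and g: "\<gamma> = id"
    and s: "4 \<le> deg (outer X p) m"
    and prime: "prime_graph (deg (outer X p) m) (\<lambda>i j. (i, j) \<in> invA (deg (outer X p) m) (iota (outer X p) m \<sigma>))"
  shows "\<not> reducible (weyl n) (invBC X n) \<alpha>"
proof
  let ?N = "deg X n" and ?s = "deg (outer X p) m" and ?Z = "sym_lengths X m z p"
    and ?S = "iota (outer X p) m \<sigma>"
  assume red: "reducible (weyl n) (invBC X n) \<alpha>"
  have ia: "inflationA ?N (iota X n \<alpha>) ?s ?Z ?S (sym_entries X m z p \<beta> \<gamma>)"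
    using infl unfolding inflationBC_def by blast
  note c = inflationA_composition[OF ia]
  obtain cl :: "nat \<Rightarrow> nat \<Rightarrow> nat" where cl: "interval_colouring ?N cl"
    "\<And>x y. cl x y = 0 \<longleftrightarrow> (x, y) \<notin> invA ?N (iota X n \<alpha>)"
    "\<And>x y. (x, y) \<in> invA ?N (iota X n \<alpha>) \<Longrightarrow> blk ?Z ?s x < blk ?Z ?s y"
    "\<And>i. \<exists>x y. (x, y) \<in> invA ?N (iota X n \<alpha>) \<and> cl x y \<noteq> i"
    by (rule colouring_of_reducible[OF infl b g red]) blast+
  have inv: "x \<in> {1..?N} \<and> y \<in> {1..?N} \<and> blk ?Z ?s x < blk ?Z ?s y \<and> cl x y \<noteq> 0"
    if "(x, y) \<in> invA ?N (iota X n \<alpha>)" for x y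
    using subsetD[OF invA_subset that] cl(2,3) that by (auto simp: posA_def)
  have prime': "prime_graph ?s (\<lambda>i j. (i, j) \<notin> invA ?s ?S)" using prime by (simp only: prime_graph_not)
  have crossQ: "cl x y = 0 \<longleftrightarrow> (blk ?Z ?s x, blk ?Z ?s y) \<notin> invA ?s ?S"
    if "x \<in> {1..?N}" "y \<in> {1..?N}" "blk ?Z ?s x < blk ?Z ?s y" for x y
    using cl(2) inflationA_cross_iff[OF ia posA_blk(1)[OF c that]] that(3) by simp
  obtain u v where uv: "(u, v) \<in> invA ?N (iota X n \<alpha>)" using cl(4) by blast
  obtain x y where xy: "(x, y) \<in> invA ?N (iota X n \<alpha>)" "cl x y \<noteq> cl u v" using cl(4) by blast
  have "cl x y = cl u v"
    by (rule cross_colour_unique[OF c s cl(1) prime', of 0]) (use inv[OF xy(1)] inv[OF uv] crossQ in blast)+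
  then show False using xy(2) by simp
qed

text \<open>There are two intervals, or three with a middle one, and colour 0 occurs exactly inside
  them. Hence colours depend only on the pair of intervals, and mirror symmetry identifies the pairs
  involving the middle.\<close>

lemma irreducible_longest:
  assumes infl: "inflationBC X n \<alpha> 1 z p (negation 1) \<beta> \<gamma>" and b: "\<beta> 1 = id" and g: "\<gamma> = id"
  shows "\<not> reducible (weyl n) (invBC X n) \<alpha>"
proof
  let ?N = "deg X n" and ?s = "deg (outer X p) 1" and ?Z = "sym_lengths X 1 z p"
  let ?g = "blk ?Z ?s"
  assume red: "reducible (weyl n) (invBC X n) \<alpha>"
  have ia: "inflationA ?N (iota X n \<alpha>) ?s ?Z (iota (outer X p) 1 (negation 1)) (sym_entries X 1 z p \<beta> \<gamma>)"
    using infl unfolding inflationBC_def by blast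
  note c = inflationA_composition[OF ia]
  have s: "?s = 2 \<or> ?s = 3" by (cases "outer X p") (auto simp: deg_def)
  have b1: "\<beta> b' = id" if "b' \<in> {1..1}" for b' using b that by (metis atLeastAtMost_singleton singletonD)
  obtain cl :: "nat \<Rightarrow> nat \<Rightarrow> nat" where cl: "interval_colouring ?N cl"
    "\<And>x y. cl x y = 0 \<longleftrightarrow> (x, y) \<notin> invA ?N (iota X n \<alpha>)"
    "\<And>x y. (x, y) \<in> invA ?N (iota X n \<alpha>) \<Longrightarrow> ?g x < ?g y"
    "\<And>x y. (x, y) \<in> posA ?N \<Longrightarrow> cl (?N + 1 - y) (?N + 1 - x) = cl x y"
    "\<And>i. \<exists>x y. (x, y) \<in> invA ?N (iota X n \<alpha>) \<and> cl x y \<noteq> i"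
    by (rule colouring_of_reducible[OF infl b1 g red]) blast+
  have cl0: "col cl x y = 0 \<longleftrightarrow> ?g x = ?g y" if x: "x \<in> {1..?N}" "y \<in> {1..?N}" "x < y" for x y
  proof (cases "?g x = ?g y")
    case True
    then show ?thesis using cl(2,3)[of x y] x(3) by (auto simp: col_less)
  next
    case False
    have pos: "(x, y) \<in> posA ?N" using x by (auto simp: posA_def)
    have "(?g x, ?g y) \<in> posA ?s" using blk_mono[OF c x(1,2)] posA_blk(2)[OF c x(1,2)] False x(3) by simp
    then have "(x, y) \<in> invA ?N (iota X n \<alpha>)"
      using inflationA_cross_iff[OF ia pos False] by (simp add: iota_negation)
    then show ?thesis using False cl(2)[of x y] x(3) by (simp add: col_less)
  qed
  have clsym: "col cl (?N + 1 - y) (?N + 1 - x) = col cl x y" if "x \<in> {1..?N}" "y \<in> {1..?N}" "x < y" for x y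
    using cl(4)[of x y] that by (simp add: col_less posA_def diff_less_mono2)
  have s1: "1 \<le> ?s" using s by auto
  note ends = composition_1[OF c s1]
  let ?i = "col cl 1 ?N"
  \<comment> \<open>The edge inside an interval has colour 0 while the long edge has not, so the
    long edge takes the colour of the other short edge.\<close>
  have step: "col cl x y = col cl x' y" if "x \<in> {1..?N}" "x' \<in> {1..?N}" "y \<in> {1..?N}" "?g x = ?g x'" "?g x < ?g y" for x x' y
  proof -
    have *: "col cl x y = col cl x' y" if x: "x \<in> {1..?N}" "x' \<in> {1..?N}" "?g x = ?g x'" "?g x < ?g y" "x < x'" for x x'
    proof -
      have l: "x' < y" "x < y" using blk_less[OF c x(2) \<open>y \<in> _\<close>] blk_less[OF c x(1) \<open>y \<in> _\<close>] x by auto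
      have "col cl x y \<noteq> 0" using cl0[OF x(1) \<open>y \<in> _\<close> l(2)] x by simp
      moreover have "col cl x x' = 0" using cl0[OF x(1,2,5)] x by simp
      ultimately show ?thesis using interval_colouringD[OF cl(1), of x x' y] x l \<open>y \<in> _\<close> by auto
    qed
    show ?thesis using *[of x x'] *[of x' x] that by (cases x x' rule: linorder_cases) auto
  qed
  have step': "col cl x y = col cl x y'" if "x \<in> {1..?N}" "y \<in> {1..?N}" "y' \<in> {1..?N}" "?g y = ?g y'" "?g x < ?g y" for x y y'
  proof -
    have *: "col cl x y = col cl x y'" if y: "y \<in> {1..?N}" "y' \<in> {1..?N}" "?g y = ?g y'" "?g x < ?g y" "y < y'" for y y'
    proof -
      have l: "x < y" "x < y'" using blk_less[OF c \<open>x \<in> _\<close> y(1)] blk_less[OF c \<open>x \<in> _\<close> y(2)] y by auto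
      have "col cl x y' \<noteq> 0" using cl0[OF \<open>x \<in> _\<close> y(2) l(2)] y by simp
      moreover have "col cl y y' = 0" using cl0[OF y(1,2,5)] y by simp
      ultimately show ?thesis using interval_colouringD[OF cl(1), of x y y'] y l \<open>x \<in> _\<close> by auto
    qed
    show ?thesis using *[of y y'] *[of y' y] that by (cases y y' rule: linorder_cases) auto
  qed
  have low: "col cl x y = ?i" if xy: "x \<in> {1..?N}" "y \<in> {1..?N}" "?g x = 1" "?g x < ?g y" for x y
  proof (cases "?g y = ?s")
    case True
    then show ?thesis
      using step[OF xy(1) ends(1) xy(2)] step'[OF ends(1) xy(2) ends(2)] xy ends by simp
  next
    case False
    have gy: "?g y = 2" "?s = 3" using blk_in(1)[OF c xy(2)] s False xy by auto
    let ?y = "?N + 1 - y"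
    have y': "?y \<in> {1..?N}" using xy(2) by auto
    have "?g ?y = 2" using blk_rev(1)[OF c sym_lengths_palindrome xy(2)] gy by simp
    \<comment> \<open>For \<open>y\<close> in the middle, its mirror image is also in the middle, so
      the edges from \<open>y\<close> to 1 and to \<open>?N\<close> have equal colours; the long
      edge must share it.\<close>
    then have "col cl 1 y = col cl 1 ?y" using step'[OF ends(1) xy(2) y'] gy ends by simp
    moreover have lt: "1 < y" "y < ?N" using blk_less[OF c ends(1) xy(2)] blk_less[OF c xy(2) ends(2)] ends gy by auto
    moreover have "col cl 1 ?y = col cl y ?N" using clsym[OF xy(2) ends(2) lt(2)] by simp
    moreover have "?i = col cl 1 y \<or> ?i = col cl y ?N" using interval_colouringD[OF cl(1), of 1 y ?N] lt by simp
    ultimately have "col cl 1 y = ?i" by metis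
    then show ?thesis using step[OF xy(1) ends(1) xy(2)] xy ends by simp
  qed
  have all: "col cl x y = ?i" if xy: "x \<in> {1..?N}" "y \<in> {1..?N}" "?g x < ?g y" for x y
  proof (cases "?g x = 1")
    case False
    then have gs: "?g x = 2" "?g y = 3" "?s = 3"
      using blk_in(1)[OF c xy(1)] blk_in(1)[OF c xy(2)] s xy(3) by auto
    let ?x = "?N + 1 - y" and ?y = "?N + 1 - x"
    have "?x \<in> {1..?N}" "?y \<in> {1..?N}" using xy by auto
    moreover have "?g ?x = 1" "?g ?y = 2"
      using blk_rev(1)[OF c sym_lengths_palindrome xy(2)] blk_rev(1)[OF c sym_lengths_palindrome xy(1)] gs by auto
    ultimately have "col cl ?x ?y = ?i" using low by simp
    then show ?thesis using clsym[OF xy(1,2) blk_less[OF c xy]] by simp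
  qed (use low xy in simp)
  obtain x y where xy: "(x, y) \<in> invA ?N (iota X n \<alpha>)" "cl x y \<noteq> ?i" using cl(5) by blast
  have "x \<in> {1..?N}" "y \<in> {1..?N}" "x < y" using subsetD[OF invA_subset xy(1)] by (auto simp: posA_def)
  then show False using all[OF _ _ cl(3)[OF xy(1)]] xy(2) by (simp add: col_less)
qed

text \<open>For any w other than I and J, the inversion sets of w and Jw are complementary and
  neither is everything.\<close>

lemma reducible_negation:
  assumes "2 \<le> m"
  shows "reducible (weyl m) (invBC Y m) (negation m)"
proof -
  \<comment> \<open>The transposition of the first two basis vectors, which is available because
    \<open>2 \<le> m\<close>.\<close>
  define w :: "int \<Rightarrow> int" where
    "w a = (if a = 1 then 2 else if a = 2 then 1 else if a = - 1 then - 2 else if a = - 2 then - 1 else a)" for a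
  have w: "w \<in> weyl m" by (rule weylI) (use assms in \<open>auto simp: w_def split: if_splits\<close>)
  let ?w = "negation m \<circ> w"
  have w': "?w \<in> weyl m" using weyl_comp[OF negation_weyl w] .
  have "w 1 = 2" by (simp add: w_def)
  then have "w \<noteq> id" by auto
  have "negation m 1 = - 1" using assms by (simp add: negation_def)
  then have "w \<noteq> negation m" using \<open>w 1 = 2\<close> by auto
  have "?w \<noteq> negation m"
  proof
    assume "?w = negation m"
    then have "negation m (w 1) = negation m 1" by (metis comp_apply)
    then show False using \<open>w 1 = 2\<close> assms by (simp add: negation_def)
  qed
  have "invA (deg Y m) (iota Y m ?w) = posA (deg Y m) - invA (deg Y m) (iota Y m w)"
    unfolding iota_comp[OF negation_weyl w] iota_negation by (rule invA_rev_comp[OF iota_symgrp[OF w]])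
  then have "disj_union (invA (deg Y m) (iota Y m (negation m))) 2
      (\<lambda>a. invA (deg Y m) (iota Y m (if a = 1 then w else ?w)))"
    unfolding disj_union_two iota_negation using invA_subset by auto
  then have "disj_union (invBC Y m (negation m)) 2 (\<lambda>a. invBC Y m (if a = 1 then w else ?w))"
    by (subst disj_union_invBC_iff) (use w w' negation_weyl in auto)
  moreover have "\<forall>a\<in>{1..2::nat}. (if a = 1 then w else ?w) \<in> weyl m \<and>
      invBC Y m (if a = 1 then w else ?w) \<noteq> invBC Y m (negation m)"
    using w w' invBC_inject negation_weyl \<open>w \<noteq> negation m\<close> \<open>?w \<noteq> negation m\<close> by metis
  ultimately show ?thesis unfolding reducible_def
    by (intro exI[of _ 2] exI[of _ "\<lambda>a. if a = 1 then w else ?w"]) simp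
qed

text \<open>The longest element is an inflation of longest elements over every partition. So the
  decomposition of all positive roots is an instance of
  \<open>inflationBC_disj_union\<close>.\<close>

lemma inflationBC_negation:
  assumes len: "lengths_ok n m z p"
  shows "inflationBC X n (negation n) m z p (negation m) (\<lambda>b. revperm (z b)) (negation p)"
proof -
  let ?N = "deg X n" and ?s = "deg (outer X p) m" and ?Z = "sym_lengths X m z p"
    and ?E = "sym_entries X m z p (\<lambda>b. revperm (z b)) (negation p)"
  note c = composition_sym[OF len, of X]
  have E: "?E i = revperm (?Z i)" if "i \<in> {1..?s}" for i
    using that
  proof (cases rule: sym_index_cases)
    case low
    then show ?thesis by (simp add: sym_entries_low sym_lengths_low)
  next
    case mid
    then show ?thesis using sym_entries_mid sym_lengths_mid iota_negation by metis
  next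
    case (high b)
    have "conjrev k (revperm k) = revperm k" for k by (auto simp: conjrev_def revperm_def fun_eq_iff)
    then show ?thesis
      using high sym_entries_high[OF high(1), of X z p] sym_lengths_rev[OF deg_gt(1)[OF high(1)]]
        sym_lengths_low[OF high(1)] by metis
  qed
  have "inflationA ?N (revperm ?N) ?s ?Z (revperm ?s) ?E"
    unfolding inflationA_iff
  proof (intro conjI ballI c revperm_symgrp)
    fix v assume v: "v \<in> posA ?N"
    then obtain x y where vxy: "v = (x, y)" and x: "x \<in> {1..?N}" "y \<in> {1..?N}" "x < y"
      by (auto simp: posA_def)
    have "liftA ?Z ?s (invA ?s (revperm ?s)) (\<lambda>i. invA (?Z i) (?E i)) v"
    proof (cases "blk ?Z ?s x = blk ?Z ?s y")
      case True
      then show ?thesis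
        using E[OF blk_in(1)[OF c x(1)]] loc_in(1)[OF c x(1)] loc_in(1)[OF c x(2)] loc_less_iff[OF c x(1,2)] x(3)
        unfolding vxy liftA_def by (simp add: posA_def)
    next
      case False
      then show ?thesis using blk_mono[OF c x(1,2)] x(3) posA_blk(2)[OF c x(1,2)]
        unfolding vxy liftA_def by simp
    qed
    then show "v \<in> invA ?N (revperm ?N) \<longleftrightarrow> liftA ?Z ?s (invA ?s (revperm ?s)) (\<lambda>i. invA (?Z i) (?E i)) v"
      using v by simp
  qed (use E revperm_symgrp in metis)
  then show ?thesis
    unfolding inflationBC_iff iota_negation using len negation_weyl revperm_symgrp by blast
qed

section \<open>Decompositions of the set of positive roots\<close>

lemma disj_union_0: "disj_union D 0 F \<longleftrightarrow> D = {}"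
  unfolding disj_union_def disjoint_family_on_def by simp

text \<open>An instance of \<open>inflationBC_disj_union\<close> with no members: a union of length
  0 says that the set is empty.\<close>

lemma inflationBC_empty_iff:
  assumes "inflationBC X n \<alpha> m z p \<sigma> \<beta> \<gamma>"
  shows "invBC X n \<alpha> = {} \<longleftrightarrow> \<sigma> = id \<and> (\<forall>b\<in>{1..m}. \<beta> b = id) \<and> \<gamma> = id"
proof -
  have h: "\<sigma> \<in> weyl m" "\<gamma> \<in> weyl p" "\<And>b. b \<in> {1..m} \<Longrightarrow> \<beta> b \<in> symgrp (z b)"
    using assms unfolding inflationBC_def by blast+
  show ?thesis
    using inflationBC_disj_union[OF assms, of 0] h invA_eq_empty_iff[OF h(3)] invBC_eq_empty_iff
    by (simp add: disj_union_0)
qed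

text \<open>The inversion \<open>(1, deg X n)\<close> joins the first and the last interval and so
  excludes a trivial outer element. Of the two remaining kinds of simple form, reversal is exactly
  the minus-decomposable one.\<close>

lemma simple_form_cases:
  assumes sf: "simple_formBC X n \<alpha> m z p \<sigma> \<beta> \<gamma>" and inv: "(1, deg X n) \<in> invA (deg X n) (iota X n \<alpha>)"
  shows "1 \<le> m" and "\<sigma> \<noteq> id"
    and "minus_decomposableBC X n \<alpha> \<Longrightarrow> \<sigma> = negation m"
    and "\<not> minus_decomposableBC X n \<alpha> \<Longrightarrow> 4 \<le> deg (outer X p) m \<and> simpleA (deg (outer X p) m) (iota (outer X p) m \<sigma>)"
proof -
  let ?N = "deg X n" and ?s = "deg (outer X p) m" and ?Z = "sym_lengths X m z p"
    and ?S = "iota (outer X p) m \<sigma>"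
  have infl: "inflationA ?N (iota X n \<alpha>) ?s ?Z ?S (sym_entries X m z p \<beta> \<gamma>)"
    and s2: "2 \<le> ?s" and w: "\<sigma> \<in> weyl m"
    and cases: "4 \<le> ?s \<and> simpleA ?s ?S \<or> ?S = id \<or> ?S = revperm ?s"
    using sf unfolding simple_formBC_def simple_formA_def inflationBC_def by blast+
  note c = inflationA_composition[OF infl]
  show "1 \<le> m" using s2 by (cases "outer X p"; cases m) (auto simp: deg_def)
  have s1: "1 \<le> ?s" using s2 by simp
  note ends = composition_1[OF c s1]
  have "(1, ?s) \<in> invA ?s ?S"
    using inflationA_cross_iff[OF infl _] inv invA_subset[of ?N "iota X n \<alpha>"] ends s2 by fastforce
  then have ne: "?S \<noteq> id" by auto
  then show "\<sigma> \<noteq> id" by auto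
  have rev: "minus_decomposableBC X n \<alpha>" "\<sigma> = negation m" if "?S = revperm ?s"
  proof -
    show "minus_decomposableBC X n \<alpha>"
      unfolding minus_decomposableBC_def using minus_decomposable_rev[OF infl[unfolded that] s2] .
    show "\<sigma> = negation m"
      using iota_inject[OF w negation_weyl] that iota_negation by metis
  qed
  show "\<sigma> = negation m" if "minus_decomposableBC X n \<alpha>"
  proof -
    have "\<not> (4 \<le> ?s \<and> simpleA ?s ?S)"
      using not_minus_decomposable_simple[OF infl] that unfolding minus_decomposableBC_def by blast
    then show ?thesis using cases ne rev(2) by blast
  qed
  show "4 \<le> ?s \<and> simpleA ?s ?S" if "\<not> minus_decomposableBC X n \<alpha>"
    using cases ne rev(1) that by blast
qed

lemma invA_negation_comp:
  assumes "w \<in> weyl m"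
  shows "invA (deg Y m) (iota Y m (negation m \<circ> w)) = posA (deg Y m) - invA (deg Y m) (iota Y m w)"
  unfolding iota_comp[OF negation_weyl assms] iota_negation by (rule invA_rev_comp[OF iota_symgrp[OF assms]])

text \<open>The outer elements \<open>S a\<close> are prescribed so as to fit the colours between
  intervals; \<open>inflationBC_of_cross\<close> then supplies the inner components.\<close>

lemma outer_elements:
  fixes \<alpha> :: "nat \<Rightarrow> int \<Rightarrow> int"
  assumes \<alpha>: "\<forall>a\<in>{1..r}. \<alpha> a \<in> weyl n"
    and du: "disj_union (pos_roots X n) r (\<lambda>a. invBC X n (\<alpha> a))"
    and inv: "(1, deg X n) \<in> invA (deg X n) (iota X n (\<alpha> 1))"
    and sf: "simple_formBC X n (\<alpha> 1) m z p \<sigma>\<^sub>1 \<beta>\<^sub>1 \<gamma>\<^sub>1" and r: "1 \<le> r"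
  obtains S where "S 1 = \<sigma>\<^sub>1"
    "\<And>a. a \<in> {1..r} \<Longrightarrow> \<exists>\<beta> \<gamma>. \<beta> \<in> (\<Pi>\<^sub>E b\<in>{1..m}. symgrp (z b)) \<and> inflationBC X n (\<alpha> a) m z p (S a) \<beta> \<gamma>"
    "minus_decomposableBC X n (\<alpha> 1) \<Longrightarrow> \<forall>a\<in>{2..r}. S a = id"
    "\<not> minus_decomposableBC X n (\<alpha> 1) \<Longrightarrow>
       \<exists>a\<^sub>0\<in>{2..r}. S a\<^sub>0 = negation m \<circ> \<sigma>\<^sub>1 \<and> (\<forall>a\<in>{2..r} - {a\<^sub>0}. S a = id)"
proof -
  let ?N = "deg X n" and ?s = "deg (outer X p) m" and ?Z = "sym_lengths X m z p"
  let ?g = "blk ?Z ?s"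
  have infl: "inflationBC X n (\<alpha> 1) m z p \<sigma>\<^sub>1 \<beta>\<^sub>1 \<gamma>\<^sub>1" using sf unfolding simple_formBC_def by blast
  have w: "\<sigma>\<^sub>1 \<in> weyl m" and len: "lengths_ok n m z p"
    and ia: "inflationA ?N (iota X n (\<alpha> 1)) ?s ?Z (iota (outer X p) m \<sigma>\<^sub>1) (sym_entries X m z p \<beta>\<^sub>1 \<gamma>\<^sub>1)"
    using infl unfolding inflationBC_iff by blast+
  note c = inflationA_composition[OF ia] and sfc = simple_form_cases[OF sf inv]
  have one: "1 \<in> {1..r}" using r by simp
  have "disj_union (invBC X n (negation n)) r (\<lambda>a. invBC X n (\<alpha> a))" using du by (simp add: invBC_negation)
  then have duA: "disj_union (invA ?N (revperm ?N)) r (\<lambda>a. invA ?N (iota X n (\<alpha> a)))"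
    using disj_union_invBC_iff[OF negation_weyl, of r \<alpha> n X] \<alpha> by (simp add: iota_negation del: invA_revperm)
  obtain cl where cl: "interval_colouring ?N cl"
    "\<And>x y a. a \<in> {1..r} \<Longrightarrow> cl x y = a \<longleftrightarrow> (x, y) \<in> invA ?N (iota X n (\<alpha> a))"
    "\<And>x y. cl x y = 0 \<longleftrightarrow> (x, y) \<notin> invA ?N (revperm ?N)" "\<And>x y. cl x y \<le> r"
    by (rule colouring_of_disj_union[OF duA]) blast
  have blk_less': "?g x < ?g y" if "(x, y) \<in> posA ?N" "?g x \<noteq> ?g y" for x y
    using blk_mono[OF c, of x y] that by (auto simp: posA_def)
  have posg: "(?g x, ?g y) \<in> posA ?s" if "(x, y) \<in> posA ?N" "?g x \<noteq> ?g y" for x y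
    using posA_blk(2)[OF c, of x y] blk_less'[OF that] that(1) by (auto simp: posA_def)
  have cl1: "cl x y = 1 \<longleftrightarrow> (?g x, ?g y) \<in> invA ?s (iota (outer X p) m \<sigma>\<^sub>1)"
    if "(x, y) \<in> posA ?N" "?g x \<noteq> ?g y" for x y
    using cl(2)[OF one] inflationA_cross_iff[OF ia that] by simp
  have *: "\<exists>\<beta> \<gamma>. \<beta> \<in> (\<Pi>\<^sub>E b\<in>{1..m}. symgrp (z b)) \<and> inflationBC X n (\<alpha> a) m z p t \<beta> \<gamma>"
    if a: "a \<in> {1..r}" and t: "t \<in> weyl m"
      and cross: "\<And>x y. (x, y) \<in> posA ?N \<Longrightarrow> ?g x \<noteq> ?g y \<Longrightarrow>
          cl x y = a \<longleftrightarrow> (?g x, ?g y) \<in> invA ?s (iota (outer X p) m t)" for a t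
  proof -
    have "\<alpha> a \<in> weyl n" using \<alpha> a by blast
    then obtain \<beta> \<gamma> where "\<beta> \<in> (\<Pi>\<^sub>E b\<in>{1..m}. symgrp (z b))" "inflationBC X n (\<alpha> a) m z p t \<beta> \<gamma>"
      by (rule inflationBC_of_cross[OF len _ t, where X = X]) (use cl(2)[OF a] cross in auto)
    then show ?thesis by blast
  qed
  show ?thesis
  proof (cases "minus_decomposableBC X n (\<alpha> 1)")
    case True
    \<comment> \<open>The outer element of \<open>\<alpha> 1\<close> is J, so colour 1 already uses
      up all pairs between intervals.\<close>
    have eq1: "cl x y = 1" if "(x, y) \<in> posA ?N" "?g x \<noteq> ?g y" for x y
      using cl1[OF that] posg[OF that] sfc(3)[OF True] by (simp add: iota_negation)
    define S where "S a = (if a = 1 then \<sigma>\<^sub>1 else id)" for a :: nat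
    show ?thesis
    proof (rule that[of S])
      fix a assume a: "a \<in> {1..r}"
      show "\<exists>\<beta> \<gamma>. \<beta> \<in> (\<Pi>\<^sub>E b\<in>{1..m}. symgrp (z b)) \<and> inflationBC X n (\<alpha> a) m z p (S a) \<beta> \<gamma>"
        by (rule *[OF a]) (use eq1 cl1 w id_weyl in \<open>auto simp: S_def\<close>)
    qed (use True in \<open>auto simp: S_def\<close>)
  next
    case False
    have s: "4 \<le> ?s" and simple: "simpleA ?s (iota (outer X p) m \<sigma>\<^sub>1)" using sfc(4)[OF False] by auto
    note prime = simple_prime_graph[OF simple]
    have cross: "cl x y = 1 \<longleftrightarrow> (?g x, ?g y) \<in> invA ?s (iota (outer X p) m \<sigma>\<^sub>1)"
      if "x \<in> {1..?N}" "y \<in> {1..?N}" "?g x < ?g y" for x y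
      using cl1[OF posA_blk(1)[OF c that]] that(3) by simp
    \<comment> \<open>Primality at \<open>{1, 2}\<close> now yields a non-inverted pair of
      intervals, hence a pair between intervals whose colour is not 1.\<close>
    obtain t u v where t: "t \<in> {1..?s} - {1..2}" "u \<in> {1..2::nat}" "v \<in> {1..2}"
      "(min t v, max t v) \<notin> invA ?s (iota (outer X p) m \<sigma>\<^sub>1)"
      by (rule prime_graphE[OF prime, of 1 2]) (use s in auto)
    have vt: "v \<in> {1..?s}" "t \<in> {1..?s}" "v < t" "(v, t) \<notin> invA ?s (iota (outer X p) m \<sigma>\<^sub>1)"
      using t s by (auto simp: min_def max_def split: if_splits)
    obtain x0 where x0: "x0 \<in> {1..?N}" "?g x0 = v" using blk_rep[OF c vt(1)] .
    obtain y0 where y0: "y0 \<in> {1..?N}" "?g y0 = t" using blk_rep[OF c vt(2)] .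
    have xy0: "?g x0 < ?g y0" "cl x0 y0 \<noteq> 1" using cross[OF x0(1) y0(1)] x0 y0 vt by auto
    define a0 where "a0 = cl x0 y0"
    \<comment> \<open>Every pair is an inversion of the reversal, so colour 0 does not occur on
      \<open>posA\<close>.\<close>
    have "a0 \<noteq> 0" using cl(3)[of x0 y0] posA_blk(1)[OF c x0(1) y0(1) xy0(1)] by (simp add: a0_def)
    then have a0: "a0 \<in> {2..r}" using xy0(2) cl(4)[of x0 y0] by (auto simp: a0_def)
    have col: "cl x y = (if (?g x, ?g y) \<in> invA ?s (iota (outer X p) m \<sigma>\<^sub>1) then 1 else a0)"
      if xy: "(x, y) \<in> posA ?N" "?g x \<noteq> ?g y" for x y
    proof (cases "cl x y = 1")
      case True
      then show ?thesis using cl1[OF xy] by simp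
    next
      case False
      have x: "x \<in> {1..?N}" "y \<in> {1..?N}" using xy(1) by (auto simp: posA_def)
      have "cl x y = cl x0 y0"
        by (rule cross_colour_unique[OF c s cl(1) prime, of 1])
          (use cross x blk_less'[OF xy] False x0(1) y0(1) xy0 in blast)+
      then show ?thesis using cl1[OF xy] False by (simp add: a0_def)
    qed
    define S where "S a = (if a = 1 then \<sigma>\<^sub>1 else if a = a0 then negation m \<circ> \<sigma>\<^sub>1 else id)" for a :: nat
    show ?thesis
    proof (rule that[of S])
      fix a assume a: "a \<in> {1..r}"
      show "\<exists>\<beta> \<gamma>. \<beta> \<in> (\<Pi>\<^sub>E b\<in>{1..m}. symgrp (z b)) \<and> inflationBC X n (\<alpha> a) m z p (S a) \<beta> \<gamma>"
      proof (rule *[OF a])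
        show "S a \<in> weyl m" using w weyl_comp[OF negation_weyl w] id_weyl by (simp add: S_def)
        fix x y assume xy: "(x, y) \<in> posA ?N" "?g x \<noteq> ?g y"
        show "cl x y = a \<longleftrightarrow> (?g x, ?g y) \<in> invA ?s (iota (outer X p) m (S a))"
          using col[OF xy] posg[OF xy] a0 invA_negation_comp[OF w, of "outer X p"] by (auto simp: S_def)
      qed
    next
      show "\<exists>a\<^sub>0\<in>{2..r}. S a\<^sub>0 = negation m \<circ> \<sigma>\<^sub>1 \<and> (\<forall>a\<in>{2..r} - {a\<^sub>0}. S a = id)"
        using a0 by (intro bexI[of _ a0]) (auto simp: S_def)
    qed (use False in \<open>auto simp: S_def\<close>)
  qed
qed

text \<open>The conditions are sorted by whether \<open>\<sigma> a\<close> is the identity instead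
  of by relabelled indices, which keeps the permutation of the \<alpha>'s out of the
  argument.\<close>

lemma irreducibility_criterion:
  fixes \<alpha> :: "nat \<Rightarrow> int \<Rightarrow> int"
  assumes infl: "\<And>a. a \<in> {1..r} \<Longrightarrow> inflationBC X n (\<alpha> a) m z p (\<sigma> a) (\<beta> a) (\<gamma> a)"
    and ne: "\<And>a. a \<in> {1..r} \<Longrightarrow> invBC X n (\<alpha> a) \<noteq> {}" and m: "1 \<le> m" and r: "1 \<le> r"
    and md: "md \<Longrightarrow> \<sigma> 1 = negation m" "\<And>a. md \<Longrightarrow> a \<in> {2..r} \<Longrightarrow> \<sigma> a = id"
    and mi: "\<not> md \<Longrightarrow> 4 \<le> deg (outer X p) m" "\<not> md \<Longrightarrow> simpleA (deg (outer X p) m) (iota (outer X p) m (\<sigma> 1))"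
      "\<And>a. \<not> md \<Longrightarrow> a \<in> {2..r} \<Longrightarrow> \<sigma> a = negation m \<circ> \<sigma> 1 \<or> \<sigma> a = id"
  shows "(\<forall>a\<in>{1..r}. \<not> reducible (weyl n) (invBC X n) (\<alpha> a)) \<longleftrightarrow>
     (\<forall>a\<in>{1..r}. \<not> reducible (weyl m) (invBC (outer X p) m) (\<sigma> a)) \<and>
     (\<forall>b\<in>{1..m}. \<forall>a\<in>{1..r}. \<not> reducible (symgrp (z b)) (invA (z b)) (\<beta> a b)) \<and>
     (\<forall>a\<in>{1..r}. \<not> reducible (weyl p) (invBC X p) (\<gamma> a)) \<and>
     (\<forall>a\<in>{1..r}. \<sigma> a = id \<longrightarrow> (\<exists>!b. b \<in> {1..m + 1} \<and> (if b \<le> m then \<beta> a b \<noteq> id else \<gamma> a \<noteq> id))) \<and>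
     (\<forall>a\<in>{1..r}. \<sigma> a \<noteq> id \<longrightarrow> (\<forall>b\<in>{1..m}. \<beta> a b = id) \<and> \<gamma> a = id) \<and>
     (md \<longrightarrow> m = 1)" (is "?L \<longleftrightarrow> ?R")
proof
  assume L: ?L
  have red_id: "\<not> reducible (weyl k) (invBC Y k) id" "\<not> reducible (symgrp k) (invA k) id" for k Y
    using reducible_nonempty[of "weyl k" "invBC Y k" id] reducible_nonempty[of "symgrp k" "invA k" id] by auto
  have outer: "(\<forall>b\<in>{1..m}. \<beta> a b = id) \<and> \<gamma> a = id" if "a \<in> {1..r}" "\<sigma> a \<noteq> id" for a
    using irreducible_outer[OF infl[OF that(1)] _ that(2)] L that(1) by blast
  have inner: "\<sigma> a = id \<and> (\<forall>b'\<in>{1..m}. b' \<noteq> b \<longrightarrow> \<beta> a b' = id) \<and> \<gamma> a = id"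
    if "a \<in> {1..r}" "b \<in> {1..m}" "\<beta> a b \<noteq> id" for a b
    using irreducible_inner[OF infl[OF that(1)] _ that(2,3)] L that(1) by blast
  have 1: "\<not> reducible (weyl m) (invBC (outer X p) m) (\<sigma> a)" if a: "a \<in> {1..r}" for a
  proof (cases "\<sigma> a = id")
    case False
    then show ?thesis using reducible_outer[OF infl[OF a]] outer[OF a] L a by blast
  qed (simp add: red_id)
  have 2: "\<not> reducible (symgrp (z b)) (invA (z b)) (\<beta> a b)" if a: "a \<in> {1..r}" and b: "b \<in> {1..m}" for a b
  proof (cases "\<beta> a b = id")
    case False
    then have "inflationBC X n (\<alpha> a) m z p id (\<beta> a) id" using infl[OF a] inner[OF a b] by simp
    then show ?thesis using reducible_inner[OF _ b] inner[OF a b False] L a by blast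
  qed (simp add: red_id)
  have 3: "\<not> reducible (weyl p) (invBC X p) (\<gamma> a)" if a: "a \<in> {1..r}" for a
  proof (cases "\<gamma> a = id")
    case False
    then have "\<sigma> a = id" "\<And>b. b \<in> {1..m} \<Longrightarrow> \<beta> a b = id" using outer[OF a] inner[OF a] by blast+
    moreover from this have "inflationBC X n (\<alpha> a) m z p id (\<beta> a) (\<gamma> a)" using infl[OF a] by simp
    ultimately show ?thesis using reducible_middle L a by blast
  qed (simp add: red_id)
  \<comment> \<open>Some component is nontrivial since the inversion set is nonempty; a second one
    could be split off.\<close>
  have 4: "\<exists>!b. b \<in> {1..m + 1} \<and> (if b \<le> m then \<beta> a b \<noteq> id else \<gamma> a \<noteq> id)"
    if a: "a \<in> {1..r}" and id: "\<sigma> a = id" for a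
  proof -
    consider (ex) b where "b \<in> {1..m}" "\<beta> a b \<noteq> id" | (mid) "\<gamma> a \<noteq> id" "\<forall>b\<in>{1..m}. \<beta> a b = id"
      using inflationBC_empty_iff[OF infl[OF a]] ne[OF a] id by blast
    then show ?thesis
    proof cases
      case (ex b)
      show ?thesis
      proof (rule ex1I[of _ b])
        show "b \<in> {1..m + 1} \<and> (if b \<le> m then \<beta> a b \<noteq> id else \<gamma> a \<noteq> id)" using ex by auto
        fix c assume h: "c \<in> {1..m + 1} \<and> (if c \<le> m then \<beta> a c \<noteq> id else \<gamma> a \<noteq> id)"
        then have "c \<le> m" using inner[OF a ex] by (cases "c \<le> m") auto
        then have "c \<in> {1..m}" "\<beta> a c \<noteq> id" using h by auto
        then show "c = b" using inner[OF a ex] by blast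
      qed
    next
      case mid
      show ?thesis
      proof (rule ex1I[of _ "m + 1"])
        show "m + 1 \<in> {1..m + 1} \<and> (if m + 1 \<le> m then \<beta> a (m + 1) \<noteq> id else \<gamma> a \<noteq> id)" using mid by auto
        fix c assume h: "c \<in> {1..m + 1} \<and> (if c \<le> m then \<beta> a c \<noteq> id else \<gamma> a \<noteq> id)"
        then have "\<not> c \<le> m" using mid(2) by (cases "c \<le> m") auto
        then show "c = m + 1" using h by auto
      qed
    qed
  qed
  have 5: "m = 1" if md
  proof (rule ccontr)
    assume "m \<noteq> 1"
    then have "reducible (weyl m) (invBC (outer X p) m) (\<sigma> 1)"
      unfolding md(1)[OF that] by (intro reducible_negation) (use m in simp)
    then show False using 1[of 1] r by simp
  qed
  show ?R using 1 2 3 4 5 outer by blast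
next
  assume R: ?R
  show ?L
  proof
    fix a assume a: "a \<in> {1..r}"
    show "\<not> reducible (weyl n) (invBC X n) (\<alpha> a)"
    proof (cases "\<sigma> a = id")
      case True
      then have "inflationBC X n (\<alpha> a) m z p id (\<beta> a) (\<gamma> a)" using infl[OF a] by simp
      then show ?thesis by (rule irreducible_inflation_id) (use R a True in blast)+
    next
      case False
      have i: "\<And>b. b \<in> {1..m} \<Longrightarrow> \<beta> a b = id" "\<gamma> a = id" using R a False by blast+
      show ?thesis
      proof (cases md)
        case True
        have m1: "m = 1" using R True by blast
        have "a = 1" using md(2)[OF True, of a] a False by force
        then have "inflationBC X n (\<alpha> a) 1 z p (negation 1) (\<beta> a) (\<gamma> a)"
          using infl[OF a] md(1)[OF True] m1 by simp
        then show ?thesis by (rule irreducible_longest) (use i m1 in auto)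
      next
        case nmd: False
        let ?s = "deg (outer X p) m"
        have w: "\<sigma> 1 \<in> weyl m" using infl[of 1] r unfolding inflationBC_def by simp
        note prime = simple_prime_graph[OF mi(2)[OF nmd]]
        have cases: "\<sigma> a = \<sigma> 1 \<or> \<sigma> a = negation m \<circ> \<sigma> 1"
          using mi(3)[OF nmd, of a] False a by (cases "a = 1") auto
        \<comment> \<open>Multiplying by J complements the inversion graph, and primality is
          invariant under complement.\<close>
        have "prime_graph ?s (\<lambda>i j. (i, j) \<in> invA ?s (iota (outer X p) m (\<sigma> a)))"
        proof (cases "\<sigma> a = \<sigma> 1")
          case False
          then have eq: "\<sigma> a = negation m \<circ> \<sigma> 1" using cases by blast
          have "prime_graph ?s (\<lambda>i j. (i, j) \<in> invA ?s (iota (outer X p) m (negation m \<circ> \<sigma> 1))) \<longleftrightarrow>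
             prime_graph ?s (\<lambda>i j. (i, j) \<notin> invA ?s (iota (outer X p) m (\<sigma> 1)))"
            by (rule prime_graph_cong) (simp only: invA_negation_comp[OF w] Diff_iff simp_thms)
          then show ?thesis unfolding eq using prime by (simp only: prime_graph_not)
        qed (use prime in simp)
        then show ?thesis using irreducible_simple[OF infl[OF a] i mi(1)[OF nmd]] by blast
      qed
    qed
  qed
qed

theorem theorem5p4:
  fixes X :: bctype and n r m p :: nat and z :: "nat \<Rightarrow> nat"
    and \<alpha> :: "nat \<Rightarrow> int \<Rightarrow> int"
    and \<sigma>\<^sub>1 :: "int \<Rightarrow> int" and \<beta>\<^sub>1 :: "nat \<Rightarrow> nat \<Rightarrow> nat" and \<gamma>\<^sub>1 :: "int \<Rightarrow> int"
  assumes "1 \<le> n"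
    and "\<forall>a\<in>{1..r}. \<alpha> a \<in> weyl n"
    and "disj_union (pos_roots X n) r (\<lambda>a. invBC X n (\<alpha> a))"
    and "\<forall>a\<in>{1..r}. invBC X n (\<alpha> a) \<noteq> {}"
    and "(1, deg X n) \<in> invA (deg X n) (iota X n (\<alpha> 1))"
    and "simple_formBC X n (\<alpha> 1) m z p \<sigma>\<^sub>1 \<beta>\<^sub>1 \<gamma>\<^sub>1"
  shows "(\<exists>!(\<sigma>, \<beta>, \<gamma>). inflated_decomp X n r \<alpha> m z p \<sigma>\<^sub>1 \<beta>\<^sub>1 \<gamma>\<^sub>1 \<sigma> \<beta> \<gamma>) \<and>
    (\<forall>\<sigma> \<beta> \<gamma>. inflated_decomp X n r \<alpha> m z p \<sigma>\<^sub>1 \<beta>\<^sub>1 \<gamma>\<^sub>1 \<sigma> \<beta> \<gamma> \<longrightarrow>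
      \<sigma> 1 \<noteq> id \<and> card {a \<in> {2..r}. \<sigma> a \<noteq> id} \<le> 1 \<and>
      (let q = card {a \<in> {1..r}. \<sigma> a \<noteq> id} in
         q = (if minus_decomposableBC X n (\<alpha> 1) then 1 else 2) \<and>
         (\<forall>\<pi>. \<pi> permutes {2..r} \<and> (\<forall>a\<in>{q+1..r}. \<sigma> (\<pi> a) = id) \<longrightarrow>
            (irreducible_decomp (weyl n) (invBC X n) r (\<lambda>a. invBC X n (\<alpha> a)) \<longleftrightarrow>
               irreducible_decomp (weyl m) (invBC (outer X p) m) r
                 (\<lambda>a. invBC (outer X p) m (\<sigma> a)) \<and>
               (\<forall>b\<in>{1..m}. irreducible_decomp (symgrp (z b)) (invA (z b)) r
                  (\<lambda>a. invA (z b) (\<beta> a b))) \<and>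
               irreducible_decomp (weyl p) (invBC X p) r (\<lambda>a. invBC X p (\<gamma> a)) \<and>
               (\<forall>a\<in>{q+1..r}. \<exists>!b. b \<in> {1..m+1} \<and>
                  (if b \<le> m then \<beta> (\<pi> a) b \<noteq> id else \<gamma> (\<pi> a) \<noteq> id)) \<and>
               (\<forall>a\<in>{1..q}. (\<forall>b\<in>{1..m}. \<beta> (\<pi> a) b = id) \<and> \<gamma> (\<pi> a) = id) \<and>
               (minus_decomposableBC X n (\<alpha> 1) \<longrightarrow> m = 1)))))"
proof (unfold Let_def, intro conjI allI impI)
  let ?Y = "outer X p" and ?md = "minus_decomposableBC X n (\<alpha> 1)" and ?s = "deg (outer X p) m"
  note \<alpha> = assms(2) and du = assms(3) and ne = assms(4) and inv = assms(5) and sf = assms(6)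
  note sfc = simple_form_cases[OF sf inv]
  have infl1: "inflationBC X n (\<alpha> 1) m z p \<sigma>\<^sub>1 \<beta>\<^sub>1 \<gamma>\<^sub>1" using sf unfolding simple_formBC_def by blast
  have w: "\<sigma>\<^sub>1 \<in> weyl m" and len: "lengths_ok n m z p" using infl1 unfolding inflationBC_iff by blast+
  \<comment> \<open>The inversion \<open>(1, deg X n)\<close> gives a positive root, so the union
    cannot be empty.\<close>
  have r: "1 \<le> r"
  proof (rule ccontr)
    assume "\<not> 1 \<le> r"
    then have "pos_roots X n = {}" using du unfolding disj_union_def by simp
    moreover have "pair_root X n (1, deg X n) \<in> pos_roots X n"
      using pair_root_pos inv invA_subset by blast
    ultimately show False by simp
  qed
  then have one: "1 \<in> {1..r}" by simp
  have insert: "{1..r} = insert 1 {2..r}" using r by auto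
  have types: "\<sigma> \<in> {1..r} \<rightarrow>\<^sub>E weyl m" "\<beta> \<in> {1..r} \<rightarrow>\<^sub>E (\<Pi>\<^sub>E b\<in>{1..m}. symgrp (z b))"
    "\<gamma> \<in> {1..r} \<rightarrow>\<^sub>E weyl p"
    if "inflated_decomp X n r \<alpha> m z p \<sigma>\<^sub>1 \<beta>\<^sub>1 \<gamma>\<^sub>1 \<sigma> \<beta> \<gamma>" for \<sigma> \<beta> \<gamma>
    by (rule conjunct1[OF that[unfolded inflated_decomp_def]]
        conjunct1[OF conjunct2[OF that[unfolded inflated_decomp_def]]]
        conjunct1[OF conjunct2[OF conjunct2[OF that[unfolded inflated_decomp_def]]]])+
  have infl: "inflationBC X n (\<alpha> a) m z p (\<sigma> a) (\<beta> a) (\<gamma> a)"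
    if "inflated_decomp X n r \<alpha> m z p \<sigma>\<^sub>1 \<beta>\<^sub>1 \<gamma>\<^sub>1 \<sigma> \<beta> \<gamma>" and a: "a \<in> {1..r}" for \<sigma> \<beta> \<gamma> a
  proof (cases "a = 1")
    case True
    have d: "\<sigma> 1 = \<sigma>\<^sub>1" "\<forall>b\<in>{1..m}. \<beta> 1 b = \<beta>\<^sub>1 b" "\<gamma> 1 = \<gamma>\<^sub>1"
      "\<beta> \<in> {1..r} \<rightarrow>\<^sub>E (\<Pi>\<^sub>E b\<in>{1..m}. symgrp (z b))"
      using that(1) unfolding inflated_decomp_def by blast+
    have "\<beta> 1 \<in> (\<Pi>\<^sub>E b\<in>{1..m}. symgrp (z b))" using PiE_mem[OF d(4) one] .
    \<comment> \<open>The given \<open>\<beta>\<^sub>1\<close> is arbitrary outside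
      \<open>{1..m}\<close>, whereas \<open>\<beta> 1\<close> is extensional.\<close>
    then have "\<beta> 1 = restrict \<beta>\<^sub>1 {1..m}" using d(2) by (auto simp: PiE_def extensional_def restrict_def fun_eq_iff)
    then show ?thesis using inflationBC_restrict[OF infl1] d True by simp
  next
    case False
    then have "a \<in> {2..r}" using a by auto
    then show ?thesis using that(1) unfolding inflated_decomp_def by blast
  qed
  show "\<exists>!(\<sigma>, \<beta>, \<gamma>). inflated_decomp X n r \<alpha> m z p \<sigma>\<^sub>1 \<beta>\<^sub>1 \<gamma>\<^sub>1 \<sigma> \<beta> \<gamma>"
  proof -
    obtain S where S: "S 1 = \<sigma>\<^sub>1"
      "\<And>a. a \<in> {1..r} \<Longrightarrow> \<exists>\<beta> \<gamma>. \<beta> \<in> (\<Pi>\<^sub>E b\<in>{1..m}. symgrp (z b)) \<and> inflationBC X n (\<alpha> a) m z p (S a) \<beta> \<gamma>"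
      "?md \<Longrightarrow> \<forall>a\<in>{2..r}. S a = id"
      "\<not> ?md \<Longrightarrow> \<exists>a\<^sub>0\<in>{2..r}. S a\<^sub>0 = negation m \<circ> \<sigma>\<^sub>1 \<and> (\<forall>a\<in>{2..r} - {a\<^sub>0}. S a = id)"
      by (rule outer_elements[OF \<alpha> du inv sf r]) blast
    have "\<exists>B. \<forall>a\<in>{1..r}. B a \<in> (\<Pi>\<^sub>E b\<in>{1..m}. symgrp (z b)) \<and> (\<exists>\<gamma>. inflationBC X n (\<alpha> a) m z p (S a) (B a) \<gamma>)"
      using S(2) by (intro bchoice) blast
    then obtain B where B: "\<And>a. a \<in> {1..r} \<Longrightarrow> B a \<in> (\<Pi>\<^sub>E b\<in>{1..m}. symgrp (z b))"
      "\<And>a. a \<in> {1..r} \<Longrightarrow> \<exists>\<gamma>. inflationBC X n (\<alpha> a) m z p (S a) (B a) \<gamma>" by blast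
    have "\<exists>G. \<forall>a\<in>{1..r}. inflationBC X n (\<alpha> a) m z p (S a) (B a) (G a)"
      using B(2) by (intro bchoice) blast
    then obtain G where G: "\<And>a. a \<in> {1..r} \<Longrightarrow> inflationBC X n (\<alpha> a) m z p (S a) (B a) (G a)" by blast
    define \<sigma> where "\<sigma> = restrict S {1..r}"
    define \<beta> where "\<beta> = restrict B {1..r}"
    define \<gamma> where "\<gamma> = restrict G {1..r}"
    have I: "inflationBC X n (\<alpha> a) m z p (\<sigma> a) (\<beta> a) (\<gamma> a)" if "a \<in> {1..r}" for a
      using G[OF that] that by (simp add: \<sigma>_def \<beta>_def \<gamma>_def)
    have mem: "\<sigma> a \<in> weyl m" "\<gamma> a \<in> weyl p" if "a \<in> {1..r}" for a
      using I[OF that] unfolding inflationBC_def by blast+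
    have s1: "\<sigma> 1 = \<sigma>\<^sub>1" using S(1) one by (simp add: \<sigma>_def)
    have first: "\<forall>b\<in>{1..m}. \<beta> 1 b = \<beta>\<^sub>1 b" "\<gamma> 1 = \<gamma>\<^sub>1"
      using inflationBC_data_unique[OF I[OF one] infl1] by blast+
    \<comment> \<open>All positive roots are read as the inversion set of J, so that componentwise
      splitting applies and gives (i).\<close>
    have "disj_union (invBC X n (negation n)) r (\<lambda>a. invBC X n (\<alpha> a))" using du by (simp add: invBC_negation)
    then have parts: "disj_union (pos_roots ?Y m) r (\<lambda>a. invBC ?Y m (\<sigma> a))"
      "\<forall>b\<in>{1..m}. disj_union (posA (z b)) r (\<lambda>a. invA (z b) (\<beta> a b))"
      "disj_union (pos_roots X p) r (\<lambda>a. invBC X p (\<gamma> a))"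
      using inflationBC_disj_union[OF inflationBC_negation[OF len, of X], of r \<alpha> \<sigma> \<beta> \<gamma>] I
      by (simp_all add: invBC_negation)
    have md: "\<sigma> 1 = longest ?Y m \<and> (\<forall>a\<in>{2..r}. \<sigma> a = id)" if ?md
      using sfc(3)[OF that] s1 S(3)[OF that] by (simp add: longest_eq \<sigma>_def)
    have mi: "simpleBC ?Y m (\<sigma> 1) \<and> (\<exists>\<pi>. \<pi> permutes {2..r} \<and> 2 \<le> r \<and>
             \<sigma> (\<pi> 2) = longest ?Y m \<circ> \<sigma> 1 \<and> (\<forall>a\<in>{3..r}. \<sigma> (\<pi> a) = id))" if nmd: "\<not> ?md"
    proof
      show "simpleBC ?Y m (\<sigma> 1)" using simpleBC_of_simpleA w sfc(4)[OF nmd] s1 by simp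
      obtain a0 where a0: "a0 \<in> {2..r}" "S a0 = negation m \<circ> \<sigma>\<^sub>1" "\<forall>a\<in>{2..r} - {a0}. S a = id"
        using S(4)[OF nmd] by blast
      \<comment> \<open>The relabelling only has to bring the one further nontrivial outer element
        to index 2.\<close>
      let ?\<pi> = "Transposition.transpose 2 a0"
      have "?\<pi> permutes {2..r}" by (rule permutes_swap_id) (use a0 in auto)
      moreover have "\<sigma> (?\<pi> a) = id" if "a \<in> {3..r}" for a
        using that a0 by (cases "a = a0") (auto simp: \<sigma>_def transpose_apply_other)
      moreover have "\<sigma> (?\<pi> 2) = longest ?Y m \<circ> \<sigma> 1"
        using a0 s1 by (simp add: longest_eq \<sigma>_def)
      moreover have "2 \<le> r" using a0 by simp
      ultimately show "\<exists>\<pi>. \<pi> permutes {2..r} \<and> 2 \<le> r \<and>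
             \<sigma> (\<pi> 2) = longest ?Y m \<circ> \<sigma> 1 \<and> (\<forall>a\<in>{3..r}. \<sigma> (\<pi> a) = id)" by blast
    qed
    have D: "inflated_decomp X n r \<alpha> m z p \<sigma>\<^sub>1 \<beta>\<^sub>1 \<gamma>\<^sub>1 \<sigma> \<beta> \<gamma>"
      unfolding inflated_decomp_def
    proof (intro conjI impI)
      show "\<sigma> \<in> {1..r} \<rightarrow>\<^sub>E weyl m" "\<gamma> \<in> {1..r} \<rightarrow>\<^sub>E weyl p"
        using mem unfolding \<sigma>_def \<gamma>_def by (auto simp: PiE_iff)
      show "\<beta> \<in> {1..r} \<rightarrow>\<^sub>E (\<Pi>\<^sub>E b\<in>{1..m}. symgrp (z b))"
        unfolding \<beta>_def restrict_PiE_iff using B(1) by blast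
      show "\<forall>a\<in>{2..r}. inflationBC X n (\<alpha> a) m z p (\<sigma> a) (\<beta> a) (\<gamma> a)" using I by simp
    qed (use s1 first parts md mi in blast)+
    show ?thesis
    proof (rule ex1I[of _ "(\<sigma>, \<beta>, \<gamma>)"])
      fix t assume "case t of (\<sigma>, \<beta>, \<gamma>) \<Rightarrow> inflated_decomp X n r \<alpha> m z p \<sigma>\<^sub>1 \<beta>\<^sub>1 \<gamma>\<^sub>1 \<sigma> \<beta> \<gamma>"
      then obtain \<sigma>' \<beta>' \<gamma>' where t: "t = (\<sigma>', \<beta>', \<gamma>')"
        and D': "inflated_decomp X n r \<alpha> m z p \<sigma>\<^sub>1 \<beta>\<^sub>1 \<gamma>\<^sub>1 \<sigma>' \<beta>' \<gamma>'" by (cases t) auto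
      note u = inflationBC_data_unique[OF infl[OF D'] I]
      note e = types[OF D] and e' = types[OF D']
      have "\<sigma>' = \<sigma>" by (rule PiE_ext[OF e'(1) e(1)]) (rule u(1); assumption)
      moreover have "\<gamma>' = \<gamma>" by (rule PiE_ext[OF e'(3) e(3)]) (rule u(3); assumption)
      moreover have "\<beta>' = \<beta>"
      proof (rule PiE_ext[of _ "{1..r}"])
        show b: "\<beta>' \<in> {1..r} \<rightarrow>\<^sub>E (\<Pi>\<^sub>E b\<in>{1..m}. symgrp (z b))" "\<beta> \<in> {1..r} \<rightarrow>\<^sub>E (\<Pi>\<^sub>E b\<in>{1..m}. symgrp (z b))"
          by (rule e'(2) e(2))+
        fix a assume a: "a \<in> {1..r}"
        show "\<beta>' a = \<beta> a"
          by (rule PiE_ext[OF PiE_mem[OF b(1) a] PiE_mem[OF b(2) a]]) (rule u(2)[OF a a])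
      qed
      ultimately show "t = (\<sigma>, \<beta>, \<gamma>)" using t by simp
    qed (use D in simp)
  qed
  {
    fix \<sigma> \<beta> \<gamma> assume D: "inflated_decomp X n r \<alpha> m z p \<sigma>\<^sub>1 \<beta>\<^sub>1 \<gamma>\<^sub>1 \<sigma> \<beta> \<gamma>"
    note e = D[unfolded inflated_decomp_def] and I = infl[OF D]
    have s1: "\<sigma> 1 = \<sigma>\<^sub>1" using e by blast
    have s1ne: "\<sigma> 1 \<noteq> id" using sfc(2) s1 by simp
    have T1: "{a \<in> {1..r}. \<sigma> a \<noteq> id} = insert 1 {a \<in> {2..r}. \<sigma> a \<noteq> id}" using insert s1ne by auto
    have T2: "\<exists>a0. {a \<in> {2..r}. \<sigma> a \<noteq> id} = {a0} \<and> a0 \<in> {2..r} \<and> \<sigma> a0 = negation m \<circ> \<sigma> 1" if nmd: "\<not> ?md"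
    proof -
      have "\<exists>\<pi>. \<pi> permutes {2..r} \<and> 2 \<le> r \<and> \<sigma> (\<pi> 2) = negation m \<circ> \<sigma> 1 \<and> (\<forall>a\<in>{3..r}. \<sigma> (\<pi> a) = id)"
        using e nmd unfolding longest_eq by argo
      then obtain \<pi> where \<pi>: "\<pi> permutes {2..r}" "2 \<le> r" "\<sigma> (\<pi> 2) = negation m \<circ> \<sigma> 1" "\<forall>a\<in>{3..r}. \<sigma> (\<pi> a) = id"
        by blast
      have in_r: "\<pi> 2 \<in> {2..r}" using permutes_in_image[OF \<pi>(1), of 2] \<pi>(2) by simp
      \<comment> \<open>If J times the outer element were trivial, that element would be J and
        \<open>\<alpha> 1\<close> minus-decomposable. This is what makes q equal to 2 and not
        1.\<close>
      have nid: "\<sigma> (\<pi> 2) \<noteq> id"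
        unfolding \<pi>(3)
      proof
        assume id: "negation m \<circ> \<sigma> 1 = id"
        have "invA ?s (iota ?Y m (\<sigma> 1)) = posA ?s"
          using invA_negation_comp[of "\<sigma> 1" m ?Y] id w s1 invA_subset[of ?s "iota ?Y m \<sigma>\<^sub>1"] by auto
        then have "iota ?Y m (\<sigma> 1) = revperm ?s"
          using invA_inject[OF iota_symgrp revperm_symgrp] w s1 by simp
        then have "inflationA (deg X n) (iota X n (\<alpha> 1)) ?s (sym_lengths X m z p) (revperm ?s) (sym_entries X m z p (\<beta> 1) (\<gamma> 1))"
          using I[OF one] unfolding inflationBC_def by simp
        then have "?md" unfolding minus_decomposableBC_def
          by (rule minus_decomposable_rev) (use sfc(4)[OF nmd] in simp)
        then show False using nmd by simp
      qed
      have only: "a = \<pi> 2" if a: "a \<in> {2..r}" "\<sigma> a \<noteq> id" for a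
      proof -
        have "a \<in> \<pi> ` {2..r}" using permutes_image[OF \<pi>(1)] a(1) by simp
        then obtain b where b: "b \<in> {2..r}" "\<pi> b = a" by blast
        then have "b = 2" using \<pi>(4) a(2) by (cases "b = 2") auto
        then show ?thesis using b by simp
      qed
      have "{a \<in> {2..r}. \<sigma> a \<noteq> id} = {\<pi> 2}"
        by (rule set_eqI) (use in_r nid only in blast)
      then show ?thesis using in_r \<pi>(3) by blast
    qed
    have T3: "{a \<in> {2..r}. \<sigma> a \<noteq> id} = {}" if ?md using e that by blast
    define q where "q = card {a \<in> {1..r}. \<sigma> a \<noteq> id}"
    have card2: "card {a \<in> {2..r}. \<sigma> a \<noteq> id} = (if ?md then 0 else 1)"
      using T2 T3 by (cases ?md) auto
    have "q = Suc (card {a \<in> {2..r}. \<sigma> a \<noteq> id})" unfolding q_def T1 by (rule card_insert_disjoint) auto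
    then have q: "q = (if ?md then 1 else 2)" using card2 by simp
    have md: "\<sigma> a = id" if "?md" "a \<in> {2..r}" for a using T3 that by blast
    have mi: "\<sigma> a = negation m \<circ> \<sigma> 1 \<or> \<sigma> a = id" if nmd: "\<not> ?md" and a: "a \<in> {2..r}" for a
    proof -
      obtain a0 where "{a \<in> {2..r}. \<sigma> a \<noteq> id} = {a0}" "\<sigma> a0 = negation m \<circ> \<sigma> 1" using T2[OF nmd] by blast
      moreover from this(1) a have "\<sigma> a = id \<or> a = a0" by blast
      ultimately show ?thesis by blast
    qed
    have mem: "\<And>a. a \<in> {1..r} \<Longrightarrow> \<sigma> a \<in> weyl m" "\<And>a. a \<in> {1..r} \<Longrightarrow> \<gamma> a \<in> weyl p"
      "\<And>a b. a \<in> {1..r} \<Longrightarrow> b \<in> {1..m} \<Longrightarrow> \<beta> a b \<in> symgrp (z b)"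
      using I unfolding inflationBC_def by blast+
    have irr: "irreducible_decomp (weyl n) (invBC X n) r (\<lambda>a. invBC X n (\<alpha> a)) \<longleftrightarrow>
        (\<forall>a\<in>{1..r}. \<not> reducible (weyl n) (invBC X n) (\<alpha> a))"
      "irreducible_decomp (weyl m) (invBC ?Y m) r (\<lambda>a. invBC ?Y m (\<sigma> a)) \<longleftrightarrow>
        (\<forall>a\<in>{1..r}. \<not> reducible (weyl m) (invBC ?Y m) (\<sigma> a))"
      "irreducible_decomp (weyl p) (invBC X p) r (\<lambda>a. invBC X p (\<gamma> a)) \<longleftrightarrow>
        (\<forall>a\<in>{1..r}. \<not> reducible (weyl p) (invBC X p) (\<gamma> a))"
      by (rule irreducible_decomp_iff, use \<alpha> mem in blast)+
    have irrA: "irreducible_decomp (symgrp (z b)) (invA (z b)) r (\<lambda>a. invA (z b) (\<beta> a b)) \<longleftrightarrow>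
        (\<forall>a\<in>{1..r}. \<not> reducible (symgrp (z b)) (invA (z b)) (\<beta> a b))" if "b \<in> {1..m}" for b
      by (rule irreducible_decomp_iff) (use mem(3) that in blast)
    show "\<sigma> 1 \<noteq> id" by (rule s1ne)
    show "card {a \<in> {2..r}. \<sigma> a \<noteq> id} \<le> 1" using card2 by simp
    show "card {a \<in> {1..r}. \<sigma> a \<noteq> id} = (if minus_decomposableBC X n (\<alpha> 1) then 1 else 2)"
      using q unfolding q_def .
    let ?q = "card {a \<in> {1..r}. \<sigma> a \<noteq> id}"
    fix \<pi> assume "\<pi> permutes {2..r} \<and> (\<forall>a\<in>{?q+1..r}. \<sigma> (\<pi> a) = id)"
    then have \<pi>: "\<pi> permutes {2..r}" "\<forall>a\<in>{q+1..r}. \<sigma> (\<pi> a) = id" unfolding q_def by blast+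
    show "irreducible_decomp (weyl n) (invBC X n) r (\<lambda>a. invBC X n (\<alpha> a)) \<longleftrightarrow>
               irreducible_decomp (weyl m) (invBC ?Y m) r (\<lambda>a. invBC ?Y m (\<sigma> a)) \<and>
               (\<forall>b\<in>{1..m}. irreducible_decomp (symgrp (z b)) (invA (z b)) r
                  (\<lambda>a. invA (z b) (\<beta> a b))) \<and>
               irreducible_decomp (weyl p) (invBC X p) r (\<lambda>a. invBC X p (\<gamma> a)) \<and>
               (\<forall>a\<in>{?q+1..r}. \<exists>!b. b \<in> {1..m+1} \<and>
                  (if b \<le> m then \<beta> (\<pi> a) b \<noteq> id else \<gamma> (\<pi> a) \<noteq> id)) \<and>
               (\<forall>a\<in>{1..?q}. (\<forall>b\<in>{1..m}. \<beta> (\<pi> a) b = id) \<and> \<gamma> (\<pi> a) = id) \<and>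
               (?md \<longrightarrow> m = 1)"
    proof -
      let ?A = "{a \<in> {1..r}. \<sigma> a \<noteq> id}"
      have perm: "\<pi> permutes {1..r}" using \<pi>(1) by (rule permutes_subset) auto
      have inj: "inj_on \<pi> B" for B using permutes_inj[OF perm] by (rule inj_on_subset) simp
      have "card ?A \<le> card {1..r}" by (rule card_mono) auto
      then have qr: "q \<le> r" by (simp add: q_def)
      \<comment> \<open>Beyond q the relabelled outer elements are trivial, so the nontrivial ones
        have new index at most q. As there are exactly q of them, equality follows by counting, and
        conditions indexed by \<open>1..q\<close> and \<open>q+1..r\<close> become conditions on
        \<open>\<sigma> a\<close>.\<close>
      have sub: "?A \<subseteq> \<pi> ` {1..q}"
      proof
        fix a assume a: "a \<in> ?A"
        then have "a \<in> \<pi> ` {1..r}" using permutes_image[OF perm] by simp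
        then obtain b where b: "b \<in> {1..r}" "\<pi> b = a" by blast
        then have "b \<in> {1..q}" using \<pi>(2) a by (cases "b \<le> q") auto
        then show "a \<in> \<pi> ` {1..q}" using b(2) by blast
      qed
      moreover have "card (\<pi> ` {1..q}) = card ?A" by (simp add: card_image[OF inj] q_def)
      ultimately have A: "?A = \<pi> ` {1..q}" by (intro card_subset_eq) auto
      have "{1..r} - ?A = \<pi> ` {1..r} - \<pi> ` {1..q}" unfolding A permutes_image[OF perm] ..
      also have "\<dots> = \<pi> ` ({1..r} - {1..q})" by (rule inj_on_image_set_diff[OF inj, symmetric]) (use qr in auto)
      also have "{1..r} - {1..q} = {q + 1..r}" by auto
      finally have A': "{1..r} - ?A = \<pi> ` {q + 1..r}" .
      have 1: "(\<forall>a\<in>{q+1..r}. P (\<pi> a)) \<longleftrightarrow> (\<forall>a\<in>{1..r}. \<sigma> a = id \<longrightarrow> P a)" for P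
      proof -
        have "(\<forall>a\<in>{q+1..r}. P (\<pi> a)) \<longleftrightarrow> (\<forall>a\<in>{1..r} - ?A. P a)" unfolding A' by blast
        then show ?thesis by blast
      qed
      have 2: "(\<forall>a\<in>{1..q}. P (\<pi> a)) \<longleftrightarrow> (\<forall>a\<in>{1..r}. \<sigma> a \<noteq> id \<longrightarrow> P a)" for P
      proof -
        have "(\<forall>a\<in>{1..q}. P (\<pi> a)) \<longleftrightarrow> (\<forall>a\<in>?A. P a)" unfolding A by blast
        then show ?thesis by blast
      qed
      have e1: "(\<forall>a\<in>{q+1..r}. \<exists>!b. b \<in> {1..m+1} \<and> (if b \<le> m then \<beta> (\<pi> a) b \<noteq> id else \<gamma> (\<pi> a) \<noteq> id)) \<longleftrightarrow>
         (\<forall>a\<in>{1..r}. \<sigma> a = id \<longrightarrow> (\<exists>!b. b \<in> {1..m + 1} \<and> (if b \<le> m then \<beta> a b \<noteq> id else \<gamma> a \<noteq> id)))"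
        by (rule 1[where P = "\<lambda>a. \<exists>!b. b \<in> {1..m + 1} \<and> (if b \<le> m then \<beta> a b \<noteq> id else \<gamma> a \<noteq> id)"])
      have e2: "(\<forall>a\<in>{1..q}. (\<forall>b\<in>{1..m}. \<beta> (\<pi> a) b = id) \<and> \<gamma> (\<pi> a) = id) \<longleftrightarrow>
         (\<forall>a\<in>{1..r}. \<sigma> a \<noteq> id \<longrightarrow> (\<forall>b\<in>{1..m}. \<beta> a b = id) \<and> \<gamma> a = id)"
        by (rule 2[where P = "\<lambda>a. (\<forall>b\<in>{1..m}. \<beta> a b = id) \<and> \<gamma> a = id"])
      have e3: "(\<forall>b\<in>{1..m}. irreducible_decomp (symgrp (z b)) (invA (z b)) r (\<lambda>a. invA (z b) (\<beta> a b))) \<longleftrightarrow>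
         (\<forall>b\<in>{1..m}. \<forall>a\<in>{1..r}. \<not> reducible (symgrp (z b)) (invA (z b)) (\<beta> a b))"
        by (rule ball_cong[OF refl irrA])
      show ?thesis unfolding q_def[symmetric] e1 e2 e3 irr 
      proof (rule irreducibility_criterion[OF I _ sfc(1) r])
        show "\<sigma> a = id" if "?md" "a \<in> {2..r}" for a by (rule md[OF that])
        show "\<sigma> a = negation m \<circ> \<sigma> 1 \<or> \<sigma> a = id" if "\<not> ?md" "a \<in> {2..r}" for a by (rule mi[OF that])
      qed (use ne sfc s1 in auto)
    qed
  }
qed

end
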